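(* (a) For every infinite dimensional normed space $E$, $\Gamma_1(E)$ is non-shrinking. (b) Let $E$ be an infinite dimensional normed space. Suppose that $E$ contains an infinite dimensional subspace $F$ such that $c_0$ is not isomorphic to a subspace of the completion of $F$. Then $\Gamma_2(E)$ is non-shrinking.
   Context: Normed spaces are real; $c_0$ is the Banach space of real sequences converging to $0$; $\overline E$ is the completion of $E$; $B(x,r)$ is the closed ball. A semigroup $\Gamma$ (under composition) of functions from a metric space $X$ to itself is non-shrinking if there are no $g\in\Gamma$, $x\in X$ and $r>0$ such that $g(B(x,r))$ is contained in a finite union of closed balls with radius $<r$. A set $\mathcal S$ of subsets of a metric space is separated if for some $r>0$, $d(S,T)>r$ for all distinct $S,T\in\mathcal S$. $\widehat\Gamma_1(E)$ is the set of all functions $h:E\to E$ (not necessarily continuous) for which there is a set of pairs $\{(S_j,E_j) : j\in J\}$, each $E_j$ a finite dimensional linear subspace of $E$, such that: (1) every $S_j$ is a closed convex subset of $E$; (2) $\{S_j : j\in J\}$ is separated; (3) $\bigcup_{j}S_j$ is bounded; (4) $h(x)-x\in E_j$ for every $j\in J$ and $x\in S_j$, and $h(x)=x$ for every $x\in E\setminus\bigcup_j S_j$. $\Gamma_1(E)$ is the semigroup generated by $\widehat\Gamma_1(E)$ under composition. $\widehat\Gamma_2(E)$ is the set of all functions $h:E\to E$ for which there is a set of pairs $\{(\widehat S_j,E_j) : j\in J\}$, each $E_j$ a finite dimensional linear subspace of $E$, such that: (1) every $\widehat S_j$ is a weakly closed subset of $\overline E$; (2) $\{\widehat S_j : j\in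 J\}$ is locally finite in $\overline E$; (3) $\bigcup_j\widehat S_j$ is bounded; (4) $h(x)-x\in E_j$ for every $j\in J$ and $x\in\widehat S_j\cap E$, and $h(x)=x$ for every $x\in E\setminus\bigcup_j\widehat S_j$. $\Gamma_2(E)$ is the semigroup generated by $\widehat\Gamma_2(E)$ under composition. *)

theory Defs
  imports "HOL-Analysis.Analysis"
begin

text \<open>
  The completion of a normed space is constructed as the space of Cauchy sequences modulo null
  sequences, with the norm of a class being the limit of the norms of a representative.
\<close>

definition cauchy_rel :: "(nat \<Rightarrow> 'a::real_normed_vector) \<Rightarrow> (nat \<Rightarrow> 'a) \<Rightarrow> bool"
  where "cauchy_rel X Y \<longleftrightarrow> Cauchy X \<and> Cauchy Y \<and> (\<lambda>n. X n - Y n) \<longlonglongrightarrow> 0"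

lemma cauchy_rel_refl: "Cauchy X \<Longrightarrow> cauchy_rel X X"
  by (simp add: cauchy_rel_def)

lemma part_equivp_cauchy_rel: "part_equivp cauchy_rel"
proof (rule part_equivpI)
  show "\<exists>X. cauchy_rel X (X :: nat \<Rightarrow> 'a)"
    by (rule exI[of _ "\<lambda>_. 0"]) (simp add: cauchy_rel_def convergent_Cauchy convergent_const)
  show "symp (cauchy_rel :: (nat \<Rightarrow> 'a) \<Rightarrow> _)"
  proof (rule sympI)
    fix X Y :: "nat \<Rightarrow> 'a" assume *: "cauchy_rel X Y"
    then have "(\<lambda>n. - (X n - Y n)) \<longlonglongrightarrow> - 0"
      unfolding cauchy_rel_def by (intro tendsto_minus) auto
    with * show "cauchy_rel Y X" by (simp add: cauchy_rel_def)
  qed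
  show "transp (cauchy_rel :: (nat \<Rightarrow> 'a) \<Rightarrow> _)"
  proof (rule transpI)
    fix X Y Z :: "nat \<Rightarrow> 'a" assume *: "cauchy_rel X Y" "cauchy_rel Y Z"
    then have "(\<lambda>n. (X n - Y n) + (Y n - Z n)) \<longlonglongrightarrow> 0 + 0"
      unfolding cauchy_rel_def by (intro tendsto_add) auto
    with * show "cauchy_rel X Z" by (simp add: cauchy_rel_def)
  qed
qed

lemma Cauchy_norm_seq: "Cauchy (X :: nat \<Rightarrow> 'a::real_normed_vector) \<Longrightarrow> convergent (\<lambda>n. norm (X n))"
proof -
  assume X: "Cauchy X"
  have "Cauchy (\<lambda>n. norm (X n))"
  proof (rule metric_CauchyI)
    fix e :: real assume "0 < e"
    then obtain M where M: "\<forall>m\<ge>M. \<forall>n\<ge>M. dist (X m) (X n) < e"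
      using X by (meson metric_CauchyD)
    have "dist (norm (X m)) (norm (X n)) \<le> dist (X m) (X n)" for m n
      by (simp add: dist_norm norm_triangle_ineq3)
    then show "\<exists>M. \<forall>m\<ge>M. \<forall>n\<ge>M. dist (norm (X m)) (norm (X n)) < e"
      using M by (meson order_le_less_trans)
  qed
  then show ?thesis by (rule Cauchy_convergent)
qed

lemma Cauchy_scaleR_seq: "Cauchy (X :: nat \<Rightarrow> 'a::real_normed_vector) \<Longrightarrow> Cauchy (\<lambda>n. c *\<^sub>R X n)"
  by (rule bounded_linear.Cauchy[OF bounded_linear_scaleR_right])

lemma Cauchy_minus_seq: "Cauchy (X :: nat \<Rightarrow> 'a::real_normed_vector) \<Longrightarrow> Cauchy (\<lambda>n. - X n)"
  using Cauchy_scaleR_seq[of X "-1"] by simp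

lemma Cauchy_add_seq:
  "Cauchy (X :: nat \<Rightarrow> 'a::real_normed_vector) \<Longrightarrow> Cauchy Y \<Longrightarrow> Cauchy (\<lambda>n. X n + Y n)"
proof (rule metric_CauchyI)
  fix e :: real assume X: "Cauchy X" and Y: "Cauchy Y" and "0 < e"
  then have e: "0 < e / 2" by simp
  obtain M N where M: "\<forall>m\<ge>M. \<forall>n\<ge>M. dist (X m) (X n) < e / 2"
    and N: "\<forall>m\<ge>N. \<forall>n\<ge>N. dist (Y m) (Y n) < e / 2"
    using metric_CauchyD[OF X e] metric_CauchyD[OF Y e] by blast
  have "dist (X m + Y m) (X n + Y n) < e" if "m \<ge> max M N" "n \<ge> max M N" for m n
  proof -
    have "dist (X m + Y m) (X n + Y n) \<le> dist (X m) (X n) + dist (Y m) (Y n)"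
      by (rule dist_triangle_add)
    moreover have "dist (X m) (X n) < e / 2" "dist (Y m) (Y n) < e / 2"
      using M N that by auto
    ultimately show ?thesis by linarith
  qed
  then show "\<exists>M. \<forall>m\<ge>M. \<forall>n\<ge>M. dist (X m + Y m) (X n + Y n) < e" by blast
qed

quotient_type (overloaded) 'a norm_completion =
  "nat \<Rightarrow> 'a::real_normed_vector" / partial: cauchy_rel
  by (rule part_equivp_cauchy_rel)

instantiation norm_completion :: (real_normed_vector) real_normed_vector
begin

lift_definition zero_norm_completion :: "'a norm_completion" is "\<lambda>_. 0"
  by (simp add: cauchy_rel_def convergent_Cauchy convergent_const)

lift_definition plus_norm_completion ::
  "'a norm_completion \<Rightarrow> 'a norm_completion \<Rightarrow> 'a norm_completion" is "\<lambda>X Y n. X n + Y n"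
proof -
  fix X X' Y Y' :: "nat \<Rightarrow> 'a" assume *: "cauchy_rel X X'" "cauchy_rel Y Y'"
  then have "(\<lambda>n. (X n - X' n) + (Y n - Y' n)) \<longlonglongrightarrow> 0 + 0"
    unfolding cauchy_rel_def by (intro tendsto_add) auto
  with * show "cauchy_rel (\<lambda>n. X n + Y n) (\<lambda>n. X' n + Y' n)"
    by (simp add: cauchy_rel_def Cauchy_add_seq algebra_simps)
qed

lift_definition uminus_norm_completion :: "'a norm_completion \<Rightarrow> 'a norm_completion"
  is "\<lambda>X n. - X n"
proof -
  fix X X' :: "nat \<Rightarrow> 'a" assume *: "cauchy_rel X X'"
  then have "(\<lambda>n. - (X n - X' n)) \<longlonglongrightarrow> - 0"
    unfolding cauchy_rel_def by (intro tendsto_minus) auto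
  with * show "cauchy_rel (\<lambda>n. - X n) (\<lambda>n. - X' n)"
    by (simp add: cauchy_rel_def Cauchy_minus_seq)
qed

definition minus_norm_completion ::
  "'a norm_completion \<Rightarrow> 'a norm_completion \<Rightarrow> 'a norm_completion"
  where "minus_norm_completion x y = x + - y"

lift_definition scaleR_norm_completion :: "real \<Rightarrow> 'a norm_completion \<Rightarrow> 'a norm_completion"
  is "\<lambda>c X n. c *\<^sub>R X n"
proof -
  fix c and X X' :: "nat \<Rightarrow> 'a" assume *: "cauchy_rel X X'"
  then have "(\<lambda>n. c *\<^sub>R (X n - X' n)) \<longlonglongrightarrow> c *\<^sub>R 0"
    unfolding cauchy_rel_def by (intro tendsto_intros) auto
  with * show "cauchy_rel (\<lambda>n. c *\<^sub>R X n) (\<lambda>n. c *\<^sub>R X' n)"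
    by (simp add: cauchy_rel_def Cauchy_scaleR_seq scaleR_diff_right)
qed

lift_definition norm_norm_completion :: "'a norm_completion \<Rightarrow> real"
  is "\<lambda>X. lim (\<lambda>n. norm (X n))"
proof -
  fix X X' :: "nat \<Rightarrow> 'a" assume *: "cauchy_rel X X'"
  have "(\<lambda>n. norm (X n) - norm (X' n)) \<longlonglongrightarrow> 0"
  proof (rule Lim_null_comparison)
    show "\<forall>\<^sub>F n in sequentially. norm (norm (X n) - norm (X' n)) \<le> norm (X n - X' n)"
      by (simp add: norm_triangle_ineq3)
    show "(\<lambda>n. norm (X n - X' n)) \<longlonglongrightarrow> 0"
      using * unfolding cauchy_rel_def by (simp add: tendsto_norm_zero)
  qed
  moreover have "(\<lambda>n. norm (X' n)) \<longlonglongrightarrow> lim (\<lambda>n. norm (X' n))"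
    using * Cauchy_norm_seq convergent_LIMSEQ_iff unfolding cauchy_rel_def by blast
  ultimately have "(\<lambda>n. (norm (X n) - norm (X' n)) + norm (X' n)) \<longlonglongrightarrow> 0 + lim (\<lambda>n. norm (X' n))"
    by (rule tendsto_add)
  then show "lim (\<lambda>n. norm (X n)) = lim (\<lambda>n. norm (X' n))"
    by (intro limI) simp
qed

definition dist_norm_completion :: "'a norm_completion \<Rightarrow> 'a norm_completion \<Rightarrow> real"
  where "dist_norm_completion x y = norm (x - y)"

definition sgn_norm_completion :: "'a norm_completion \<Rightarrow> 'a norm_completion"
  where "sgn_norm_completion x = inverse (norm x) *\<^sub>R x"

definition uniformity_norm_completion :: "('a norm_completion \<times> 'a norm_completion) filter"
  where "uniformity_norm_completion = (INF e\<in>{0<..}. principal {(x, y). dist x y < e})"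

definition open_norm_completion :: "'a norm_completion set \<Rightarrow> bool"
  where "open_norm_completion U \<longleftrightarrow> (\<forall>x\<in>U. eventually (\<lambda>(x', y). x' = x \<longrightarrow> y \<in> U) uniformity)"

lemma norm_completion_seq:
  "cauchy_rel X X \<Longrightarrow> (\<lambda>n. norm (X n)) \<longlonglongrightarrow> lim (\<lambda>n. norm (X n :: 'a))"
  using Cauchy_norm_seq convergent_LIMSEQ_iff unfolding cauchy_rel_def by blast

instance
proof
  fix x y z :: "'a norm_completion" and a b :: real
  show "x + y + z = x + (y + z)"
    by transfer (simp add: add.assoc cauchy_rel_refl Cauchy_add_seq cauchy_rel_def)
  show "x + y = y + x"
    by transfer (simp add: add.commute cauchy_rel_refl Cauchy_add_seq cauchy_rel_def)
  show "0 + x = x" by transfer simp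
  show "- x + x = 0"
    by transfer (simp add: cauchy_rel_def convergent_Cauchy convergent_const)
  show "x - y = x + - y" by (simp add: minus_norm_completion_def)
  show "a *\<^sub>R (x + y) = a *\<^sub>R x + a *\<^sub>R y"
    by transfer (simp add: scaleR_add_right cauchy_rel_def Cauchy_add_seq Cauchy_scaleR_seq)
  show "(a + b) *\<^sub>R x = a *\<^sub>R x + b *\<^sub>R x"
    by transfer (simp add: scaleR_add_left cauchy_rel_def Cauchy_add_seq Cauchy_scaleR_seq)
  show "a *\<^sub>R b *\<^sub>R x = (a * b) *\<^sub>R x"
    by transfer (simp add: cauchy_rel_def Cauchy_scaleR_seq)
  show "1 *\<^sub>R x = x" by transfer simp
  show "dist x y = norm (x - y)" by (simp add: dist_norm_completion_def)
  show "sgn x = inverse (norm x) *\<^sub>R x" by (simp add: sgn_norm_completion_def)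
  show "(uniformity :: ('a norm_completion \<times> _) filter)
      = (INF e\<in>{0<..}. principal {(x, y). dist x y < e})"
    by (simp add: uniformity_norm_completion_def)
  show "open U = (\<forall>x\<in>U. \<forall>\<^sub>F (x', y) in uniformity. x' = x \<longrightarrow> y \<in> U)"
    for U :: "'a norm_completion set"
    by (simp add: open_norm_completion_def)
  show "(norm x = 0) = (x = 0)"
  proof transfer
    fix X :: "nat \<Rightarrow> 'a" assume X: "cauchy_rel X X"
    have "lim (\<lambda>n. norm (X n)) = 0 \<longleftrightarrow> (\<lambda>n. norm (X n)) \<longlonglongrightarrow> 0"
      using norm_completion_seq[OF X] limI by metis
    also have "\<dots> \<longleftrightarrow> X \<longlonglongrightarrow> 0" by (simp add: tendsto_norm_zero_iff)
    also have "\<dots> \<longleftrightarrow> cauchy_rel X (\<lambda>_. 0)"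
      using X by (simp add: cauchy_rel_def convergent_Cauchy convergent_const)
    finally show "(lim (\<lambda>n. norm (X n)) = 0) = cauchy_rel X (\<lambda>_. 0)" .
  qed
  show "norm (x + y) \<le> norm x + norm y"
  proof transfer
    fix X Y :: "nat \<Rightarrow> 'a" assume X: "cauchy_rel X X" and Y: "cauchy_rel Y Y"
    then have XY: "cauchy_rel (\<lambda>n. X n + Y n) (\<lambda>n. X n + Y n)"
      by (simp add: cauchy_rel_def Cauchy_add_seq)
    show "lim (\<lambda>n. norm (X n + Y n)) \<le> lim (\<lambda>n. norm (X n)) + lim (\<lambda>n. norm (Y n))"
      by (rule LIMSEQ_le[OF norm_completion_seq[OF XY]
            tendsto_add[OF norm_completion_seq[OF X] norm_completion_seq[OF Y]]])
         (simp add: norm_triangle_ineq)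
  qed
  show "norm (a *\<^sub>R x) = \<bar>a\<bar> * norm x"
  proof transfer
    fix a and X :: "nat \<Rightarrow> 'a" assume X: "cauchy_rel X X"
    show "lim (\<lambda>n. norm (a *\<^sub>R X n)) = \<bar>a\<bar> * lim (\<lambda>n. norm (X n))"
      using tendsto_mult[OF tendsto_const norm_completion_seq[OF X], of "\<bar>a\<bar>"]
      by (intro limI) simp
  qed
qed

end

lift_definition embed :: "'a::real_normed_vector \<Rightarrow> 'a norm_completion" is "\<lambda>x _. x"
  by (simp add: cauchy_rel_def convergent_Cauchy convergent_const)

lemma linear_embed: "linear embed"
proof (rule linearI)
  show "embed (x + y) = embed x + embed y" for x y :: 'a
    by transfer (simp add: cauchy_rel_def convergent_Cauchy convergent_const)
  show "embed (c *\<^sub>R x) = c *\<^sub>R embed x" for c and x :: 'a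
    by transfer (simp add: cauchy_rel_def convergent_Cauchy convergent_const)
qed

lemma norm_embed: "norm (embed x) = norm x"
  by transfer simp

lemma dist_embed: "dist (embed x) (embed y) = dist x y"
  by (metis dist_norm linear_diff linear_embed norm_embed)

lemma embed_approx:
  assumes "0 < e"
  shows "\<exists>a. dist z (embed a) < e"
proof -
  have "\<exists>a. norm (z + - embed a) < e"
  proof (use assms in \<open>transfer fixing: e\<close>)
    fix X :: "nat \<Rightarrow> 'a" assume "cauchy_rel X X"
    then have X: "Cauchy X" by (simp add: cauchy_rel_def)
    have "0 < e / 2" using assms by simp
    then obtain M where M: "\<forall>m\<ge>M. \<forall>n\<ge>M. dist (X m) (X n) < e / 2"
      using metric_CauchyD[OF X] by blast
    have "cauchy_rel (\<lambda>n. X n + - X M) (\<lambda>n. X n + - X M)"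
      using Cauchy_add_seq[OF X, of "\<lambda>_. - X M"]
      by (intro cauchy_rel_refl) (simp add: convergent_Cauchy convergent_const)
    then have "(\<lambda>n. norm (X n + - X M)) \<longlonglongrightarrow> lim (\<lambda>n. norm (X n + - X M))"
      by (rule norm_completion_seq)
    then have "lim (\<lambda>n. norm (X n + - X M)) \<le> e / 2"
    proof (rule LIMSEQ_le_const2)
      show "\<exists>N. \<forall>n\<ge>N. norm (X n + - X M) \<le> e / 2"
        using M by (intro exI[of _ M]) (auto simp: dist_norm less_imp_le)
    qed
    then show "\<exists>a. lim (\<lambda>n. norm (X n + - a)) < e"
      using assms by (intro exI[of _ "X M"]) simp
  qed
  then show ?thesis by (simp add: dist_norm)
qed

lemma closure_range_embed: "closure (range embed) = UNIV"
proof -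
  have "z \<in> closure (range embed)" for z :: "'a norm_completion"
    unfolding closure_approachable using embed_approx[of _ z] by (auto simp: dist_commute)
  then show ?thesis by auto
qed

lemma embed_seq_converges:
  assumes "Cauchy X"
  shows "(\<lambda>n. embed (X n)) \<longlonglongrightarrow> abs_norm_completion X"
proof (rule metric_LIMSEQ_I)
  fix e :: real assume "0 < e"
  then have "0 < e / 2" by simp
  then obtain M where M: "\<forall>m\<ge>M. \<forall>n\<ge>M. dist (X m) (X n) < e / 2"
    using metric_CauchyD[OF assms] by blast
  have "dist (embed (X n)) (abs_norm_completion X) < e" if "n \<ge> M" for n
  proof -
    have c: "cauchy_rel (\<lambda>_. X n) (\<lambda>_. X n)" "cauchy_rel X X"
        "cauchy_rel (\<lambda>m. - X m) (\<lambda>m. - X m)"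
      using assms
      by (auto simp: cauchy_rel_def convergent_Cauchy convergent_const Cauchy_minus_seq)
    have c': "cauchy_rel (\<lambda>m. X n + - X m) (\<lambda>m. X n + - X m)"
      using Cauchy_add_seq[of "\<lambda>_. X n" "\<lambda>m. - X m"] c by (simp add: cauchy_rel_def)
    have "dist (embed (X n)) (abs_norm_completion X) = lim (\<lambda>m. norm (X n + - X m))"
      unfolding dist_norm minus_norm_completion_def embed.abs_eq
      using c c' by (simp add: uminus_norm_completion.abs_eq plus_norm_completion.abs_eq
          norm_norm_completion.abs_eq)
    also have "\<dots> \<le> e / 2"
    proof (rule LIMSEQ_le_const2[OF norm_completion_seq[OF c']])
      show "\<exists>N. \<forall>m\<ge>N. norm (X n + - X m) \<le> e / 2"
        using M that by (intro exI[of _ M]) (auto simp: dist_norm less_imp_le)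
    qed
    finally show ?thesis using \<open>0 < e\<close> by simp
  qed
  then show "\<exists>M. \<forall>n\<ge>M. dist (embed (X n)) (abs_norm_completion X) < e" by blast
qed

instance norm_completion :: (real_normed_vector) banach
proof
  fix Z :: "nat \<Rightarrow> 'a norm_completion" assume Z: "Cauchy Z"
  define a where "a n = (SOME a. dist (Z n) (embed a) < inverse (real (Suc n)))" for n
  have a: "dist (Z n) (embed (a n)) < inverse (real (Suc n))" for n
    unfolding a_def by (rule someI_ex, rule embed_approx) simp
  have null: "(\<lambda>n. Z n - embed (a n)) \<longlonglongrightarrow> 0"
    by (rule Lim_null_comparison[OF _ LIMSEQ_inverse_real_of_nat])
       (use a in \<open>simp add: dist_norm less_imp_le\<close>)
  then have "Cauchy (\<lambda>n. - (Z n - embed (a n)))"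
    by (intro Cauchy_minus_seq) (rule LIMSEQ_imp_Cauchy)
  from Cauchy_add_seq[OF Z this] have "Cauchy (\<lambda>n. embed (a n))" by simp
  then have "Cauchy a" unfolding Cauchy_def dist_embed .
  from tendsto_add[OF null embed_seq_converges[OF this]]
  have "Z \<longlonglongrightarrow> abs_norm_completion a" by simp
  then show "convergent Z" by (rule convergentI)
qed

text \<open>
  For a linear subspace \<open>F\<close> of a normed space, the completion of \<open>F\<close> is the closure of \<open>F\<close> in the
  completion of the whole space.
\<close>

definition subspace_completion :: "'a::real_normed_vector set \<Rightarrow> 'a norm_completion set"
  where "subspace_completion F = closure (embed ` F)"

definition finite_dimensional :: "'a::real_vector set \<Rightarrow> bool"
  where "finite_dimensional V \<longleftrightarrow> (\<exists>B. finite B \<and> V = span B)"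

text \<open>The library provides the bounded (continuous) functions on the discrete space \<^typ>\<open>nat\<close>,
  with the supremum norm.\<close>

definition c0 :: "(nat \<Rightarrow>\<^sub>C real) set"
  where "c0 = {x. (\<lambda>n. apply_bcontfun x n) \<longlonglongrightarrow> 0}"

definition isomorphic_subspaces ::
    "'a::real_normed_vector set \<Rightarrow> 'b::real_normed_vector set \<Rightarrow> bool"
  where "isomorphic_subspaces V W \<longleftrightarrow>
    (\<exists>T T'. (\<forall>x\<in>V. \<forall>y\<in>V. T (x + y) = T x + T y) \<and> (\<forall>c. \<forall>x\<in>V. T (c *\<^sub>R x) = c *\<^sub>R T x) \<and>
            homeomorphism V W T T')"

definition weak_topology :: "'a::real_normed_vector topology"
  where "weak_topology = topology_generated_by {blinfun_apply f -` U | f U. open (U :: real set)}"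

text \<open>Since \<^const>\<open>setdist\<close> is \<open>0\<close> if one of its arguments is empty, the convention that the
  distance to the empty set is infinite has to be made explicit.\<close>

definition separated :: "'a::metric_space set set \<Rightarrow> bool"
  where "separated \<S> \<longleftrightarrow>
    (\<exists>r>0. \<forall>S\<in>\<S>. \<forall>T\<in>\<S>. S \<noteq> T \<longrightarrow> S \<noteq> {} \<longrightarrow> T \<noteq> {} \<longrightarrow> setdist S T > r)"

definition non_shrinking :: "('a::metric_space \<Rightarrow> 'a) set \<Rightarrow> bool"
  where "non_shrinking \<Gamma> \<longleftrightarrow>
    \<not> (\<exists>g\<in>\<Gamma>. \<exists>x. \<exists>r>0. \<exists>\<B>. finite \<B> \<and> (\<forall>(y, s)\<in>\<B>. s < r) \<and>
         g ` cball x r \<subseteq> (\<Union>(y, s)\<in>\<B>. cball y s))"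

inductive_set semigroup_generated :: "('a \<Rightarrow> 'a) set \<Rightarrow> ('a \<Rightarrow> 'a) set"
  for G :: "('a \<Rightarrow> 'a) set"
where
  generator: "h \<in> G \<Longrightarrow> h \<in> semigroup_generated G"
| comp: "g \<in> semigroup_generated G \<Longrightarrow> h \<in> semigroup_generated G \<Longrightarrow> g \<circ> h \<in> semigroup_generated G"

text \<open>In both generating sets a family of pairs is a set \<open>P\<close>; as separation and local finiteness
  concern the set of first components, a set paired with several subspaces is counted once.\<close>

definition Gamma1_hat :: "('a::real_normed_vector \<Rightarrow> 'a) set"
  where "Gamma1_hat = {h. \<exists>P :: ('a set \<times> 'a set) set.
    (\<forall>(S, V)\<in>P. subspace V \<and> finite_dimensional V) \<and>
    (\<forall>(S, V)\<in>P. closed S \<and> convex S) \<and>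
    separated (fst ` P) \<and>
    bounded (\<Union>(fst ` P)) \<and>
    (\<forall>(S, V)\<in>P. \<forall>x\<in>S. h x - x \<in> V) \<and>
    (\<forall>x. x \<notin> \<Union>(fst ` P) \<longrightarrow> h x = x)}"

definition Gamma1 :: "('a::real_normed_vector \<Rightarrow> 'a) set"
  where "Gamma1 = semigroup_generated Gamma1_hat"

definition Gamma2_hat :: "('a::real_normed_vector \<Rightarrow> 'a) set"
  where "Gamma2_hat = {h. \<exists>P :: ('a norm_completion set \<times> 'a set) set.
    (\<forall>(S, V)\<in>P. subspace V \<and> finite_dimensional V) \<and>
    (\<forall>(S, V)\<in>P. closedin weak_topology S) \<and>
    locally_finite_in euclidean (fst ` P) \<and>
    bounded (\<Union>(fst ` P)) \<and>
    (\<forall>(S, V)\<in>P. \<forall>x. embed x \<in> S \<longrightarrow> h x - x \<in> V) \<and>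
    (\<forall>x. embed x \<notin> \<Union>(fst ` P) \<longrightarrow> h x = x)}"

definition Gamma2 :: "('a::real_normed_vector \<Rightarrow> 'a) set"
  where "Gamma2 = semigroup_generated Gamma2_hat"

end

theory Submission
  imports Defs "HOL-Homology.Homology" "HOL-Library.Z2"
begin

text \<open>
  Write the points of the sphere around \<open>x\<close> as \<open>x + u\<close>. Call a set of directions \<open>u\<close> antipodally small if
  it has a finite colouring without monochromatic pairs \<open>u, w\<close> for which \<open>norm (u + w)\<close> is arbitrarily
  small. Finite unions of small sets are small, and by a Borsuk--Ulam argument no sphere of an infinite
  dimensional space is small. If \<open>g\<close> moves every \<open>x + u\<close>, for \<open>u\<close> in a set that is not small, within one
  finite dimensional subspace, then finitely many balls of radius less than \<open>r\<close> cannot cover the image: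
  some ball would contain the images of two almost antipodal points displaced by almost the same vector.

  For \<open>Gamma1\<close>, such a set of directions is found by passing to subsets that are not small, one generator at
  a time. Once the displacement so far is almost constant, convexity shows that almost antipodal points lying
  in the same \<open>S\<close> force \<open>S\<close> to come near the displaced centre, which happens for at most one \<open>S\<close>; and
  separation makes the graph of almost antipodal pairs between the other sets 2-colourable.

  For \<open>Gamma2\<close>, only finitely many sets meet the compact set of displaced centres. All others are avoided by
  a cube of steps \<open>u i\<close> in \<open>F\<close>, each chosen in the kernel of finitely many functionals that witness weak
  closedness. If all sums of \<open>\<plusminus> u i\<close> were bounded, then, as \<open>c0\<close> does not embed, the series would converge
  unconditionally and the cubes would stay in a compact set, which local finiteness forbids. So the cubes
  grow, and contain images of spheres of every dimension.
\<close>

subsection \<open>A colouring theorem for spheres\<close>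

lemma bit_add_self [simp]: "(x::bit) + x = 0"
  by (cases x) auto

text \<open>The vertex map of the face opposite to vertex \<open>k\<close>: the increasing injection
  whose range misses \<open>k\<close>.\<close>

definition skip :: "nat \<Rightarrow> nat \<Rightarrow> nat" where
  "skip k j = (if j < k then j else Suc j)"

lemma skip_0 [simp]: "skip 0 j = Suc j"
  and skip_Suc_0 [simp]: "skip (Suc k) 0 = 0"
  and skip_Suc_Suc [simp]: "skip (Suc k) (Suc j) = Suc (skip k j)"
  by (auto simp: skip_def)

text \<open>On a simplex with vertices \<open>t 0\<close>, ..., \<open>t d\<close> this is the cup
  product of the coboundaries of the 0-cochains \<open>s 0\<close>, ..., \<open>s (d - 1)\<close>.
  The plus sign stands for a difference, as the uses are in characteristic 2.\<close>

definition sign_changes :: "nat \<Rightarrow> (nat \<Rightarrow> 'a \<Rightarrow> 'b::comm_ring_1) \<Rightarrow> (nat \<Rightarrow> 'a) \<Rightarrow> 'b" where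
  "sign_changes d s t = (\<Prod>i<d. s i (t i) + s i (t (Suc i)))"

lemma sign_changes_0 [simp]: "sign_changes 0 s t = 1"
  by (simp add: sign_changes_def)

lemma sign_changes_Suc:
  "sign_changes (Suc d) s t =
     (s 0 (t 0) + s 0 (t 1)) * sign_changes d (\<lambda>i. s (Suc i)) (\<lambda>i. t (Suc i))"
  by (simp add: sign_changes_def prod.lessThan_Suc_shift del: prod.lessThan_Suc)

text \<open>A cup product of coboundaries is a cocycle. The induction splits off the first factor,
  which depends only on the initial edge of a face.\<close>

lemma sign_changes_cocycle:
  fixes s :: "nat \<Rightarrow> 'a \<Rightarrow> 'b::comm_ring_1"
  assumes char2: "\<And>x::'b. x + x = 0"
  shows "(\<Sum>k\<le>Suc d. sign_changes d s (\<lambda>j. t (skip k j))) = 0"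
proof (induction d arbitrary: s t)
  case 0
  then show ?case by (simp add: char2)
next
  case (Suc d)
  let ?s = "\<lambda>i. s (Suc i)" and ?t = "\<lambda>i. t (Suc i)"
  define A where "A = sign_changes d ?s (\<lambda>i. ?t (Suc i))"
  define B where "B = (\<Sum>k\<le>d. sign_changes d ?s (\<lambda>j. ?t (skip (Suc k) j)))"
  have IH: "A + B = 0"
    using Suc[of ?s ?t] unfolding A_def B_def by (simp add: sum.atMost_Suc_shift del: sum.atMost_Suc)
  \<comment> \<open>Omitting vertex 0 or 1 changes the initial edge and leaves the same tail, hence
    \<open>A\<close> twice; every other face keeps the edge from \<open>t 0\<close> to
    \<open>t 1\<close>, hence \<open>B\<close>.\<close>
  have "(\<Sum>k\<le>Suc (Suc d). sign_changes (Suc d) s (\<lambda>j. t (skip k j))) =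
     (s 0 (t 1) + s 0 (t 2)) * A + ((s 0 (t 0) + s 0 (t 2)) * A + (s 0 (t 0) + s 0 (t 1)) * B)"
    unfolding A_def B_def
    by (simp only: sum.atMost_Suc_shift sign_changes_Suc sum_distrib_left skip_0 skip_Suc_0 skip_Suc_Suc
        One_nat_def numeral_2_eq_2 o_def)
  also have "\<dots> = (s 0 (t 0) + s 0 (t 1)) * (A + B) + (s 0 (t 2) * A + s 0 (t 2) * A)"
    by (simp only: algebra_simps)
  also have "\<dots> = 0"
    using IH char2 by simp
  finally show ?case .
qed

text \<open>Leibniz rule: the product of the 0-cochain \<open>s 0\<close> with a cocycle has as
  coboundary the product of the coboundary of \<open>s 0\<close> with that cocycle.\<close>

lemma sum_faces_sign_changes:
  fixes s :: "nat \<Rightarrow> 'a \<Rightarrow> 'b::comm_ring_1"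
  assumes char2: "\<And>x::'b. x + x = 0"
  shows "(\<Sum>k\<le>Suc d. s 0 (t (skip k 0)) * sign_changes d (\<lambda>i. s (Suc i)) (\<lambda>j. t (skip k j)))
    = sign_changes (Suc d) s t"
proof -
  let ?s = "\<lambda>i. s (Suc i)"
  define A where "A = sign_changes d ?s (\<lambda>j. t (Suc j))"
  define B where "B = (\<Sum>k\<le>d. sign_changes d ?s (\<lambda>j. t (skip (Suc k) j)))"
  have "A + B = 0"
    using sign_changes_cocycle[OF char2, of d ?s t] unfolding A_def B_def
    by (simp only: sum.atMost_Suc_shift skip_0 o_def)
  then have "B = A"
    using char2[of A] by (metis add_left_cancel)
  have "(\<Sum>k\<le>Suc d. s 0 (t (skip k 0)) * sign_changes d ?s (\<lambda>j. t (skip k j))) = s 0 (t 1) * A + s 0 (t 0) * B"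
    unfolding A_def B_def
    by (simp only: sum.atMost_Suc_shift sum_distrib_left skip_0 skip_Suc_0 One_nat_def)
  also have "\<dots> = sign_changes (Suc d) s t"
    unfolding \<open>B = A\<close> unfolding A_def by (simp only: sign_changes_Suc algebra_simps)
  finally show ?thesis .
qed

section \<open>Evaluation of mod 2 cochains on singular chains\<close>

definition vertex :: "nat \<Rightarrow> nat \<Rightarrow> real" where
  "vertex j = (\<lambda>i. if i = j then 1 else 0)"

lemma vertex_in_standard_simplex [simp]: "vertex j \<in> standard_simplex p \<longleftrightarrow> j \<le> p"
  by (simp add: vertex_def)

lemma simplical_face_vertex: "simplical_face k (vertex j) = vertex (skip k j)"
  by (auto simp: simplical_face_def vertex_def skip_def fun_eq_iff)

lemma singular_face_vertex:
  "j \<le> p \<Longrightarrow> singular_face (Suc p) k f (vertex j) = f (vertex (skip k j))"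
  by (simp add: singular_face_def simplical_face_vertex)

text \<open>The value of the mod 2 cochain \<open>F\<close> on an integral chain. Passing through
  the free abelian group on one generator makes additivity an instance of that of
  \<open>frag_extend\<close>.\<close>

definition chain_eval :: "(((nat \<Rightarrow> real) \<Rightarrow> 'a) \<Rightarrow> bit) \<Rightarrow> 'a chain \<Rightarrow> bit" where
  "chain_eval F c = of_int (Poly_Mapping.lookup
     (frag_extend (\<lambda>f. frag_cmul (if F f = 0 then 0 else 1) (frag_of ())) c) ())"

lemma chain_eval_0 [simp]: "chain_eval F 0 = 0"
  by (simp add: chain_eval_def)

lemma chain_eval_diff: "chain_eval F (a - b) = chain_eval F a + chain_eval F b"
  by (simp add: chain_eval_def frag_extend_diff lookup_minus)

lemma chain_eval_minus: "chain_eval F (- a) = chain_eval F a"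
  using chain_eval_diff[of F 0 a] by simp

lemma chain_eval_add: "chain_eval F (a + b) = chain_eval F a + chain_eval F b"
  using chain_eval_diff[of F a "- b"] by (simp add: chain_eval_minus)

lemma chain_eval_sum: "chain_eval F (sum g I) = (\<Sum>i\<in>I. chain_eval F (g i))"
  by (induction I rule: infinite_finite_induct) (auto simp: chain_eval_add)

lemma chain_eval_sign_cmul: "chain_eval F (frag_cmul ((-1) ^ k) a) = chain_eval F a"
  by (cases "even k") (auto simp: chain_eval_minus)

lemma chain_eval_of: "chain_eval F (frag_of f) = F f"
  by (cases "F f") (simp_all add: chain_eval_def)

lemma chain_eval_cong:
  assumes "singular_chain p X c" and "\<And>f. singular_simplex p X f \<Longrightarrow> F f = G f"
  shows "chain_eval F c = chain_eval G c"
  using assms(1) unfolding singular_chain_def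
  by (induction rule: frag_induction) (auto simp: chain_eval_of chain_eval_diff assms(2))

lemma chain_eval_eq_0:
  assumes "\<And>f. f \<in> Poly_Mapping.keys c \<Longrightarrow> F f = 0"
  shows "chain_eval F c = 0"
  using subset_refl[of "Poly_Mapping.keys c"]
  by (induction rule: frag_induction) (auto simp: chain_eval_of chain_eval_diff assms)

abbreviation vertices :: "((nat \<Rightarrow> real) \<Rightarrow> 'a) \<Rightarrow> nat \<Rightarrow> 'a" where
  "vertices f \<equiv> \<lambda>j. f (vertex j)"

text \<open>The Leibniz rule summed over the simplices of a chain; the alternating signs of the
  boundary disappear mod 2.\<close>

lemma chain_eval_boundary:
  fixes s :: "nat \<Rightarrow> 'a \<Rightarrow> bit"
  assumes "singular_chain (Suc p) X c"
  shows "chain_eval (\<lambda>f. s 0 (vertices f 0) * sign_changes p (\<lambda>i. s (Suc i)) (vertices f)) (chain_boundary (Suc p) c)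
    = chain_eval (\<lambda>f. sign_changes (Suc p) s (vertices f)) c"
  using assms unfolding singular_chain_def
proof (induction rule: frag_induction)
  case (one f)
  have *: "sign_changes p (\<lambda>i. s (Suc i)) (vertices (singular_face (Suc p) k f))
      = sign_changes p (\<lambda>i. s (Suc i)) (\<lambda>j. vertices f (skip k j))" for k
    unfolding sign_changes_def by (intro prod.cong) (auto simp: singular_face_vertex)
  show ?case
    using sum_faces_sign_changes[OF bit_add_self, of s "vertices f" p]
    by (simp only: chain_boundary_of chain_eval_sum chain_eval_sign_cmul chain_eval_of * singular_face_vertex
      le0 nat.distinct if_False o_def)
qed (auto simp: chain_boundary_diff chain_eval_diff)

lemma chain_eval_chain_map:
  assumes "singular_chain p X c"
  shows "chain_eval F (chain_map p g c) = chain_eval (\<lambda>f. F (simplex_map p g f)) c"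
  using assms unfolding singular_chain_def
  by (induction rule: frag_induction) (auto simp: chain_map_diff chain_eval_of chain_eval_diff)

text \<open>The cup product of the coboundaries of the antisymmetric cochains \<open>s i\<close> does not vanish on the
  chain that fills up the sphere.\<close>

lemma chain_eval_equivariant:
  fixes s :: "nat \<Rightarrow> 'a \<Rightarrow> bit"
  assumes c: "\<And>p. p \<le> n \<Longrightarrow> singular_chain p X (c p)"
    and c0: "c 0 = frag_of x0"
    and bd: "\<And>p. p < n \<Longrightarrow> chain_boundary (Suc p) (c (Suc p)) = c p + frag_cmul ((-1) ^ Suc p) (chain_map p \<alpha> (c p))"
    and s: "\<And>i x. x \<in> topspace X \<Longrightarrow> s i (\<alpha> x) = s i x + 1"
  shows "p \<le> n \<Longrightarrow> chain_eval (\<lambda>f. sign_changes p s (vertices f)) (c p) = 1"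
  using s
proof (induction p arbitrary: s)
  case 0
  then show ?case by (simp add: c0 chain_eval_of)
next
  case (Suc p)
  let ?s = "\<lambda>i. s (Suc i)"
  let ?A = "\<lambda>f. s 0 (vertices f 0) * sign_changes p ?s (vertices f)"
  have cp: "singular_chain p X (c p)"
    using Suc.prems c by simp
  \<comment> \<open>Applying \<alpha> flips both values in each sign change, which therefore stays
    the same; only the leading factor \<open>s 0\<close> changes, by 1.\<close>
  have *: "?A (simplex_map p \<alpha> f) = ?A f + sign_changes p ?s (vertices f)" if "singular_simplex p X f" for f
  proof -
    have v: "vertices f j \<in> topspace X" if "j \<le> p" for j
    proof -
      have "f \<in> standard_simplex p \<rightarrow> topspace X"
        using \<open>singular_simplex p X f\<close>
        by (auto simp: singular_simplex_def continuous_map_def)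
      then show ?thesis using that by auto
    qed
    have sv: "s i (vertices (simplex_map p \<alpha> f) j) = s i (vertices f j) + 1" if "j \<le> p" for i j
      using that v[OF that] Suc.prems(2) by (simp add: simplex_map_def)
    have "sign_changes p ?s (vertices (simplex_map p \<alpha> f)) = sign_changes p ?s (vertices f)"
      unfolding sign_changes_def
    proof (rule prod.cong)
      fix i assume "i \<in> {..<p}"
      then show "s (Suc i) (vertices (simplex_map p \<alpha> f) i) + s (Suc i) (vertices (simplex_map p \<alpha> f) (Suc i))
         = s (Suc i) (vertices f i) + s (Suc i) (vertices f (Suc i))"
        using sv[of i "Suc i"] sv[of "Suc i" "Suc i"]
        by (cases "s (Suc i) (vertices f i)"; cases "s (Suc i) (vertices f (Suc i))") auto
    qed simp
    then show ?thesis
      by (simp only: sv le0 distrib_right mult_1)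
  qed
  have "chain_eval (\<lambda>f. sign_changes (Suc p) s (vertices f)) (c (Suc p)) = chain_eval ?A (chain_boundary (Suc p) (c (Suc p)))"
    using chain_eval_boundary[of p X "c (Suc p)" s] c Suc.prems by simp
  also have "\<dots> = chain_eval ?A (c p) + chain_eval (\<lambda>f. ?A (simplex_map p \<alpha> f)) (c p)"
    using bd[of p] Suc.prems by (simp only: chain_eval_add chain_eval_sign_cmul chain_eval_chain_map[OF cp] Suc_le_lessD)
  also have "chain_eval (\<lambda>f. ?A (simplex_map p \<alpha> f)) (c p) = chain_eval (\<lambda>f. ?A f + sign_changes p ?s (vertices f)) (c p)"
    by (rule chain_eval_cong[OF cp]) (rule *)
  also have "\<dots> = chain_eval ?A (c p) + chain_eval (\<lambda>f. sign_changes p ?s (vertices f)) (c p)"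
    using cp unfolding singular_chain_def
    by (induction rule: frag_induction) (simp_all only: chain_eval_0 chain_eval_of chain_eval_diff add.left_commute add.assoc add.commute add_0_left)
  also have "chain_eval (\<lambda>f. sign_changes p ?s (vertices f)) (c p) = 1"
    using Suc by simp
  \<comment> \<open>The two evaluations of \<open>?A\<close> cancel mod 2, which leaves the value 1
    from the induction hypothesis for the shifted signs.\<close>
  finally show ?case
    by (simp only: bit_add_self add_0_left flip: add.assoc)
qed

section \<open>Equivariant chains on spheres\<close>

abbreviation antipode :: "(nat \<Rightarrow> real) \<Rightarrow> nat \<Rightarrow> real" where
  "antipode x \<equiv> \<lambda>i. - x i"

lemma continuous_map_antipode: "continuous_map (nsphere n) (nsphere n) antipode"
proof -
  have "continuous_map (nsphere n) (powertop_real UNIV) antipode"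
    unfolding continuous_map_componentwise_UNIV
    by (intro allI continuous_intros continuous_map_nsphere_projection)
  then show ?thesis
    unfolding nsphere continuous_map_in_subtopology by (auto simp: nsphere)
qed

lemma antipode_neq: "x \<in> topspace (nsphere n) \<Longrightarrow> antipode x \<noteq> x"
  by (force simp: nsphere fun_eq_iff)

text \<open>In degrees other than 0 and \<open>n\<close> the homology of the \<open>n\<close>-sphere
  vanishes; in positive degrees it agrees with reduced homology.\<close>

lemma singular_cycle_nsphere_boundary:
  assumes "0 < p" "p \<noteq> n" and c: "singular_chain p (nsphere n) c" "chain_boundary p c = 0"
  obtains d where "singular_chain (Suc p) (nsphere n) d" "chain_boundary (Suc p) d = c"
proof -
  let ?H = "homology_group (int p) (nsphere n)"
  have "trivial_group ?H"
    using trivial_reduced_homology_group_nsphere[of "int p" n] assms by (simp add: un_reduced_homology_group)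
  moreover have "homologous_rel_set p (nsphere n) {} c \<in> carrier ?H"
    using c by (auto simp: carrier_relative_homology_group singular_cycle)
  ultimately have "singular_relboundary p (nsphere n) {} c"
    by (auto simp: trivial_group_def homologous_rel_set_eq_relboundary)
  then show thesis
    using that by (auto simp: singular_boundary)
qed

text \<open>Half a great circle joins a point to its antipode. This starts the construction of
  hemispheres in degree 0, where homology does not vanish.\<close>

lemma half_circle_chain:
  assumes "0 < n"
  obtains c x0 where "singular_simplex 0 (nsphere n) x0" "singular_chain 1 (nsphere n) c"
    "chain_boundary 1 c = frag_of x0 - chain_map 0 antipode (frag_of x0)"
proof -
  define g where "g \<equiv> \<lambda>t::nat\<Rightarrow>real. \<lambda>i. if i = 0 then cos (pi * t 0) else if i = (1::nat) then sin (pi * t 0) else 0"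
  define f where "f = restrict g (standard_simplex 1)"
  let ?S = "\<lambda>p. subtopology (powertop_real UNIV) (standard_simplex p)"
  have proj: "continuous_map (?S 1) euclideanreal (\<lambda>t. t 0)"
    by (intro continuous_map_from_subtopology continuous_map_product_projection UNIV_I)
  have "continuous_map (?S 1) euclideanreal (\<lambda>t. cos (pi * t 0))"
    "continuous_map (?S 1) euclideanreal (\<lambda>t. sin (pi * t 0))"
    by (auto intro!: continuous_map_compose[OF proj, unfolded o_def] continuous_intros simp: continuous_map_iff_continuous2
        simp del: One_nat_def)
  then have "continuous_map (?S 1) (powertop_real UNIV) g"
    unfolding continuous_map_componentwise_UNIV by (auto simp: g_def)
  moreover have "(\<Sum>i\<le>n. (g t i)\<^sup>2) = 1" for t
  proof -
    have "(\<Sum>i\<le>n. (g t i)\<^sup>2) = (\<Sum>i\<in>{0,1}. (g t i)\<^sup>2)"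
      using assms by (intro sum.mono_neutral_right) (auto simp: g_def)
    then show ?thesis by (simp add: g_def)
  qed
  ultimately have cg: "continuous_map (?S 1) (nsphere n) g"
    using assms unfolding nsphere continuous_map_in_subtopology by (auto simp: g_def)
  then have f: "singular_simplex 1 (nsphere n) f"
    by (simp add: singular_simplex_def f_def continuous_map_eq[OF cg])
  have v0: "g (vertex 1) = antipode (g (vertex 0))"
    by (auto simp: g_def vertex_def fun_eq_iff)
  have ss0: "standard_simplex 0 = {vertex 0}"
    by (simp add: standard_simplex_0 vertex_def)
  have face: "singular_face 1 k f = restrict (\<lambda>_. g (vertex (skip k 0))) (standard_simplex 0)" if "k \<le> 1" for k
    unfolding singular_face_def diff_self_eq_0 One_nat_def[symmetric] ss0
    using that by (intro restrict_ext) (simp add: f_def simplical_face_vertex skip_def)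
  let ?x = "singular_face 1 0 f" and ?y = "singular_face 1 1 f"
  have y: "singular_simplex 0 (nsphere n) ?y"
    using singular_simplex_singular_face[OF f, of 1] by simp
  have "chain_boundary 1 (frag_of f) = frag_of ?x - frag_of ?y"
    by (simp add: chain_boundary_of)
  moreover have "?x = simplex_map 0 antipode ?y"
    unfolding face[OF le_refl] face[OF zero_le_one] simplex_map_def
    by (intro ext) (auto simp: skip_def v0[unfolded One_nat_def] restrict_def)
  ultimately have "chain_boundary 1 (- frag_of f) = frag_of ?y - chain_map 0 antipode (frag_of ?y)"
    by (simp add: chain_boundary_minus)
  then show thesis
    using that[OF y, of "- frag_of f"] f by (simp add: singular_chain_minus singular_chain_of)
qed

text \<open>\<open>c p\<close> plays the part of a \<open>p\<close>-dimensional hemisphere, bounded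
  by the two hemispheres one dimension lower. With the alternating sign the prescribed boundary is a
  cycle, because the antipodal map is an involution; below degree \<open>n\<close> it then
  bounds.\<close>

lemma equivariant_sphere_chains:
  assumes "0 < n"
  obtains c x0 where "\<And>p. p \<le> n \<Longrightarrow> singular_chain p (nsphere n) (c p)" "c 0 = frag_of x0"
    "\<And>p. p < n \<Longrightarrow> chain_boundary (Suc p) (c (Suc p)) = c p + frag_cmul ((-1) ^ Suc p) (chain_map p antipode (c p))"
proof -
  let ?X = "nsphere n"
  obtain x0 d where x0: "singular_simplex 0 ?X x0" and d: "singular_chain 1 ?X d"
    "chain_boundary 1 d = frag_of x0 - chain_map 0 antipode (frag_of x0)"
    using half_circle_chain[OF assms] by metis
  define Q where "Q m c \<longleftrightarrow> (\<forall>p\<le>m. singular_chain p ?X (c p)) \<and> c 0 = frag_of x0 \<and>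
     (\<forall>p<m. chain_boundary (Suc p) (c (Suc p)) = c p + frag_cmul ((-1) ^ Suc p) (chain_map p antipode (c p)))"
    for m and c :: "nat \<Rightarrow> (nat \<Rightarrow> real) chain"
  have "m \<le> n \<Longrightarrow> \<exists>c. Q m c" for m
  proof (induction m)
    case 0
    have "Q 0 (\<lambda>_. frag_of x0)"
      using x0 by (simp add: Q_def singular_chain_of)
    then show ?case by blast
  next
    case (Suc m)
    then obtain c where c: "Q m c" by auto
    let ?z = "c m + frag_cmul ((-1) ^ Suc m) (chain_map m antipode (c m))"
    have cm: "singular_chain m ?X (c m)"
      using c by (auto simp: Q_def)
    have "\<exists>e. singular_chain (Suc m) ?X e \<and> chain_boundary (Suc m) e = ?z"
    proof (cases m)
      case 0
      then show ?thesis using d c by (auto simp: Q_def)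
    next
      case (Suc k)
      have ck: "singular_chain k ?X (c k)" and bd: "chain_boundary m (c m) = c k + frag_cmul ((-1) ^ m) (chain_map k antipode (c k))"
        using c Suc by (auto simp: Q_def)
      have aa: "chain_map k antipode (chain_map k antipode (c k)) = c k"
      proof -
        have "chain_map k (antipode \<circ> antipode) (c k) = c k"
          by (rule chain_map_id_gen[OF ck]) auto
        then show ?thesis
          using chain_map_compose[of k antipode antipode] by (simp add: fun_eq_iff)
      qed
      have "chain_boundary m (chain_map m antipode (c m)) = chain_map k antipode (chain_boundary m (c m))"
        using chain_boundary_chain_map[OF cm, of antipode] Suc by simp
      also have "\<dots> = chain_map k antipode (c k) + frag_cmul ((-1) ^ m) (c k)"
        unfolding bd chain_map_add chain_map_cmul aa ..
      finally have "chain_boundary m ?z = 0"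
        unfolding chain_boundary_add chain_boundary_cmul bd
        by (cases "even m") (auto simp: frag_cmul_distrib2)
      moreover have "singular_chain m ?X ?z"
        by (intro singular_chain_add singular_chain_cmul cm singular_chain_chain_map[OF cm continuous_map_antipode])
      ultimately show ?thesis
        using singular_cycle_nsphere_boundary[of m n ?z] \<open>Suc m \<le> n\<close> Suc
        by (metis less_irrefl less_eq_Suc_le zero_less_Suc)
    qed
    then obtain e where "singular_chain (Suc m) ?X e" "chain_boundary (Suc m) e = ?z" by blast
    with c have "Q (Suc m) (c(Suc m := e))"
      by (auto simp: Q_def le_Suc_eq less_Suc_eq)
    then show ?case by blast
  qed
  then obtain c where "Q n c" by blast
  then show thesis
    using that[of c x0] by (auto simp: Q_def)
qed

text \<open>Barycentric subdivision commutes with boundaries and with the antipodal map, so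
  subdividing all \<open>c p\<close> equally often keeps the relations while the simplices of
  \<open>c n\<close> become small.\<close>

lemma fine_equivariant_sphere_chains:
  assumes "0 < n" and \<C>: "\<And>U. U \<in> \<C> \<Longrightarrow> openin (nsphere n) U" "topspace (nsphere n) \<subseteq> \<Union>\<C>"
  obtains c x0 where "\<And>p. p \<le> n \<Longrightarrow> singular_chain p (nsphere n) (c p)" "c 0 = frag_of x0"
    "\<And>p. p < n \<Longrightarrow> chain_boundary (Suc p) (c (Suc p)) = c p + frag_cmul ((-1) ^ Suc p) (chain_map p antipode (c p))"
    "\<And>f. f \<in> Poly_Mapping.keys (c n) \<Longrightarrow> \<exists>V\<in>\<C>. f ` standard_simplex n \<subseteq> V"
proof -
  let ?X = "nsphere n"
  obtain c x0 where c: "\<And>p. p \<le> n \<Longrightarrow> singular_chain p ?X (c p)" "c 0 = frag_of x0"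
    "\<And>p. p < n \<Longrightarrow> chain_boundary (Suc p) (c (Suc p)) = c p + frag_cmul ((-1) ^ Suc p) (chain_map p antipode (c p))"
    using equivariant_sphere_chains[OF assms(1)] by metis
  define D where "D k p = (singular_subdivision p ^^ k) (c p)" for k p
  have D: "(\<forall>p\<le>n. singular_chain p ?X (D k p)) \<and> D k 0 = frag_of x0 \<and>
    (\<forall>p<n. chain_boundary (Suc p) (D k (Suc p)) = D k p + frag_cmul ((-1) ^ Suc p) (chain_map p antipode (D k p)))" for k
  proof (induction k)
    case 0
    then show ?case using c by (simp add: D_def)
  next
    case (Suc k)
    have step: "D (Suc k) p = singular_subdivision p (D k p)" for p
      by (simp add: D_def)
    have sd_cmul: "singular_subdivision p (frag_cmul a b) = frag_cmul a (singular_subdivision p b)" for p a and b :: "(nat \<Rightarrow> real) chain"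
      by (simp add: singular_subdivision_def frag_extend_cmul)
    show ?case
    proof (intro conjI allI impI)
      show "singular_chain p ?X (D (Suc k) p)" if "p \<le> n" for p
        using Suc that by (simp add: step singular_chain_singular_subdivision)
      have "singular_chain 0 ?X (D k 0)"
        using Suc by blast
      then show "D (Suc k) 0 = frag_of x0"
        using Suc by (simp add: step singular_subdivision_zero)
      fix p assume p: "p < n"
      then have s: "singular_chain p ?X (D k p)" "singular_chain (Suc p) ?X (D k (Suc p))"
        using Suc by auto
      have "chain_boundary (Suc p) (D (Suc k) (Suc p)) = singular_subdivision p (chain_boundary (Suc p) (D k (Suc p)))"
        using chain_boundary_singular_subdivision[OF s(2)] by (simp add: step)
      also have "\<dots> = singular_subdivision p (D k p + frag_cmul ((-1) ^ Suc p) (chain_map p antipode (D k p)))"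
        using Suc p by simp
      also have "\<dots> = D (Suc k) p + frag_cmul ((-1) ^ Suc p) (chain_map p antipode (D (Suc k) p))"
        by (simp only: singular_subdivision_add sd_cmul naturality_singular_subdivision[OF s(1)] step)
      finally show "chain_boundary (Suc p) (D (Suc k) (Suc p)) = D (Suc k) p + frag_cmul ((-1) ^ Suc p) (chain_map p antipode (D (Suc k) p))" .
    qed
  qed
  obtain k where k: "\<And>f. f \<in> Poly_Mapping.keys (D k n) \<Longrightarrow> \<exists>V\<in>\<C>. f \<in> standard_simplex n \<rightarrow> V"
    using sufficient_iterated_singular_subdivision_exists[OF \<C> c(1)[OF le_refl]]
    unfolding D_def by (metis le_refl)
  show thesis
    using that[of "D k" x0] D[of k] k by (metis image_subset_iff_funcset)
qed

text \<open>A Lusternik--Schnirelmann type statement. A colour class without almost antipodal pairs gives a sign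
  \<open>s i\<close> that is constant near the class, and a simplex that is small and has a vertex in class \<open>i\<close>
  shows no change of \<open>s i\<close>; so the product of the sign changes vanishes on every small simplex.\<close>

theorem antipodal_coloring:
  fixes \<phi> :: "(nat \<Rightarrow> real) \<Rightarrow> 'a::real_normed_vector" and col :: "'a \<Rightarrow> nat"
  assumes "0 < n" and cont: "continuous_map (nsphere n) euclidean \<phi>"
    and odd: "\<And>x. x \<in> topspace (nsphere n) \<Longrightarrow> \<phi> (antipode x) = - \<phi> x"
    and col: "\<And>x. x \<in> topspace (nsphere n) \<Longrightarrow> col (\<phi> x) < n" and "0 < \<epsilon>"
  shows "\<exists>x\<in>topspace (nsphere n). \<exists>y\<in>topspace (nsphere n). col (\<phi> x) = col (\<phi> y) \<and> norm (\<phi> x + \<phi> y) < \<epsilon>"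
proof (rule ccontr)
  let ?X = "nsphere n"
  assume "\<not> ?thesis"
  then have far: "\<epsilon> \<le> norm (\<phi> x + \<phi> y)" if "x \<in> topspace ?X" "y \<in> topspace ?X" "col (\<phi> x) = col (\<phi> y)" for x y
    using that by (meson not_le)
  define \<C> where "\<C> = (\<lambda>z. {x \<in> topspace ?X. \<phi> x \<in> ball z (\<epsilon>/4)}) ` UNIV"
  have op: "openin ?X U" if U: "U \<in> \<C>" for U
  proof -
    obtain z where "U = {x \<in> topspace ?X. \<phi> x \<in> ball z (\<epsilon>/4)}"
      using U unfolding \<C>_def by blast
    then show ?thesis
      using openin_continuous_map_preimage[OF cont, of "ball z (\<epsilon>/4)"] by simp
  qed
  have cov: "topspace ?X \<subseteq> \<Union>\<C>"
  proof
    fix x assume "x \<in> topspace ?X"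
    then have "x \<in> {y \<in> topspace ?X. \<phi> y \<in> ball (\<phi> x) (\<epsilon>/4)}"
      using \<open>0 < \<epsilon>\<close> by simp
    then show "x \<in> \<Union>\<C>"
      unfolding \<C>_def by blast
  qed
  obtain c x0 where c: "\<And>p. p \<le> n \<Longrightarrow> singular_chain p ?X (c p)" "c 0 = frag_of x0"
    "\<And>p. p < n \<Longrightarrow> chain_boundary (Suc p) (c (Suc p)) = c p + frag_cmul ((-1) ^ Suc p) (chain_map p antipode (c p))"
    and small: "\<And>f. f \<in> Poly_Mapping.keys (c n) \<Longrightarrow> \<exists>V\<in>\<C>. f ` standard_simplex n \<subseteq> V"
    using fine_equivariant_sphere_chains[OF \<open>0 < n\<close> op cov] by metis
  \<comment> \<open>The radius \<epsilon>/2 matches the cover: \<phi> varies by less than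
    \<epsilon>/2 on each of its sets, so a simplex with a vertex of colour \<open>i\<close> has all
    its vertices near class \<open>i\<close>.\<close>
  define near where "near i x \<longleftrightarrow> (\<exists>y\<in>topspace ?X. col (\<phi> y) = i \<and> norm (\<phi> x - \<phi> y) < \<epsilon>/2)" for i x
  \<comment> \<open>An antisymmetric default sign. The choice operator is given the same predicate
    by a point and its antipode, hence selects exactly one of the two.\<close>
  define s0 :: "(nat \<Rightarrow> real) \<Rightarrow> bit" where "s0 x = of_bool ((SOME y. y = x \<or> y = antipode x) = x)" for x
  define s :: "nat \<Rightarrow> (nat \<Rightarrow> real) \<Rightarrow> bit" where
    "s i x = (if near i x then 1 else if near i (antipode x) then 0 else s0 x)" for i x
  have aa [simp]: "antipode (antipode x) = x" for x by simp
  have s0: "s0 (antipode x) = s0 x + 1" if "x \<in> topspace ?X" for x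
  proof -
    let ?P = "\<lambda>y. y = x \<or> y = antipode x"
    have "Eps ?P = x \<or> Eps ?P = antipode x"
      by (rule someI[of ?P x]) simp
    moreover have "(\<lambda>y. y = antipode x \<or> y = antipode (antipode x)) = ?P"
      by (auto simp: fun_eq_iff)
    ultimately show ?thesis
      using antipode_neq[OF that] unfolding s0_def by auto
  qed
  \<comment> \<open>Witnesses near \<open>x\<close> and near its antipode would have the same colour
    and be almost antipodal.\<close>
  have not_both: "\<not> (near i x \<and> near i (antipode x))" if x: "x \<in> topspace ?X" for i x
  proof
    assume "near i x \<and> near i (antipode x)"
    then obtain y z where yz: "y \<in> topspace ?X" "z \<in> topspace ?X" "col (\<phi> y) = i" "col (\<phi> z) = i"
      "norm (\<phi> x - \<phi> y) < \<epsilon>/2" "norm (- \<phi> x - \<phi> z) < \<epsilon>/2"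
      using odd[OF x] by (auto simp: near_def)
    have "norm (\<phi> y + \<phi> z) = norm ((\<phi> x - \<phi> y) + (- \<phi> x - \<phi> z))"
      by (subst norm_minus_cancel[symmetric]) (simp add: algebra_simps)
    also have "\<dots> < \<epsilon>"
      using norm_triangle_ineq[of "\<phi> x - \<phi> y" "- \<phi> x - \<phi> z"] yz by linarith
    finally show False
      using far[of y z] yz by auto
  qed
  have s: "s i (antipode x) = s i x + 1" if x: "x \<in> topspace ?X" for i x
    using not_both[OF x, of i] s0[OF x] by (auto simp: s_def)
  have "chain_eval (\<lambda>f. sign_changes n s (vertices f)) (c n) = 1"
  proof (rule chain_eval_equivariant[where X = ?X and \<alpha> = antipode and n = n])
    show "c 0 = frag_of x0" by (rule c)
  qed (auto simp: c s)
  moreover have "chain_eval (\<lambda>f. sign_changes n s (vertices f)) (c n) = 0"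
  proof (rule chain_eval_eq_0)
    fix f assume f: "f \<in> Poly_Mapping.keys (c n)"
    obtain z where z: "f ` standard_simplex n \<subseteq> {x \<in> topspace ?X. \<phi> x \<in> ball z (\<epsilon>/4)}"
      using small[OF f] by (auto simp: \<C>_def)
    have v: "vertices f j \<in> topspace ?X" "dist z (\<phi> (vertices f j)) < \<epsilon>/4" if "j \<le> n" for j
      using z that by (auto simp: image_subset_iff)
    \<comment> \<open>There are as many factors in the product as colours, so the colour of a vertex
      of the simplex names a factor, and that factor is 0.\<close>
    define i where "i = col (\<phi> (vertices f 0))"
    have "i < n"
      using col v(1)[of 0] by (simp add: i_def)
    have "near i (vertices f j)" if "j \<le> n" for j
      unfolding near_def
    proof (intro bexI conjI)
      have "dist (\<phi> (vertices f j)) (\<phi> (vertices f 0)) < \<epsilon>/4 + \<epsilon>/4"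
        using v(2)[OF that] v(2)[of 0] dist_triangle[of "\<phi> (vertices f j)" "\<phi> (vertices f 0)" z]
        by (simp add: dist_commute)
      then show "norm (\<phi> (vertices f j) - \<phi> (vertices f 0)) < \<epsilon>/2"
        by (simp add: dist_norm)
    qed (use v(1)[of 0] in \<open>auto simp: i_def\<close>)
    then have "s i (vertices f i) + s i (vertices f (Suc i)) = 0"
      using \<open>i < n\<close> by (simp add: s_def)
    then show "sign_changes n s (vertices f) = 0"
      unfolding sign_changes_def using \<open>i < n\<close> by (intro prod_zero) auto
  qed
  ultimately show False by simp
qed

subsection \<open>Hahn-Banach\<close>

definition sublinear :: "('a::real_vector \<Rightarrow> real) \<Rightarrow> bool" where
  "sublinear q \<longleftrightarrow> (\<forall>x y. q (x + y) \<le> q x + q y) \<and> (\<forall>c\<ge>0. \<forall>x. q (c *\<^sub>R x) = c * q x)"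

lemma sublinear_ge: "sublinear q \<Longrightarrow> - q (- x) \<le> q x"
proof -
  assume q: "sublinear q"
  have "q 0 = 0" using q unfolding sublinear_def by (metis mult_zero_left order_refl scaleR_zero_left)
  moreover have "q (x + - x) \<le> q x + q (- x)" using q unfolding sublinear_def by blast
  ultimately show ?thesis by simp
qed

text \<open>The largest sublinear functional below \<open>q\<close> that does not exceed \<open>- q a\<close> at \<open>- a\<close>.\<close>

definition shave :: "'a::real_vector \<Rightarrow> ('a \<Rightarrow> real) \<Rightarrow> 'a \<Rightarrow> real" where
  "shave a q x = (INF t\<in>{0..}. q (x + t *\<^sub>R a) - t * q a)"

context
  fixes q :: "'a::real_vector \<Rightarrow> real"
  assumes q: "sublinear q"
begin

text \<open>A lower bound independent of \<open>t\<close>, so that the infimum defining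
  \<open>shave\<close> is that of a set bounded below.\<close>

lemma shave_bound:
  assumes "0 \<le> t"
  shows "- q (- x) \<le> q (x + t *\<^sub>R a) - t * q a"
proof -
  have "t * q a = q (t *\<^sub>R a)"
    using q assms by (simp add: sublinear_def)
  also have "t *\<^sub>R a = (x + t *\<^sub>R a) + - x"
    by simp
  also have "q \<dots> \<le> q (x + t *\<^sub>R a) + q (- x)"
    using q unfolding sublinear_def by blast
  finally show ?thesis by simp
qed

lemma shave_le:
  assumes "0 \<le> t"
  shows "shave a q x \<le> q (x + t *\<^sub>R a) - t * q a"
  unfolding shave_def using assms shave_bound
  by (intro cINF_lower bdd_belowI2[where m="- q (- x)"]) auto

lemma shave_greatest:
  assumes "\<And>t. 0 \<le> t \<Longrightarrow> m \<le> q (x + t *\<^sub>R a) - t * q a"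
  shows "m \<le> shave a q x"
  unfolding shave_def using assms by (intro cINF_greatest) auto

lemma shave_le_self: "shave a q \<le> q"
  using shave_le[of 0] by (simp add: le_fun_def)

lemma shave_minus: "shave a q (- a) \<le> - q a"
proof -
  have "q (0 *\<^sub>R a) = 0 * q a"
    using q unfolding sublinear_def by blast
  then show ?thesis
    using shave_le[of 1 a "- a"] by simp
qed

text \<open>Subadditivity adds the parameters of the two infima. For homogeneity the parameter is
  scaled by \<open>c\<close>; the reverse inequality is the same one for
  \<open>inverse c\<close>.\<close>

lemma sublinear_shave: "sublinear (shave a q)"
  unfolding sublinear_def
proof (intro conjI allI impI)
  fix x y
  have "shave a q (x + y) - (q (x + t *\<^sub>R a) - t * q a) \<le> shave a q y" if t: "0 \<le> t" for t
  proof (rule shave_greatest)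
    fix u :: real assume u: "0 \<le> u"
    have "shave a q (x + y) \<le> q ((x + y) + (t + u) *\<^sub>R a) - (t + u) * q a"
      using t u by (intro shave_le) simp
    also have "(x + y) + (t + u) *\<^sub>R a = (x + t *\<^sub>R a) + (y + u *\<^sub>R a)"
      by (simp add: scaleR_add_left)
    also have "q \<dots> \<le> q (x + t *\<^sub>R a) + q (y + u *\<^sub>R a)"
      using q unfolding sublinear_def by blast
    finally show "shave a q (x + y) - (q (x + t *\<^sub>R a) - t * q a) \<le> q (y + u *\<^sub>R a) - u * q a"
      by (simp add: algebra_simps)
  qed
  then have "shave a q (x + y) - shave a q y \<le> shave a q x"
    by (intro shave_greatest) (simp add: algebra_simps)
  then show "shave a q (x + y) \<le> shave a q x + shave a q y"
    by simp
next
  have q0: "q (c *\<^sub>R x) = c * q x" if "0 \<le> c" for c x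
    using that q by (auto simp: sublinear_def)
  have le: "shave a q (c *\<^sub>R x) \<le> c * shave a q x" if c: "0 < c" for c x
  proof -
    have "shave a q (c *\<^sub>R x) / c \<le> shave a q x"
    proof (rule shave_greatest)
      fix t :: real assume t: "0 \<le> t"
      have "shave a q (c *\<^sub>R x) \<le> q (c *\<^sub>R x + (c * t) *\<^sub>R a) - (c * t) * q a"
        using c t by (intro shave_le) simp
      also have "c *\<^sub>R x + (c * t) *\<^sub>R a = c *\<^sub>R (x + t *\<^sub>R a)"
        by (simp add: scaleR_add_right)
      finally show "shave a q (c *\<^sub>R x) / c \<le> q (x + t *\<^sub>R a) - t * q a"
        using c q0[of c "x + t *\<^sub>R a"] by (simp add: field_simps)
    qed
    then show ?thesis using c by (simp add: field_simps)
  qed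
  fix c :: real and x assume "0 \<le> c"
  then consider "c = 0" | "0 < c" by linarith
  then show "shave a q (c *\<^sub>R x) = c * shave a q x"
  proof cases
    case 1
    have "q 0 = 0" using q0[of 0 0] by simp
    then have "shave a q 0 \<le> 0" "0 \<le> shave a q 0"
      using shave_le[of 0 a 0] q0[of _ a] by (simp, intro shave_greatest) simp
    with 1 show ?thesis by simp
  next
    case 2
    have "shave a q (inverse c *\<^sub>R (c *\<^sub>R x)) \<le> inverse c * shave a q (c *\<^sub>R x)"
      using 2 by (intro le) simp
    then have "c * shave a q x \<le> shave a q (c *\<^sub>R x)"
      using 2 by (simp add: field_simps)
    with le[OF 2, of x] show ?thesis by simp
  qed
qed

end

text \<open>Zorn's lemma gives a minimal sublinear \<open>q\<close> below \<open>p\<close>. By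
  minimality \<open>shave a q = q\<close> for every \<open>a\<close>, so \<open>q\<close> is odd,
  and an odd sublinear functional is linear.\<close>

lemma Hahn_Banach_sublinear:
  fixes p :: "'a::real_vector \<Rightarrow> real"
  assumes "sublinear p"
  obtains f where "linear f" "\<And>x. f x \<le> p x"
proof -
  define A where "A = {q. sublinear q \<and> q \<le> p}"
  \<comment> \<open>The order is reversed, so that the maximal element supplied by Zorn's lemma is a
    minimal functional.\<close>
  define R where "R = {(q, q'). q \<in> A \<and> q' \<in> A \<and> q' \<le> q}"
  have FR: "Field R = A"
    by (auto simp: R_def Field_def)
  have "Partial_order R"
    unfolding partial_order_on_def preorder_on_def FR
    by (auto simp: R_def refl_on_def trans_def antisym_def intro: order_trans)
  moreover have "\<exists>u\<in>Field R. \<forall>q\<in>C. (q, u) \<in> R" if C: "C \<in> Chains R" for C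
  proof (cases "C = {}")
    case True
    then show ?thesis using assms by (auto simp: FR A_def)
  next
    case False
    then obtain q1 where q1: "q1 \<in> C" by blast
    have CA: "C \<subseteq> A" using C by (auto simp: Chains_def R_def)
    have tot: "q \<le> q' \<or> q' \<le> q" if "q \<in> C" "q' \<in> C" for q q'
      using C that by (auto simp: Chains_def R_def)
    define u where "u x = (INF q\<in>C. q x)" for x
    have lo: "- p (- x) \<le> q x" if "q \<in> C" for q x
    proof -
      have "sublinear q" "q (- x) \<le> p (- x)"
        using CA that by (auto simp: A_def le_fun_def)
      then show ?thesis using sublinear_ge[of q x] by simp
    qed
    have u_le: "u x \<le> q x" if "q \<in> C" for q x
      unfolding u_def using that lo by (intro cINF_lower bdd_belowI2[where m="- p (- x)"]) auto
    have u_ge: "m \<le> u x" if "\<And>q. q \<in> C \<Longrightarrow> m \<le> q x" for m x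
      unfolding u_def using that False by (intro cINF_greatest) auto
    have q_add: "q (x + y) \<le> q x + q y" and q_scale: "0 \<le> c \<Longrightarrow> q (c *\<^sub>R x) = c * q x" if "q \<in> C" for q x y c
      using CA that by (auto simp: A_def sublinear_def)
    \<comment> \<open>Two members of the chain are comparable, so the smaller one may be used at
      both arguments.\<close>
    have "u (x + y) \<le> u x + u y" for x y
    proof -
      have "u (x + y) \<le> q x + q' y" if "q \<in> C" "q' \<in> C" for q q'
        using tot[OF that]
      proof
        assume "q \<le> q'"
        then show ?thesis using u_le[OF that(1), of "x + y"] q_add[OF that(1), of x y] by (force simp: le_fun_def intro: order_trans)
      next
        assume "q' \<le> q"
        then show ?thesis using u_le[OF that(2), of "x + y"] q_add[OF that(2), of x y] by (smt (verit) le_funD)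
      qed
      then have "u (x + y) - q x \<le> u y" if "q \<in> C" for q
        using that by (intro u_ge) (metis diff_le_eq add.commute)
      then have "u (x + y) - u y \<le> u x"
        by (intro u_ge) (metis diff_le_eq add.commute)
      then show ?thesis by simp
    qed
    moreover have "u (c *\<^sub>R x) = c * u x" if "0 \<le> c" for c x
    proof (cases "c = 0")
      case True
      have "q 0 = 0" if "q \<in> C" for q using q_scale[OF that, of 0 0] by simp
      then have "u 0 = 0" using u_le[OF q1, of 0] u_ge[of 0 0] q1 by fastforce
      then show ?thesis using True by simp
    next
      case False
      with that have c: "0 < c" by simp
      have "u (c *\<^sub>R x) / c \<le> u x"
        using c u_le[of _ "c *\<^sub>R x"] q_scale by (intro u_ge) (force simp: field_simps)
      moreover have "c * u x \<le> u (c *\<^sub>R x)"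
        using c u_le[of _ x] q_scale by (intro u_ge) force
      ultimately show ?thesis using c by (simp add: field_simps)
    qed
    ultimately have "sublinear u" by (simp add: sublinear_def)
    moreover have "u \<le> p"
      using u_le[OF q1] CA q1 by (force simp: le_fun_def A_def intro: order_trans)
    ultimately have "u \<in> A" by (simp add: A_def)
    then show ?thesis
      using CA u_le unfolding FR by (intro bexI[of _ u]) (auto simp: R_def le_fun_def)
  qed
  ultimately obtain q where q: "q \<in> A" and min: "\<And>q'. q' \<in> A \<Longrightarrow> (q, q') \<in> R \<Longrightarrow> q' = q"
    using Zorns_po_lemma[of R] unfolding FR by blast
  have sq: "sublinear q" and qp: "q \<le> p" using q by (auto simp: A_def)
  have shave_q: "shave a q = q" for a
  proof (rule min)
    show "shave a q \<in> A"
      using sublinear_shave[OF sq] shave_le_self[OF sq] qp by (auto simp: A_def intro: order_trans)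
    then show "(q, shave a q) \<in> R"
      using q shave_le_self[OF sq] by (simp add: R_def)
  qed
  have neg: "q (- x) = - q x" for x
    using shave_minus[OF sq, of x] sublinear_ge[OF sq, of x] by (simp add: shave_q)
  have sc: "q (c *\<^sub>R x) = c * q x" for c x
  proof (cases "0 \<le> c")
    case False
    then have "q ((- c) *\<^sub>R x) = - c * q x"
      using sq unfolding sublinear_def by (metis neg_0_le_iff_le nle_le)
    then show ?thesis
      using neg[of "c *\<^sub>R x"] by simp
  qed (use sq in \<open>auto simp: sublinear_def\<close>)
  have sub: "q (x + y) \<le> q x + q y" for x y
    using sq by (auto simp: sublinear_def)
  have "q (x + y) = q x + q y" for x y
    using sub[of x y] sub[of "- x" "- y"] neg[of "x + y"] by (simp add: neg)
  then have "linear q"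
    by (intro linearI) (auto simp: sc)
  then show thesis
    using qp that by (auto simp: le_fun_def)
qed

text \<open>Dominating \<open>f\<close> by \<open>shave w norm\<close> instead of
  \<open>norm\<close> forces \<open>f (- w) \<le> - norm w\<close>, which gives equality at
  \<open>w\<close>.\<close>

lemma norming_functional:
  fixes w :: "'a::real_normed_vector"
  obtains f where "linear f" "\<And>x. \<bar>f x\<bar> \<le> norm x" "f w = norm w"
proof -
  have sn: "sublinear (norm :: 'a \<Rightarrow> real)"
    by (auto simp: sublinear_def norm_triangle_ineq)
  obtain f where f: "linear f" "\<And>x. f x \<le> shave w norm x"
    using Hahn_Banach_sublinear[OF sublinear_shave[OF sn, of w]] by metis
  have fn: "f x \<le> norm x" for x
    using f(2)[of x] shave_le_self[OF sn, of w] by (auto simp: le_fun_def intro: order_trans)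
  have "\<bar>f x\<bar> \<le> norm x" for x
    using fn[of x] fn[of "- x"] linear_neg[OF f(1), of x] by auto
  moreover have "f w = norm w"
    using fn[of w] f(2)[of "- w"] shave_minus[OF sn, of w] linear_neg[OF f(1), of w] by linarith
  ultimately show thesis
    using f that by blast
qed

subsection \<open>Finite-dimensional subspaces\<close>

text \<open>Induction on the spanning set. The hypothesis for \<open>B\<close> makes
  \<open>span B\<close> closed, so a new vector \<open>b\<close> has positive distance
  \<open>d\<close> from it, and the coefficient of \<open>b\<close> in a vector of norm at most
  \<open>R\<close> is at most \<open>R/d\<close> in absolute value.\<close>

lemma bounded_span_in_compact:
  fixes B :: "'a::real_normed_vector set"
  assumes "finite B"
  shows "\<exists>C. compact C \<and> C \<subseteq> span B \<and> span B \<inter> cball 0 R \<subseteq> C"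
  using assms
proof (induction B arbitrary: R)
  case empty
  then show ?case by (intro exI[of _ "{0}"]) auto
next
  case (insert b B)
  show ?case
  proof (cases "b \<in> span B")
    case True
    then show ?thesis using insert.IH by (simp add: span_redundant)
  next
    case False
    have "closed (span B)"
      unfolding closed_sequential_limits
    proof (intro allI impI)
      fix x l assume x: "(\<forall>n. x n \<in> span B) \<and> x \<longlonglongrightarrow> l"
      then have "bounded (range x)" by (auto intro: convergent_imp_bounded)
      then obtain K where "\<And>n. norm (x n) \<le> K" by (auto simp: bounded_iff)
      moreover obtain C where C: "compact C" "C \<subseteq> span B" "span B \<inter> cball 0 K \<subseteq> C"
        using insert.IH by blast
      ultimately have "\<And>n. x n \<in> C" using x by auto
      then show "l \<in> span B"
        using x C closed_sequentially[OF compact_imp_closed[OF C(1)], of x l] by auto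
    qed
    define d where "d = infdist b (span B)"
    have "span B \<noteq> {}" using span_zero by blast
    then have d: "0 < d"
      using False \<open>closed (span B)\<close> infdist_pos_not_in_closed by (auto simp: d_def)
    obtain C where C: "compact C" "C \<subseteq> span B" "span B \<inter> cball 0 (R + (R/d) * norm b) \<subseteq> C"
      using insert.IH by blast
    let ?I = "(\<lambda>t. t *\<^sub>R b) ` {- (R/d)..R/d}"
    let ?C = "{x + y | x y. x \<in> C \<and> y \<in> ?I}"
    have "compact ?I"
      by (intro compact_continuous_image continuous_intros) auto
    then have "compact ?C" using C(1) by (intro compact_sums) auto
    moreover have "?C \<subseteq> span (insert b B)"
    proof clarify
      fix x t assume "x \<in> C" "t \<in> {- (R/d)..R/d}"
      then show "x + t *\<^sub>R b \<in> span (insert b B)"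
        using C(2) span_mono[of B "insert b B"] by (intro span_add span_scale) (auto intro: span_base)
    qed
    moreover have "span (insert b B) \<inter> cball 0 R \<subseteq> ?C"
    proof
      fix v assume v: "v \<in> span (insert b B) \<inter> cball 0 R"
      then obtain t where t: "v - t *\<^sub>R b \<in> span B"
        by (auto simp: span_insert)
      have "\<bar>t\<bar> * d \<le> norm v"
      proof (cases "t = 0")
        case False
        have "(- (1/t)) *\<^sub>R (v - t *\<^sub>R b) \<in> span B"
          using t by (rule span_scale)
        then have "d \<le> dist b ((- (1/t)) *\<^sub>R (v - t *\<^sub>R b))"
          unfolding d_def by (rule infdist_le)
        also have "\<dots> = norm ((1/t) *\<^sub>R v)"
          using False by (simp add: dist_norm scaleR_diff_right)
        finally show ?thesis using False by (simp add: field_simps)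
      qed simp
      then have tR: "\<bar>t\<bar> \<le> R/d"
        using v d by (simp add: field_simps)
      have "norm (v - t *\<^sub>R b) \<le> norm v + \<bar>t\<bar> * norm b"
        using norm_triangle_ineq4[of v "t *\<^sub>R b"] by simp
      also have "\<dots> \<le> R + (R/d) * norm b"
        using v tR by (intro add_mono mult_right_mono) auto
      finally have "v - t *\<^sub>R b \<in> C" using C(3) t by auto
      moreover have "t *\<^sub>R b \<in> ?I" using tR by (intro imageI) (simp add: abs_le_iff)
      ultimately have "(v - t *\<^sub>R b) + t *\<^sub>R b \<in> ?C" by blast
      then show "v \<in> ?C" by simp
    qed
    ultimately show ?thesis by blast
  qed
qed

lemma finite_dimensional_bounded_in_compact:
  fixes V :: "'a::real_normed_vector set"
  assumes "finite_dimensional V"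
  obtains C where "compact C" "C \<subseteq> V" "V \<inter> cball 0 R \<subseteq> C"
  using assms bounded_span_in_compact unfolding finite_dimensional_def by metis

lemma finite_dimensional_finite_cover:
  fixes V :: "'a::real_normed_vector set"
  assumes "finite_dimensional V" "bounded D" "D \<subseteq> V" "0 < \<delta>"
  obtains Y where "finite Y" "D \<subseteq> (\<Union>y\<in>Y. ball y \<delta>)"
proof -
  obtain R where R: "D \<subseteq> cball 0 R"
    using \<open>bounded D\<close> by (auto simp: bounded_iff subset_iff)
  obtain C where C: "compact C" "V \<inter> cball 0 R \<subseteq> C"
    using finite_dimensional_bounded_in_compact[OF assms(1)] by metis
  obtain Y where "finite Y" "C \<subseteq> (\<Union>y\<in>Y. ball y \<delta>)"
    using compactE_image[OF C(1), of C "\<lambda>y. ball y \<delta>"] \<open>0 < \<delta>\<close> by (metis UN_I centre_in_ball open_ball subsetI)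
  then show thesis using that C R assms(3) by blast
qed

lemma finite_dimensional_0: "finite_dimensional {0}"
  unfolding finite_dimensional_def by (intro exI[of _ "{}"]) auto

lemma finite_dimensional_span_Un:
  assumes "finite_dimensional V" "finite_dimensional W"
  shows "finite_dimensional (span (V \<union> W))"
proof -
  obtain B C where "finite B" "V = span B" "finite C" "W = span C"
    using assms unfolding finite_dimensional_def by auto
  then have "span (V \<union> W) = span (B \<union> C)"
    by (simp add: span_Un span_span)
  with \<open>finite B\<close> \<open>finite C\<close> show ?thesis
    unfolding finite_dimensional_def by (intro exI[of _ "B \<union> C"]) auto
qed

lemma finite_dimensional_span_UN:
  assumes "finite I" "\<And>i. i \<in> I \<Longrightarrow> finite_dimensional (V i)"
  shows "finite_dimensional (span (\<Union>i\<in>I. V i))"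
  using assms
proof (induction I)
  case empty
  then show ?case using finite_dimensional_0 by simp
next
  case (insert i I)
  have "span (\<Union>j\<in>insert i I. V j) = span (V i \<union> span (\<Union>j\<in>I. V j))"
    by (simp add: span_Un span_span)
  then show ?case
    using insert finite_dimensional_span_Un by auto
qed

text \<open>A finite spanning set of the kernel, together with one vector of \<open>F\<close>
  outside the kernel if there is any, would span \<open>F\<close>.\<close>

lemma infinite_dimensional_kernel:
  assumes F: "subspace F" "\<not> finite_dimensional F" and f: "linear (f :: 'a::real_vector \<Rightarrow> real)"
  shows "subspace {y \<in> F. f y = 0} \<and> \<not> finite_dimensional {y \<in> F. f y = 0}"
proof
  show "subspace {y \<in> F. f y = 0}"
    using F(1) linear_add[OF f] linear_scale[OF f] linear_0[OF f]
    by (auto simp: subspace_def)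
  show "\<not> finite_dimensional {y \<in> F. f y = 0}"
  proof
    assume "finite_dimensional {y \<in> F. f y = 0}"
    then obtain B where B: "finite B" "{y \<in> F. f y = 0} = span B"
      by (auto simp: finite_dimensional_def)
    show False
    proof (cases "\<forall>v\<in>F. f v = 0")
      case True
      then have "F = span B" using B by auto
      then show False using B F by (auto simp: finite_dimensional_def)
    next
      case False
      then obtain v where v: "v \<in> F" "f v \<noteq> 0" by blast
      have "F = span (insert v B)"
      proof
        show "span (insert v B) \<subseteq> F"
          using v B(2) span_superset[of B] F(1) by (intro span_minimal) auto
        show "F \<subseteq> span (insert v B)"
        proof
          fix y assume y: "y \<in> F"
          have "y - (f y / f v) *\<^sub>R v \<in> F"
            using y v F(1) by (simp add: subspace_diff subspace_scale)
          moreover have "f (y - (f y / f v) *\<^sub>R v) = 0"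
            using v by (simp add: linear_diff[OF f] linear_scale[OF f])
          ultimately have "y - (f y / f v) *\<^sub>R v \<in> span B"
            using B(2) by blast
          then show "y \<in> span (insert v B)"
            by (auto simp: span_insert)
        qed
      qed
      then show False using B(1) F(2) by (auto simp: finite_dimensional_def)
    qed
  qed
qed

lemma infinite_dimensional_kernels:
  assumes F: "subspace F" "\<not> finite_dimensional F"
    and "finite \<Phi>" "\<And>f. f \<in> \<Phi> \<Longrightarrow> linear (f :: 'a::real_vector \<Rightarrow> real)"
  shows "subspace {y \<in> F. \<forall>f\<in>\<Phi>. f y = 0} \<and> \<not> finite_dimensional {y \<in> F. \<forall>f\<in>\<Phi>. f y = 0}"
  using assms(3,4)
proof (induction \<Phi>)
  case empty
  then show ?case using F by simp
next
  case (insert f \<Phi>)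
  have "{y \<in> F. \<forall>g\<in>insert f \<Phi>. g y = 0} = {y \<in> {y \<in> F. \<forall>g\<in>\<Phi>. g y = 0}. f y = 0}"
    by auto
  then show ?case
    using insert infinite_dimensional_kernel[of "{y \<in> F. \<forall>g\<in>\<Phi>. g y = 0}" f] by auto
qed

lemma infinite_dimensional_nonzero:
  assumes "subspace F" "\<not> finite_dimensional F"
  obtains y where "y \<in> F" "y \<noteq> 0"
  using assms finite_dimensional_0 subspace_0 by (metis singletonI subsetI subset_singletonD empty_iff)

subsection \<open>Antipodally small sets of directions\<close>

definition antipodally_small :: "'a::real_normed_vector set \<Rightarrow> bool" where
  "antipodally_small A \<longleftrightarrow> (\<exists>\<epsilon>>0. \<exists>(col :: 'a \<Rightarrow> nat) m. \<forall>u\<in>A. col u < m \<and>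
     (\<forall>w\<in>A. col u = col w \<longrightarrow> \<epsilon> \<le> norm (u + w)))"

lemma antipodally_smallI:
  assumes "0 < \<epsilon>" "\<And>u. u \<in> A \<Longrightarrow> col u < (m::nat)"
    "\<And>u w. u \<in> A \<Longrightarrow> w \<in> A \<Longrightarrow> col u = col w \<Longrightarrow> \<epsilon> \<le> norm (u + w)"
  shows "antipodally_small A"
  unfolding antipodally_small_def using assms by blast

lemma antipodally_small_subset: "antipodally_small B \<Longrightarrow> A \<subseteq> B \<Longrightarrow> antipodally_small A"
  unfolding antipodally_small_def by (meson subsetD)

lemma antipodally_small_empty [simp]: "antipodally_small {}"
  by (rule antipodally_smallI[of 1]) auto

lemma antipodally_small_Un:
  assumes "antipodally_small A" "antipodally_small B"
  shows "antipodally_small (A \<union> B)"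
proof -
  obtain e1 c1 m1 where 1: "0 < e1" "\<And>u. u \<in> A \<Longrightarrow> c1 u < (m1::nat)"
    "\<And>u w. u \<in> A \<Longrightarrow> w \<in> A \<Longrightarrow> c1 u = c1 w \<Longrightarrow> e1 \<le> norm (u + w)"
    using assms(1) unfolding antipodally_small_def by blast
  obtain e2 c2 m2 where 2: "0 < e2" "\<And>u. u \<in> B \<Longrightarrow> c2 u < (m2::nat)"
    "\<And>u w. u \<in> B \<Longrightarrow> w \<in> B \<Longrightarrow> c2 u = c2 w \<Longrightarrow> e2 \<le> norm (u + w)"
    using assms(2) unfolding antipodally_small_def by blast
  show ?thesis
  proof (rule antipodally_smallI)
    let ?c = "\<lambda>u. if u \<in> A then c1 u else m1 + c2 u"
    show "0 < min e1 e2" using 1 2 by simp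
    show "?c u < m1 + m2" if "u \<in> A \<union> B" for u
      using that 1(2)[of u] 2(2)[of u] by auto
    show "min e1 e2 \<le> norm (u + w)" if "u \<in> A \<union> B" "w \<in> A \<union> B" "?c u = ?c w" for u w
      using that 1(3)[of u w] 2(3)[of u w] 1(2)[of u] 1(2)[of w]
      by (auto split: if_splits simp: min_le_iff_disj)
  qed
qed

lemma antipodally_small_UN:
  "finite I \<Longrightarrow> (\<And>i. i \<in> I \<Longrightarrow> antipodally_small (A i)) \<Longrightarrow> antipodally_small (\<Union>i\<in>I. A i)"
  by (induction I rule: finite_induct) (auto intro: antipodally_small_Un)

text \<open>The tool for passing to subsets: small sets are closed under finite unions, so some
  piece of a finite cover meets \<open>A\<close> in a set that is not small.\<close>

lemma antipodally_small_pigeonhole: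
  assumes "\<not> antipodally_small A" "finite I" "A \<subseteq> (\<Union>i\<in>I. B i)"
  shows "\<exists>i\<in>I. \<not> antipodally_small (A \<inter> B i)"
proof -
  have "A = (\<Union>i\<in>I. A \<inter> B i)" using assms(3) by auto
  then show ?thesis
    using antipodally_small_UN[OF assms(2), of "\<lambda>i. A \<inter> B i"] assms(1) by metis
qed

text \<open>A colouring of \<open>A\<close> with \<open>m\<close> colours is refuted by an odd map
  into \<open>A\<close> from the sphere of dimension \<open>Suc m\<close>.\<close>

lemma not_antipodally_smallI:
  assumes "\<And>n. 0 < n \<Longrightarrow> \<exists>\<phi>. continuous_map (nsphere n) euclidean \<phi> \<and>
     (\<forall>x\<in>topspace (nsphere n). \<phi> (antipode x) = - \<phi> x \<and> \<phi> x \<in> A)"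
  shows "\<not> antipodally_small A"
proof
  assume "antipodally_small A"
  then obtain \<epsilon> col m where *: "0 < \<epsilon>" "\<And>u. u \<in> A \<Longrightarrow> col u < (m::nat)"
    "\<And>u w. u \<in> A \<Longrightarrow> w \<in> A \<Longrightarrow> col u = col w \<Longrightarrow> \<epsilon> \<le> norm (u + w)"
    unfolding antipodally_small_def by blast
  obtain \<phi> where \<phi>: "continuous_map (nsphere (Suc m)) euclidean \<phi>"
    "\<And>x. x \<in> topspace (nsphere (Suc m)) \<Longrightarrow> \<phi> (antipode x) = - \<phi> x"
    "\<And>x. x \<in> topspace (nsphere (Suc m)) \<Longrightarrow> \<phi> x \<in> A"
    using assms[of "Suc m"] by blast
  have "\<exists>x\<in>topspace (nsphere (Suc m)). \<exists>y\<in>topspace (nsphere (Suc m)). col (\<phi> x) = col (\<phi> y) \<and> norm (\<phi> x + \<phi> y) < \<epsilon>"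
    using \<phi> *(1,2) by (intro antipodal_coloring) (auto intro: less_SucI)
  then show False
    using *(3) \<phi>(3) by (meson not_le)
qed

section \<open>Cubes of directions and odd maps of spheres into them\<close>

definition cube :: "nat \<Rightarrow> (nat \<Rightarrow> 'a::real_vector) \<Rightarrow> 'a set" where
  "cube k w = {\<Sum>i<k. t i *\<^sub>R w i | t. \<forall>i. \<bar>t i\<bar> \<le> 1}"

lemma cube_0: "cube 0 w = {0}"
  by (auto simp: cube_def intro: exI[of _ "\<lambda>_. 0"])

lemma cube_Suc: "cube (Suc k) w = {z + s *\<^sub>R w k | z s. z \<in> cube k w \<and> \<bar>s\<bar> \<le> 1}"
proof
  show "cube (Suc k) w \<subseteq> {z + s *\<^sub>R w k | z s. z \<in> cube k w \<and> \<bar>s\<bar> \<le> 1}"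
    by (force simp: cube_def)
  show "{z + s *\<^sub>R w k | z s. z \<in> cube k w \<and> \<bar>s\<bar> \<le> 1} \<subseteq> cube (Suc k) w"
  proof clarify
    fix z and s :: real assume "z \<in> cube k w" and s: "\<bar>s\<bar> \<le> 1"
    then obtain t where t: "z = (\<Sum>i<k. t i *\<^sub>R w i)" "\<forall>i. \<bar>t i\<bar> \<le> 1"
      by (auto simp: cube_def)
    have "(\<Sum>i<k. (t(k := s)) i *\<^sub>R w i) = z"
      unfolding t by (intro sum.cong) auto
    then show "z + s *\<^sub>R w k \<in> cube (Suc k) w"
      unfolding cube_def using t(2) s by (intro CollectI exI[of _ "t(k := s)"]) auto
  qed
qed

lemma cube_cong: "(\<And>i. i < k \<Longrightarrow> w i = w' i) \<Longrightarrow> cube k w = cube k w'"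
  unfolding cube_def by (metis (no_types, lifting) lessThan_iff sum.cong)

text \<open>The functionals \<open>f i\<close> make the vectors \<open>w i\<close> triangular, and the growth condition on the norms then
  keeps \<open>\<Sum>t i *\<^sub>R w i\<close> of norm at least \<open>r\<close> on the boundary of the cube.\<close>

lemma triangular_lower_bound:
  fixes w :: "nat \<Rightarrow> 'a::real_normed_vector"
  assumes lin: "\<And>i. i < k \<Longrightarrow> linear (f i)" and le: "\<And>i x. i < k \<Longrightarrow> \<bar>f i x\<bar> \<le> norm x"
    and diag: "\<And>i. i < k \<Longrightarrow> f i (w i) = norm (w i)"
    and upper: "\<And>i j. i < j \<Longrightarrow> j < k \<Longrightarrow> f i (w j) = (0::real)"
    and grow: "\<And>i. i < k \<Longrightarrow> r + (\<Sum>j<i. norm (w j)) \<le> norm (w i)"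
    and "i < k"
  shows "\<bar>t i\<bar> * r \<le> norm (\<Sum>j<k. t j *\<^sub>R w j)"
proof (cases "0 \<le> r")
  case True
  let ?T = "(\<lambda>j. \<bar>t j\<bar>) ` {..<k}"
  \<comment> \<open>The functional of an index \<open>m\<close> with the largest coefficient is
    applied: it kills the later vectors, and the growth condition outweighs the earlier
    ones.\<close>
  have "Max ?T \<in> ?T" using \<open>i < k\<close> by (intro Max_in) auto
  then obtain m where m: "m < k" "\<bar>t m\<bar> = Max ?T" by auto
  then have max: "\<bar>t j\<bar> \<le> \<bar>t m\<bar>" if "j < k" for j
    using that by (simp add: Max_ge)
  let ?s = "\<Sum>j<k. t j *\<^sub>R w j"
  have split: "{..<k} = {..<m} \<union> {m} \<union> {m<..<k}" using m by auto
  have "f m ?s = (\<Sum>j<k. t j * f m (w j))"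
    using lin[OF m(1)] by (simp add: linear_sum linear_scale)
  also have "\<dots> = (\<Sum>j<m. t j * f m (w j)) + t m * f m (w m) + (\<Sum>j\<in>{m<..<k}. t j * f m (w j))"
    unfolding split by (subst sum.union_disjoint; auto)+
  also have "(\<Sum>j\<in>{m<..<k}. t j * f m (w j)) = 0"
    using upper by (intro sum.neutral) auto
  finally have fs: "f m ?s = (\<Sum>j<m. t j * f m (w j)) + t m * norm (w m)"
    using diag[OF m(1)] by simp
  have "\<bar>\<Sum>j<m. t j * f m (w j)\<bar> \<le> (\<Sum>j<m. \<bar>t j * f m (w j)\<bar>)"
    by (rule sum_abs)
  also have "\<dots> \<le> (\<Sum>j<m. \<bar>t m\<bar> * norm (w j))"
    using max le[OF m(1)] m(1) by (intro sum_mono) (auto simp: abs_mult intro!: mult_mono)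
  finally have "\<bar>\<Sum>j<m. t j * f m (w j)\<bar> \<le> \<bar>t m\<bar> * (\<Sum>j<m. norm (w j))"
    by (simp add: sum_distrib_left)
  moreover have "\<bar>t m\<bar> * (r + (\<Sum>j<m. norm (w j))) \<le> \<bar>t m\<bar> * norm (w m)"
    using grow[OF m(1)] by (intro mult_left_mono) auto
  moreover have "\<bar>t m * norm (w m)\<bar> = \<bar>t m\<bar> * norm (w m)"
    by (simp add: abs_mult)
  ultimately have "\<bar>t m\<bar> * r \<le> \<bar>f m ?s\<bar>"
    unfolding fs distrib_left by linarith
  also have "\<dots> \<le> norm ?s" by (rule le[OF m(1)])
  finally show ?thesis
    using mult_right_mono[OF max[OF \<open>i < k\<close>] True] by linarith
next
  case False
  then show ?thesis
    by (meson abs_ge_zero mult_nonneg_nonpos nle_le norm_ge_zero order_trans)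
qed

text \<open>The step hypothesis is iterated to build good cubes of every dimension with triangular
  edges. The sphere is mapped linearly onto combinations of the edges and then projected radially to
  norm \<open>r\<close>.\<close>

lemma good_directions_not_small:
  fixes F :: "'a::real_normed_vector set" and Good :: "'a set \<Rightarrow> bool"
  assumes F: "subspace F" "\<not> finite_dimensional F" and "0 < r" and Good0: "Good {0}"
    and step: "\<And>G Z R. subspace G \<Longrightarrow> \<not> finite_dimensional G \<Longrightarrow> G \<subseteq> F \<Longrightarrow> Good Z \<Longrightarrow>
       \<exists>v\<in>G. R \<le> norm v \<and> Good {z + s *\<^sub>R v | z s. z \<in> Z \<and> \<bar>s\<bar> \<le> (1::real)}"
  shows "\<not> antipodally_small {u. norm u = r \<and> (\<exists>Z. Good Z \<and> u \<in> Z)}"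
proof (rule not_antipodally_smallI)
  have fam: "\<exists>w f. (\<forall>i<k. linear (f i) \<and> (\<forall>x. \<bar>f i x\<bar> \<le> norm x) \<and> f i (w i) = norm (w i)
      \<and> r + (\<Sum>j<i. norm (w j)) \<le> norm (w i)) \<and> (\<forall>j<k. \<forall>i<j. f i (w j) = (0::real)) \<and> Good (cube k w)"
    (is "\<exists>w f. ?P k w f") for k
  proof (induction k)
    case 0
    then show ?case using Good0 by (simp add: cube_0)
  next
    case (Suc k)
    then obtain w f where wf: "?P k w f" by blast
    \<comment> \<open>The new edge is taken where all earlier norming functionals vanish, which
      gives the triangular form.\<close>
    let ?G = "{y \<in> F. \<forall>g\<in>f ` {..<k}. g y = 0}"
    have "subspace ?G \<and> \<not> finite_dimensional ?G"
      using wf by (intro infinite_dimensional_kernels F) auto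
    then obtain v where v: "v \<in> ?G" "r + (\<Sum>j<k. norm (w j)) \<le> norm v"
      and good: "Good {z + s *\<^sub>R v | z s. z \<in> cube k w \<and> \<bar>s\<bar> \<le> (1::real)}"
      using step[of ?G "cube k w" "r + (\<Sum>j<k. norm (w j))"] wf by auto
    obtain g where g: "linear g" "\<And>x. \<bar>g x\<bar> \<le> norm x" "g v = norm v"
      using norming_functional[of v] by metis
    let ?w = "w(k := v)" and ?f = "f(k := g)"
    have "cube (Suc k) ?w = {z + s *\<^sub>R v | z s. z \<in> cube k w \<and> \<bar>s\<bar> \<le> (1::real)}"
      unfolding cube_Suc using cube_cong[of k ?w w] by auto
    moreover have "(\<Sum>j<i. norm (?w j)) = (\<Sum>j<i. norm (w j))" if "i \<le> k" for i
      using that by (intro sum.cong) auto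
    ultimately have "?P (Suc k) ?w ?f"
      using wf v g good by (auto simp: less_Suc_eq simp del: fun_upd_apply) (auto simp: fun_upd_apply)
    then show ?case by blast
  qed
  fix n :: nat
  obtain w f where wf: "?P (Suc n) w f" using fam by blast
  define \<psi> where "\<psi> x = (\<Sum>i<Suc n. x i *\<^sub>R w i)" for x :: "nat \<Rightarrow> real"
  define \<phi> where "\<phi> x = (r / norm (\<psi> x)) *\<^sub>R \<psi> x" for x
  have lower: "\<bar>x i\<bar> * r \<le> norm (\<psi> x)" if "i < Suc n" for x i
    unfolding \<psi>_def using wf that by (intro triangular_lower_bound[of _ f]) auto
  have pos: "0 < norm (\<psi> x)" if x: "x \<in> topspace (nsphere n)" for x
  proof -
    have "\<exists>i<Suc n. x i \<noteq> 0"
    proof (rule ccontr)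
      assume "\<not> ?thesis"
      then have "(\<Sum>i\<le>n. (x i)\<^sup>2) = 0" by simp
      then show False using x by (simp add: nsphere)
    qed
    then obtain i where "i < Suc n" "x i \<noteq> 0" by blast
    then have "0 < \<bar>x i\<bar> * r" using \<open>0 < r\<close> by simp
    also have "\<dots> \<le> norm (\<psi> x)" using \<open>i < Suc n\<close> by (rule lower)
    finally show ?thesis .
  qed
  have "continuous_map (nsphere n) euclidean (\<lambda>x. x i *\<^sub>R w i)" for i
    by (intro continuous_map_compose[OF continuous_map_nsphere_projection[of n i], of euclidean "\<lambda>t. t *\<^sub>R w i", unfolded o_def])
      (simp add: continuous_map_iff_continuous2 continuous_intros)
  then have c\<psi>: "continuous_map (nsphere n) euclidean \<psi>"
    unfolding \<psi>_def by (intro continuous_map_sum) auto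
  have "continuous_map (nsphere n) (top_of_set (- {0})) \<psi>"
    using c\<psi> pos by (auto simp: continuous_map_in_subtopology)
  moreover have "continuous_map (top_of_set (- {0})) euclidean (\<lambda>y::'a. (r / norm y) *\<^sub>R y)"
    by (auto intro!: continuous_intros)
  ultimately have "continuous_map (nsphere n) euclidean \<phi>"
    using continuous_map_compose unfolding \<phi>_def o_def by fast
  moreover have "\<phi> (antipode x) = - \<phi> x" for x
  proof -
    have "\<psi> (antipode x) = - \<psi> x" by (simp add: \<psi>_def sum_negf del: sum.lessThan_Suc)
    then show ?thesis by (simp add: \<phi>_def)
  qed
  moreover have "norm (\<phi> x) = r \<and> \<phi> x \<in> cube (Suc n) w" if x: "x \<in> topspace (nsphere n)" for x
  proof
    show "norm (\<phi> x) = r" using pos[OF x] \<open>0 < r\<close> by (simp add: \<phi>_def)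
    \<comment> \<open>The lower bound on \<open>norm (\<psi> x)\<close> is exactly what keeps the
      rescaled coordinates in the unit interval, hence \<phi> in the cube.\<close>
    have "\<bar>r / norm (\<psi> x) * x i\<bar> \<le> 1" for i
    proof (cases "i < Suc n")
      case True
      then show ?thesis
        using lower[OF True, of x] pos[OF x] \<open>0 < r\<close> by (simp add: abs_mult field_simps)
    next
      case False
      then show ?thesis using x by (simp add: nsphere)
    qed
    then show "\<phi> x \<in> cube (Suc n) w"
      unfolding cube_def \<phi>_def \<psi>_def scaleR_sum_right
      by (intro CollectI exI[of _ "\<lambda>i. r / norm (\<psi> x) * x i"]) (simp add: \<psi>_def)
  qed
  ultimately show "\<exists>\<phi>. continuous_map (nsphere n) euclidean \<phi> \<and>
     (\<forall>x\<in>topspace (nsphere n). \<phi> (antipode x) = - \<phi> x \<and> \<phi> x \<in> {u. norm u = r \<and> (\<exists>Z. Good Z \<and> u \<in> Z)})"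
    using wf by (intro exI[of _ \<phi>]) auto
qed

lemma sphere_not_small:
  assumes "\<not> finite_dimensional (UNIV :: 'a::real_normed_vector set)" "0 < r"
  shows "\<not> antipodally_small (sphere (0::'a) r)"
proof -
  have "\<not> antipodally_small {u::'a. norm u = r \<and> (\<exists>Z::'a set. True \<and> u \<in> Z)}"
  proof (rule good_directions_not_small[of UNIV _ "\<lambda>_. True"])
    fix G Z :: "'a set" and R :: real
    assume G: "subspace G" "\<not> finite_dimensional G"
    then obtain y where y: "y \<in> G" "y \<noteq> 0" using infinite_dimensional_nonzero by blast
    show "\<exists>v\<in>G. R \<le> norm v \<and> True"
      using y G(1) by (intro bexI[of _ "(R / norm y) *\<^sub>R y"]) (auto simp: subspace_scale)
  qed (use assms in auto)
  then show ?thesis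
    by (rule contrapos_nn) (auto elim!: antipodally_small_subset)
qed

text \<open>Pigeonholing by covering ball and then by displacement, up to
  \<open>(r - s) / 4\<close>, leaves a set that is not small. Its points satisfy
  \<open>norm (u - w) \<le> 2 * s + (r - s) / 2\<close>, so \<open>norm (u + w)\<close> is at least
  \<open>r - s\<close> and one colour suffices, a contradiction.\<close>

lemma displaced_sphere_not_covered:
  fixes g :: "'a::real_normed_vector \<Rightarrow> 'a"
  assumes A: "A \<subseteq> sphere 0 r" "\<not> antipodally_small A"
    and V: "finite_dimensional V" "\<And>u. u \<in> A \<Longrightarrow> g (x + u) - (x + u) \<in> V"
    and B: "finite \<B>" "\<And>y s. (y, s) \<in> \<B> \<Longrightarrow> s < r" "g ` cball x r \<subseteq> (\<Union>(y, s)\<in>\<B>. cball y s)"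
  shows False
proof -
  have gA: "g (x + u) \<in> (\<Union>(y, s)\<in>\<B>. cball y s)" if "u \<in> A" for u
  proof -
    have "x + u \<in> cball x r" using that A(1) by (auto simp: dist_norm)
    then show ?thesis using B(3) by blast
  qed
  have "A \<subseteq> (\<Union>b\<in>\<B>. {u. g (x + u) \<in> cball (fst b) (snd b)})"
  proof
    fix u assume "u \<in> A"
    then obtain y s where "(y, s) \<in> \<B>" "g (x + u) \<in> cball y s"
      using gA[OF \<open>u \<in> A\<close>] by (auto simp del: mem_cball)
    then show "u \<in> (\<Union>b\<in>\<B>. {u. g (x + u) \<in> cball (fst b) (snd b)})"
      by (intro UN_I[of "(y, s)"]) auto
  qed
  from antipodally_small_pigeonhole[OF A(2) B(1) this]
  obtain b where b: "b \<in> \<B>" "\<not> antipodally_small (A \<inter> {u. g (x + u) \<in> cball (fst b) (snd b)})"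
    by blast
  obtain y s where ys: "b = (y, s)" by fastforce
  let ?A = "A \<inter> {u. g (x + u) \<in> cball y s}"
  have s: "s < r" using B(2) b ys by auto
  let ?d = "\<lambda>u. g (x + u) - (x + u)"
  have "bounded (?d ` ?A)"
  proof (rule boundedI)
    fix z assume "z \<in> ?d ` ?A"
    then obtain u where u: "u \<in> ?A" "z = ?d u" by blast
    have "norm z \<le> norm (g (x + u) - y) + norm y + norm x + norm u"
    proof -
      have "z = (g (x + u) - y) + (y - (x + u))" using u(2) by simp
      then have "norm z \<le> norm (g (x + u) - y) + norm (y - (x + u))"
        by (metis norm_triangle_ineq)
      then show ?thesis
        using norm_triangle_ineq4[of y "x + u"] norm_triangle_ineq[of x u] by linarith
    qed
    then show "norm z \<le> s + norm y + norm x + r"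
      using u A(1) by (force simp: dist_norm norm_minus_commute)
  qed
  then obtain Y where Y: "finite Y" "?d ` ?A \<subseteq> (\<Union>v\<in>Y. ball v ((r - s) / 4))"
    using finite_dimensional_finite_cover[OF V(1), of "?d ` ?A" "(r - s) / 4"] V(2) s by auto
  then have cov: "?A \<subseteq> (\<Union>v\<in>Y. {u. ?d u \<in> ball v ((r - s) / 4)})"
    by blast
  have "\<not> antipodally_small ?A" using b(2) by (simp add: ys)
  from antipodally_small_pigeonhole[OF this Y(1) cov]
  obtain v where v: "\<not> antipodally_small (?A \<inter> {u. ?d u \<in> ball v ((r - s) / 4)})"
    by blast
  moreover have "antipodally_small (?A \<inter> {u. ?d u \<in> ball v ((r - s) / 4)})"
  proof (rule antipodally_smallI[where col="\<lambda>_. 0" and m=1])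
    fix u w assume uw: "u \<in> ?A \<inter> {u. ?d u \<in> ball v ((r - s) / 4)}" "w \<in> ?A \<inter> {u. ?d u \<in> ball v ((r - s) / 4)}"
    have "norm (?d u - ?d w) \<le> norm (?d u - v) + norm (?d w - v)"
      using norm_triangle_ineq4[of "?d u - v" "?d w - v"] by simp
    then have 1: "norm (?d u - ?d w) \<le> (r - s) / 2"
      using uw by (auto simp: dist_norm norm_minus_commute)
    have "norm (g (x + u) - g (x + w)) \<le> norm (g (x + u) - y) + norm (g (x + w) - y)"
      using norm_triangle_ineq4[of "g (x + u) - y" "g (x + w) - y"] by simp
    then have 2: "norm (g (x + u) - g (x + w)) \<le> 2 * s"
      using uw by (auto simp: dist_norm norm_minus_commute)
    have "norm (u - w) \<le> norm (g (x + u) - g (x + w)) + norm (?d u - ?d w)"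
      using norm_triangle_ineq4[of "g (x + u) - g (x + w)" "?d u - ?d w"] by (simp add: algebra_simps)
    moreover have "norm (2 *\<^sub>R u) \<le> norm (u + w) + norm (u - w)"
      using norm_triangle_ineq[of "u + w" "u - w"] by (simp add: scaleR_2)
    moreover have "norm u = r" using uw(1) A(1) by auto
    ultimately show "r - s \<le> norm (u + w)"
      using 1 2 s by simp
  qed (use s in auto)
  ultimately show False by blast
qed

subsection \<open>The semigroup \<open>Gamma1\<close>\<close>

lemma separated_dist:
  assumes "\<And>S T. S \<in> \<S> \<Longrightarrow> T \<in> \<S> \<Longrightarrow> S \<noteq> T \<Longrightarrow> S \<noteq> {} \<Longrightarrow> T \<noteq> {} \<Longrightarrow> \<rho> < setdist S T"
    and "S \<in> \<S>" "T \<in> \<S>" "x \<in> S" "y \<in> T" "dist x y \<le> \<rho>"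
  shows "S = T"
  using assms setdist_le_dist[of x S y T] by (metis empty_iff linorder_not_less order_trans)

text \<open>Used with \<open>w\<close> and \<open>w'\<close> both almost antipodal to
  \<open>u\<close>, when \<open>a\<close> and \<open>b\<close> are close to \<open>c + w'\<close>
  and \<open>c + w\<close>: then \<open>a\<close> and \<open>b\<close> are close to each
  other.\<close>

lemma norm_diff_le_shifted:
  fixes a b :: "'a::real_normed_vector"
  shows "norm (a - b) \<le> norm (a - (c + w')) + norm (b - (c + w)) + (norm (u + w') + norm (u + w))"
proof -
  have "a - b = ((a - (c + w')) - (b - (c + w))) + ((u + w') - (u + w))"
    by (simp add: algebra_simps)
  then show ?thesis
    by (metis add_mono norm_triangle_ineq4 norm_triangle_le)
qed

text \<open>\<open>q u\<close> is the position of \<open>x + u\<close> after the earlier generators.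
  Either many directions miss all sets and stay fixed, or one set catches many of them and
  contributes its subspace; otherwise the whole set of directions would be small.\<close>

lemma Gamma1_hat_step:
  fixes h :: "'a::real_normed_vector \<Rightarrow> 'a"
  assumes h: "h \<in> Gamma1_hat" and V: "subspace V" "finite_dimensional V"
    and A: "bounded A" "\<not> antipodally_small A" and q: "\<And>u. u \<in> A \<Longrightarrow> q u - (x + u) \<in> V"
  shows "\<exists>A' V'. A' \<subseteq> A \<and> \<not> antipodally_small A' \<and> subspace V' \<and> finite_dimensional V' \<and>
    (\<forall>u\<in>A'. h (q u) - (x + u) \<in> V')"
proof -
  obtain P :: "('a set \<times> 'a set) set" where P: "\<And>S E. (S, E) \<in> P \<Longrightarrow> subspace E \<and> finite_dimensional E"
    "\<And>S E. (S, E) \<in> P \<Longrightarrow> convex S" "separated (fst ` P)" "bounded (\<Union>(fst ` P))"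
    "\<And>S E y. (S, E) \<in> P \<Longrightarrow> y \<in> S \<Longrightarrow> h y - y \<in> E" "\<And>y. y \<notin> \<Union>(fst ` P) \<Longrightarrow> h y = y"
    using h unfolding Gamma1_hat_def by fast
  let ?\<S> = "fst ` P"
  obtain \<rho> where \<rho>: "0 < \<rho>" "\<And>S T. S \<in> ?\<S> \<Longrightarrow> T \<in> ?\<S> \<Longrightarrow> S \<noteq> T \<Longrightarrow> S \<noteq> {} \<Longrightarrow> T \<noteq> {} \<Longrightarrow> \<rho> < setdist S T"
    using P(3) unfolding separated_def by metis
  have same: "S = T" if "S \<in> ?\<S>" "T \<in> ?\<S>" "y \<in> S" "z \<in> T" "dist y z \<le> \<rho>" for S T y z
    by (rule separated_dist[of ?\<S> \<rho> S T y z]) (use \<rho>(2) that in auto)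
  define A0 where "A0 = {u \<in> A. q u \<notin> \<Union>?\<S>}"
  define A1 where "A1 = {u \<in> A. q u \<in> \<Union>?\<S>}"
  show ?thesis
  proof (cases "antipodally_small A0")
    case False
    then show ?thesis
      using V q P(6) by (intro exI[of _ A0] exI[of _ V]) (auto simp: A0_def)
  next
    case True
    have "A = A0 \<union> A1" by (auto simp: A0_def A1_def)
    then have A1: "\<not> antipodally_small A1"
      using True A(2) antipodally_small_Un by metis
    let ?v = "\<lambda>u. q u - (x + u)"
    have "bounded (?v ` A1)"
    proof -
      obtain M N where M: "\<And>y. y \<in> \<Union>?\<S> \<Longrightarrow> norm y \<le> M" and N: "\<And>u. u \<in> A \<Longrightarrow> norm u \<le> N"
        using P(4) A(1) unfolding bounded_iff by metis
      show ?thesis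
      proof (rule boundedI)
        fix z assume "z \<in> ?v ` A1"
        then obtain u where u: "u \<in> A1" "z = ?v u" by blast
        have "norm z \<le> norm (q u) + (norm x + norm u)"
          using u(2) norm_triangle_ineq4[of "q u" "x + u"] norm_triangle_ineq[of x u] by simp
        also have "\<dots> \<le> M + (norm x + N)"
          using u(1) M[of "q u"] N[of u] by (intro add_mono) (auto simp: A1_def)
        finally show "norm z \<le> M + (norm x + N)" .
      qed
    qed
    then obtain Y where Y: "finite Y" "?v ` A1 \<subseteq> (\<Union>y\<in>Y. ball y (\<rho>/8))"
      using finite_dimensional_finite_cover[OF V(2), of "?v ` A1" "\<rho>/8"] q \<rho>(1) by (auto simp: A1_def)
    then have cov: "A1 \<subseteq> (\<Union>y\<in>Y. {u. ?v u \<in> ball y (\<rho>/8)})"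
      by blast
    from antipodally_small_pigeonhole[OF A1 Y(1) cov]
    obtain v0 where A2: "\<not> antipodally_small (A1 \<inter> {u. ?v u \<in> ball v0 (\<rho>/8)})"
      by blast
    define A2 where "A2 = A1 \<inter> {u. ?v u \<in> ball v0 (\<rho>/8)}"
    \<comment> \<open>The displaced centre: on \<open>A2\<close> the earlier generators act as
      translation by \<open>v0\<close> up to an error below \<rho>/8.\<close>
    define c where "c = x + v0"
    have close: "norm (q u - (c + u)) < \<rho>/8" if "u \<in> A2" for u
      using that by (auto simp: A2_def c_def dist_norm norm_minus_commute algebra_simps)
    show ?thesis
    proof (cases "\<forall>S\<in>?\<S>. antipodally_small {u \<in> A2. q u \<in> S}")
      case False
      then obtain S E where SE: "(S, E) \<in> P" "\<not> antipodally_small {u \<in> A2. q u \<in> S}" by auto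
      have "h (q u) - (x + u) \<in> span (V \<union> E)" if "u \<in> {u \<in> A2. q u \<in> S}" for u
      proof -
        have "h (q u) - q u \<in> E" "q u - (x + u) \<in> V"
          using that P(5)[OF SE(1)] q by (auto simp: A2_def A1_def)
        then have "(h (q u) - q u) + (q u - (x + u)) \<in> span (V \<union> E)"
          by (intro span_add) (auto intro: span_base)
        moreover have "(h (q u) - q u) + (q u - (x + u)) = h (q u) - (x + u)"
          by (simp add: algebra_simps)
        ultimately show ?thesis by metis
      qed
      then show ?thesis
        using SE(2) finite_dimensional_span_Un[OF V(2), of E] P(1)[OF SE(1)]
        by (intro exI[of _ "{u \<in> A2. q u \<in> S}"] exI[of _ "span (V \<union> E)"]) (auto simp: A2_def A1_def)
    next
      case True
      \<comment> \<open>Separation leaves at most one set within \<rho>/4 of the centre, and the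
        directions it catches are small, so they can be discarded.\<close>
      define near where "near S \<longleftrightarrow> S \<in> ?\<S> \<and> (\<exists>y\<in>S. dist y c \<le> \<rho>/4)" for S
      define A3 where "A3 = {u \<in> A2. \<forall>S. near S \<longrightarrow> q u \<notin> S}"
      have near_unique: "S = T" if near: "near S" "near T" for S T
      proof -
        obtain y z where yz: "y \<in> S" "z \<in> T" "dist y c \<le> \<rho>/4" "dist z c \<le> \<rho>/4"
          using near by (auto simp: near_def)
        then have "dist y z \<le> \<rho>"
          using dist_triangle2[of y z c] \<rho>(1) by linarith
        then show ?thesis
          using same[of S T y z] yz near by (auto simp: near_def)
      qed
      have "\<exists>S. A2 \<subseteq> A3 \<union> {u \<in> A2. q u \<in> S} \<and> antipodally_small {u \<in> A2. q u \<in> S}"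
      proof (cases "\<exists>S. near S")
        case True
        then obtain S where S: "near S" by blast
        then have "A2 \<subseteq> A3 \<union> {u \<in> A2. q u \<in> S}"
          using near_unique by (auto simp: A3_def)
        then show ?thesis
          using S \<open>\<forall>S\<in>?\<S>. antipodally_small {u \<in> A2. q u \<in> S}\<close> by (auto simp: near_def)
      next
        case False
        then show ?thesis by (intro exI[of _ "{}"]) (auto simp: A3_def)
      qed
      then have A3: "\<not> antipodally_small A3"
        using A2 unfolding A2_def[symmetric] by (meson antipodally_small_Un antipodally_small_subset)
      moreover have "antipodally_small A3"
      proof -
        define j where "j u = (SOME S. S \<in> ?\<S> \<and> q u \<in> S)" for u
        have j: "j u \<in> ?\<S>" "q u \<in> j u" if "u \<in> A3" for u
        proof -
          have "\<exists>S. S \<in> ?\<S> \<and> q u \<in> S" using that by (auto simp: A3_def A2_def A1_def)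
          then have "j u \<in> ?\<S> \<and> q u \<in> j u" unfolding j_def by (rule someI_ex)
          then show "j u \<in> ?\<S>" "q u \<in> j u" by auto
        qed
        text \<open>Orient each edge \<open>{S, T}\<close> and colour \<open>u\<close> by the orientation of the edge from its own set
          to the only set that can contain almost antipodes of \<open>u\<close>.\<close>
        define win where "win S T \<longleftrightarrow> (SOME X. X = S \<or> X = T) = S" for S T :: "'a set"
        have win: "win S T \<longleftrightarrow> \<not> win T S" if "S \<noteq> T" for S T
        proof -
          have "(SOME X. X = S \<or> X = T) = S \<or> (SOME X. X = S \<or> X = T) = T"
            by (rule someI[of "\<lambda>X. X = S \<or> X = T" S]) simp
          moreover have "(\<lambda>X. X = T \<or> X = S) = (\<lambda>X. X = S \<or> X = T)" by auto
          ultimately show ?thesis using that by (auto simp: win_def)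
        qed
        define col :: "'a \<Rightarrow> nat" where
          "col u = (if \<exists>w\<in>A3. norm (u + w) < \<rho>/8 \<and> win (j u) (j w) then 1 else 0)" for u
        show ?thesis
        proof (rule antipodally_smallI[where col=col and m=2])
          show "0 < \<rho>/8" using \<rho>(1) by simp
          show "col u < 2" for u by (simp add: col_def)
          fix u w assume uw: "u \<in> A3" "w \<in> A3" "col u = col w"
          show "\<rho>/8 \<le> norm (u + w)"
          proof (rule ccontr)
            assume "\<not> ?thesis"
            then have lt: "norm (u + w) < \<rho>/8" by simp
            have cu: "norm (q u - (c + u)) < \<rho>/8" and cw: "norm (q w - (c + w)) < \<rho>/8"
              using close uw by (auto simp: A3_def)
            \<comment> \<open>The positions of two almost antipodes of \<open>u\<close> differ by
              less than \<rho>/2, so by separation they lie in the same set.\<close>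
            have other: "j w' = j w" if w': "w' \<in> A3" "norm (u + w') < \<rho>/8" for w'
            proof -
              note norm_diff_le_shifted[of "q w'" "q w" c w' w u]
              moreover have "norm (q w' - (c + w')) < \<rho>/8" using close w' by (auto simp: A3_def)
              ultimately have "dist (q w') (q w) \<le> \<rho>"
                using cw lt w'(2) \<rho>(1) by (simp add: dist_norm)
              then show ?thesis using same[of "j w'" "j w"] j w' uw by metis
            qed
            have other': "j u' = j u" if u': "u' \<in> A3" "norm (w + u') < \<rho>/8" for u'
            proof -
              have "norm (q u' - q u) \<le> norm (q u' - (c + u')) + norm (q u - (c + u)) + (norm (w + u') + norm (u + w))"
                using norm_diff_le_shifted[of "q u'" "q u" c u' u w] by (simp only: add.commute[of w u])
              moreover have "norm (q u' - (c + u')) < \<rho>/8" using close u' by (auto simp: A3_def)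
              ultimately have "dist (q u') (q u) \<le> \<rho>"
                using cu lt u'(2) \<rho>(1) by (simp add: dist_norm)
              then show ?thesis using same[of "j u'" "j u"] j u' uw by metis
            qed
            \<comment> \<open>If both positions were in one set, convexity would put their midpoint
              in it; the midpoint is within 3\<rho>/16 of \<open>c\<close>, so this set would be the
              discarded one.\<close>
            have "j u \<noteq> j w"
            proof
              assume eq: "j u = j w"
              obtain E where "(j u, E) \<in> P" using j(1)[OF uw(1)] by auto
              then have "convex (j u)" by (rule P(2))
              then have mid: "(1/2) *\<^sub>R q u + (1/2) *\<^sub>R q w \<in> j u"
                using j(2) uw eq by (intro convexD) auto
              have "(1/2) *\<^sub>R q u + (1/2) *\<^sub>R q w - c
                  = (1/2) *\<^sub>R ((q u - (c + u)) + (q w - (c + w)) + (u + w))"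
                by (simp add: algebra_simps flip: scaleR_add_left)
              also have "norm \<dots> \<le> (1/2) * (norm (q u - (c + u)) + norm (q w - (c + w)) + norm (u + w))"
                using norm_triangle_ineq[of "(q u - (c + u)) + (q w - (c + w))" "u + w"]
                  norm_triangle_ineq[of "q u - (c + u)" "q w - (c + w)"] by simp
              finally have "dist ((1/2) *\<^sub>R q u + (1/2) *\<^sub>R q w) c \<le> \<rho>/4"
                using cu cw lt \<rho>(1) by (simp add: dist_norm)
              then have "near (j u)"
                using mid j(1)[OF uw(1)] by (auto simp: near_def)
              then show False using j(2)[OF uw(1)] uw(1) by (auto simp: A3_def)
            qed
            moreover have "col u = (if win (j u) (j w) then 1 else 0)"
              using uw lt other unfolding col_def by metis
            moreover have "col w = (if win (j w) (j u) then 1 else 0)"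
              using uw lt other' unfolding col_def by (metis add.commute)
            ultimately show False using win[of "j u" "j w"] uw(3) by (auto split: if_splits)
          qed
        qed
      qed
      ultimately show ?thesis by blast
    qed
  qed
qed

text \<open>Stated for an arbitrary starting position map \<open>q\<close>, so that in a composition
  the outer map can start from the positions left by the inner one.\<close>

lemma Gamma1_step:
  fixes g :: "'a::real_normed_vector \<Rightarrow> 'a"
  assumes "g \<in> Gamma1"
  shows "subspace V \<Longrightarrow> finite_dimensional V \<Longrightarrow> bounded A \<Longrightarrow> \<not> antipodally_small A \<Longrightarrow>
    (\<And>u. u \<in> A \<Longrightarrow> q u - (x + u) \<in> V) \<Longrightarrow>
    \<exists>A' V'. A' \<subseteq> A \<and> \<not> antipodally_small A' \<and> subspace V' \<and> finite_dimensional V' \<and>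
      (\<forall>u\<in>A'. g (q u) - (x + u) \<in> V')"
  using assms unfolding Gamma1_def
proof (induction arbitrary: V A q rule: semigroup_generated.induct)
  case (generator h)
  show ?case by (rule Gamma1_hat_step) (use generator in auto)
next
  case (comp g h)
  have "\<exists>A' V'. A' \<subseteq> A \<and> \<not> antipodally_small A' \<and> subspace V' \<and> finite_dimensional V' \<and>
      (\<forall>u\<in>A'. h (q u) - (x + u) \<in> V')"
    by (rule comp.IH(2)) (use comp.prems in auto)
  then obtain A1 V1 where 1: "A1 \<subseteq> A" "\<not> antipodally_small A1" "subspace V1" "finite_dimensional V1"
    "\<And>u. u \<in> A1 \<Longrightarrow> h (q u) - (x + u) \<in> V1"
    by blast
  have "\<exists>A' V'. A' \<subseteq> A1 \<and> \<not> antipodally_small A' \<and> subspace V' \<and> finite_dimensional V' \<and>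
      (\<forall>u\<in>A'. g (h (q u)) - (x + u) \<in> V')"
    by (rule comp.IH(1)) (use 1 comp.prems(3) bounded_subset in auto)
  then obtain A2 V2 where 2: "A2 \<subseteq> A1" "\<not> antipodally_small A2" "subspace V2" "finite_dimensional V2"
    "\<And>u. u \<in> A2 \<Longrightarrow> g (h (q u)) - (x + u) \<in> V2"
    by blast
  show ?case
    using 1 2 by (intro exI[of _ A2] exI[of _ V2]) auto
qed

theorem non_shrinking_Gamma1:
  assumes "\<not> finite_dimensional (UNIV :: 'a::real_normed_vector set)"
  shows "non_shrinking (Gamma1 :: ('a \<Rightarrow> 'a) set)"
  unfolding non_shrinking_def
proof
  assume "\<exists>g\<in>Gamma1. \<exists>x::'a. \<exists>r>0. \<exists>\<B>. finite \<B> \<and> (\<forall>(y, s)\<in>\<B>. s < r) \<and>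
    g ` cball x r \<subseteq> (\<Union>(y, s)\<in>\<B>. cball y s)"
  then obtain g and x :: 'a and r \<B> where g: "g \<in> Gamma1" "0 < r" "finite \<B>" "\<forall>(y, s)\<in>\<B>. s < r"
    "g ` cball x r \<subseteq> (\<Union>(y, s)\<in>\<B>. cball y s)"
    by blast
  have "\<exists>A V. A \<subseteq> sphere 0 r \<and> \<not> antipodally_small A \<and> subspace V \<and> finite_dimensional V \<and>
      (\<forall>u\<in>A. g (x + u) - (x + u) \<in> V)"
    by (rule Gamma1_step[OF g(1), of "{0}"])
      (auto simp: finite_dimensional_0 sphere_not_small[OF assms g(2)]
        intro: bounded_subset[OF bounded_cball sphere_cball])
  then obtain A V where "A \<subseteq> sphere 0 r" "\<not> antipodally_small A" "finite_dimensional V"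
    "\<And>u. u \<in> A \<Longrightarrow> g (x + u) - (x + u) \<in> V"
    by blast
  then show False
    by (rule displaced_sphere_not_covered[of A r V g x \<B>]) (use g(3-5) in auto)
qed

subsection \<open>Bounded series and copies of c0\<close>

lemma sum_max_bound:
  fixes y :: "nat \<Rightarrow> 'b::real_normed_vector"
  assumes U: "\<And>J s. finite J \<Longrightarrow> (\<And>k. \<bar>s k\<bar> \<le> 1) \<Longrightarrow> norm (\<Sum>k\<in>J. s k *\<^sub>R y k) \<le> U"
    and "finite J" "\<And>k. k \<in> J \<Longrightarrow> \<bar>a k\<bar> \<le> m" "0 \<le> m"
  shows "norm (\<Sum>k\<in>J. a k *\<^sub>R y k) \<le> m * U"
proof (cases "m = 0")
  case False
  then have m: "0 < m" using assms(4) by simp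
  \<comment> \<open>The coefficients off \<open>J\<close> are set to 0, because the hypothesis asks
    for a bound at every index.\<close>
  let ?s = "\<lambda>k. if k \<in> J then a k / m else 0"
  have "(\<Sum>k\<in>J. a k *\<^sub>R y k) = m *\<^sub>R (\<Sum>k\<in>J. ?s k *\<^sub>R y k)"
    unfolding scaleR_sum_right using m by (intro sum.cong) auto
  moreover have "norm (\<Sum>k\<in>J. ?s k *\<^sub>R y k) \<le> U"
    using assms(3) m by (intro U \<open>finite J\<close>) (auto simp: divide_le_eq)
  ultimately show ?thesis using m by simp
next
  case True
  then have "(\<Sum>k\<in>J. a k *\<^sub>R y k) = 0" using assms(3) by (intro sum.neutral) auto
  then show ?thesis using True by simp
qed

text \<open>James' distortion argument: flipping all signs but one changes the norm by little.\<close>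

lemma James_lower_bound:
  fixes y :: "nat \<Rightarrow> 'b::real_normed_vector"
  assumes U: "\<And>J s. finite J \<Longrightarrow> (\<And>k. \<bar>s k\<bar> \<le> 1) \<Longrightarrow> norm (\<Sum>k\<in>J. s k *\<^sub>R y k) \<le> U"
    and L: "\<And>k. L \<le> norm (y k)" and "finite J" "j \<in> J" "U \<le> 2 * L"
  shows "(2 * L - U) * \<bar>a j\<bar> \<le> norm (\<Sum>k\<in>J. a k *\<^sub>R y k)"
proof -
  let ?M = "(\<lambda>k. \<bar>a k\<bar>) ` J"
  have "Max ?M \<in> ?M" using assms by (intro Max_in) auto
  then obtain i where i: "i \<in> J" "\<bar>a i\<bar> = Max ?M" by auto
  then have max: "\<bar>a k\<bar> \<le> \<bar>a i\<bar>" if "k \<in> J" for k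
    using that \<open>finite J\<close> by simp
  \<comment> \<open>Adding the sum with flipped signs isolates the term of a coefficient of largest
    absolute value.\<close>
  let ?b = "\<lambda>k. if k = i then a i else - a k"
  let ?s = "\<Sum>k\<in>J. a k *\<^sub>R y k" and ?s' = "\<Sum>k\<in>J. ?b k *\<^sub>R y k"
  have "?s + ?s' = (\<Sum>k\<in>J. if k = i then (2 * a i) *\<^sub>R y i else 0)"
    unfolding sum.distrib[symmetric] by (intro sum.cong) (auto simp flip: scaleR_add_left)
  also have "\<dots> = (2 * a i) *\<^sub>R y i"
    using i \<open>finite J\<close> by simp
  finally have "2 * \<bar>a i\<bar> * norm (y i) \<le> norm ?s + norm ?s'"
    using norm_triangle_ineq[of ?s ?s'] by (simp add: abs_mult)
  moreover have "norm ?s' \<le> \<bar>a i\<bar> * U"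
    using max by (intro sum_max_bound[OF U \<open>finite J\<close>]) auto
  moreover have "2 * \<bar>a i\<bar> * L \<le> 2 * \<bar>a i\<bar> * norm (y i)"
    using L by (intro mult_left_mono) auto
  ultimately have "(2 * L - U) * \<bar>a i\<bar> \<le> norm ?s"
    by (simp add: algebra_simps)
  moreover have "(2 * L - U) * \<bar>a j\<bar> \<le> (2 * L - U) * \<bar>a i\<bar>"
    using max[OF \<open>j \<in> J\<close>] \<open>U \<le> 2 * L\<close> by (intro mult_left_mono) auto
  ultimately show ?thesis by linarith
qed

lemma subspace_c0: "subspace c0"
  unfolding subspace_def c0_def
  by (auto simp: plus_bcontfun.rep_eq scaleR_bcontfun.rep_eq zero_bcontfun.rep_eq
      intro: tendsto_add_zero tendsto_mult_right_zero)

text \<open>The map sending \<open>a\<close> to the series with coefficients \<open>a k\<close> at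
  \<open>y k\<close> is bounded above by \<open>U\<close> and, by the distortion argument, below by
  \<open>2 * L - U\<close>. It is thus a linear homeomorphism of \<open>c0\<close> onto a subspace
  of \<open>W\<close>.\<close>

lemma c0_isomorphic_blocks:
  fixes y :: "nat \<Rightarrow> 'b::banach"
  assumes U: "\<And>J s. finite J \<Longrightarrow> (\<And>k. \<bar>s k\<bar> \<le> 1) \<Longrightarrow> norm (\<Sum>k\<in>J. s k *\<^sub>R y k) \<le> U"
    and L: "\<And>k. L \<le> norm (y k)" and UL: "U < 2 * L"
    and W: "subspace W" "closed W" "\<And>k. y k \<in> W"
  shows "\<exists>W'\<subseteq>W. subspace W' \<and> isomorphic_subspaces c0 W'"
proof -
  define T where "T a = suminf (\<lambda>k. apply_bcontfun a k *\<^sub>R y k)" for a :: "nat \<Rightarrow>\<^sub>C real"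
  define d where "d = 2 * L - U"
  have d: "0 < d" using UL by (simp add: d_def)
  have U0: "0 \<le> U" using U[of "{}" "\<lambda>_. 0"] by simp
  \<comment> \<open>Coefficients in \<open>c0\<close> are uniformly small on tails, and
    \<open>U\<close> turns this into a Cauchy estimate.\<close>
  have sm: "summable (\<lambda>k. apply_bcontfun a k *\<^sub>R y k)" if a: "a \<in> c0" for a
    unfolding summable_Cauchy
  proof (intro allI impI)
    fix e :: real assume "0 < e"
    then have "0 < e / (U + 1)" using U0 by simp
    then obtain N where N: "\<And>k. N \<le> k \<Longrightarrow> \<bar>apply_bcontfun a k\<bar> < e / (U + 1)"
      using a unfolding c0_def lim_sequentially by (auto simp: dist_norm)
    have "norm (\<Sum>k\<in>{m..<n}. apply_bcontfun a k *\<^sub>R y k) < e" if "N \<le> m" for m n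
    proof -
      have "norm (\<Sum>k\<in>{m..<n}. apply_bcontfun a k *\<^sub>R y k) \<le> e / (U + 1) * U"
        using that N \<open>0 < e / (U + 1)\<close> by (intro sum_max_bound[OF U]) (auto intro!: less_imp_le)
      also have "\<dots> < e" using U0 \<open>0 < e\<close> by (simp add: field_simps)
      finally show ?thesis .
    qed
    then show "\<exists>N. \<forall>m\<ge>N. \<forall>n. norm (\<Sum>k = m..<n. apply_bcontfun a k *\<^sub>R y k) < e"
      by blast
  qed
  have lim: "(\<lambda>n. \<Sum>k<n. apply_bcontfun a k *\<^sub>R y k) \<longlonglongrightarrow> T a" if "a \<in> c0" for a
    unfolding T_def by (rule summable_LIMSEQ[OF sm[OF that]])
  have le: "\<bar>apply_bcontfun a k\<bar> \<le> norm a" for a :: "nat \<Rightarrow>\<^sub>C real" and k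
    using norm_bounded[of a k] by simp
  have upper: "norm (T a) \<le> U * norm a" if "a \<in> c0" for a
  proof (rule Lim_norm_ubound[OF _ lim[OF that]])
    show "\<forall>\<^sub>F n in sequentially. norm (\<Sum>k<n. apply_bcontfun a k *\<^sub>R y k) \<le> U * norm a"
    proof (intro always_eventually allI)
      fix n
      have "norm (\<Sum>k<n. apply_bcontfun a k *\<^sub>R y k) \<le> norm a * U"
        by (intro sum_max_bound[OF U]) (use le in auto)
      then show "norm (\<Sum>k<n. apply_bcontfun a k *\<^sub>R y k) \<le> U * norm a"
        by (simp add: mult.commute)
    qed
  qed simp
  have lower: "d * norm a \<le> norm (T a)" if "a \<in> c0" for a
  proof -
    have "d * \<bar>apply_bcontfun a j\<bar> \<le> norm (T a)" for j
    proof (rule LIMSEQ_le_const[OF tendsto_norm[OF lim[OF that]]])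
      show "\<exists>N. \<forall>n\<ge>N. d * \<bar>apply_bcontfun a j\<bar> \<le> norm (\<Sum>k<n. apply_bcontfun a k *\<^sub>R y k)"
        unfolding d_def using UL
        by (intro exI[of _ "Suc j"] allI impI James_lower_bound[OF U L]) auto
    qed
    then have "norm (apply_bcontfun a j) \<le> norm (T a) / d" for j
      using d by (simp add: field_simps)
    then have "norm a \<le> norm (T a) / d" by (rule norm_bound)
    then show ?thesis using d by (simp add: field_simps)
  qed
  have add: "T (a + b) = T a + T b" if "a \<in> c0" "b \<in> c0" for a b
    unfolding T_def plus_bcontfun.rep_eq scaleR_add_left
    using suminf_add[OF sm[OF that(1)] sm[OF that(2)]] by simp
  have scale: "T (c *\<^sub>R a) = c *\<^sub>R T a" if "a \<in> c0" for a c
    unfolding T_def scaleR_bcontfun.rep_eq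
    using suminf_scaleR_right[OF sm[OF that], of c] by (simp add: mult.commute)
  have diff: "T a - T b = T (a - b)" if "a \<in> c0" "b \<in> c0" for a b
    using add[of a "- b"] scale[of b "-1"] that subspace_neg[OF subspace_c0] by simp
  have mem: "a - b \<in> c0" if "a \<in> c0" "b \<in> c0" for a b
    using that subspace_diff[OF subspace_c0] by blast
  have inj: "inj_on T c0"
  proof (rule inj_onI)
    fix a b assume "a \<in> c0" "b \<in> c0" "T a = T b"
    then show "a = b" using lower[of "a - b"] diff[of a b] mem[of a b] d by (auto simp: mult_le_0_iff)
  qed
  have "homeomorphism c0 (T ` c0) T (inv_into c0 T)"
    unfolding homeomorphism_def
  proof (intro conjI ballI)
    have "U-lipschitz_on c0 T"
      using upper mem diff U0 by (intro lipschitz_onI) (simp_all add: dist_norm)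
    then show "continuous_on c0 T" by (rule lipschitz_on_continuous_on)
    have "(1/d)-lipschitz_on (T ` c0) (inv_into c0 T)"
    proof (rule lipschitz_onI)
      fix v w assume "v \<in> T ` c0" "w \<in> T ` c0"
      then obtain a b where "a \<in> c0" "b \<in> c0" "v = T a" "w = T b" by auto
      moreover have "d * norm (a - b) \<le> norm (T a - T b)"
        using lower[OF mem] diff \<open>a \<in> c0\<close> \<open>b \<in> c0\<close> by simp
      ultimately show "dist (inv_into c0 T v) (inv_into c0 T w) \<le> 1 / d * dist v w"
        using d by (simp add: inj dist_norm pos_le_divide_eq mult.commute)
    qed (use d in simp)
    then show "continuous_on (T ` c0) (inv_into c0 T)" by (rule lipschitz_on_continuous_on)
    show "inv_into c0 T ` T ` c0 = c0" using inj by simp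
  qed (use inj in \<open>auto simp: f_inv_into_f\<close>)
  then have "isomorphic_subspaces c0 (T ` c0)"
    unfolding isomorphic_subspaces_def using add scale by blast
  moreover have "subspace (T ` c0)"
    unfolding subspace_def
  proof (intro conjI ballI allI)
    have "T 0 = 0" by (simp add: T_def zero_bcontfun.rep_eq)
    then show "0 \<in> T ` c0" using subspace_0[OF subspace_c0] by (metis imageI)
    show "v + w \<in> T ` c0" if "v \<in> T ` c0" "w \<in> T ` c0" for v w
      using that add subspace_add[OF subspace_c0] by (force simp flip: add)
    show "c *\<^sub>R v \<in> T ` c0" if "v \<in> T ` c0" for c v
      using that scale subspace_scale[OF subspace_c0] by (force simp flip: scale)
  qed
  moreover have "T ` c0 \<subseteq> W"
  proof clarify
    fix a assume "a \<in> c0"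
    show "T a \<in> W"
      by (rule closed_sequentially[OF W(2) _ lim[OF \<open>a \<in> c0\<close>]])
        (intro subspace_sum[OF W(1)] subspace_scale[OF W(1)] W(3))
  qed
  ultimately show ?thesis by blast
qed

text \<open>If the tails do not become small, let \<open>K > 0\<close> be the infimum of their
  suprema. Far out there are disjoint blocks of norm above \<open>5/6 * K\<close>, while signed sums
  of blocks are again tail sums, of norm at most \<open>7/6 * K\<close>. As 7/6 is less than twice
  5/6, the blocks span a copy of \<open>c0\<close>.\<close>

lemma bounded_series_c0_or_Cauchy:
  fixes x :: "nat \<Rightarrow> 'b::banach"
  assumes bd: "\<And>I t. finite I \<Longrightarrow> (\<And>i. \<bar>t i\<bar> \<le> 1) \<Longrightarrow> norm (\<Sum>i\<in>I. t i *\<^sub>R x i) \<le> R"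
    and W: "subspace W" "closed W" "\<And>i. x i \<in> W"
    and no_c0: "\<not> (\<exists>W'\<subseteq>W. subspace W' \<and> isomorphic_subspaces c0 W')" and "0 < e"
  shows "\<exists>N. \<forall>I t. finite I \<longrightarrow> I \<subseteq> {N..} \<longrightarrow> (\<forall>i. \<bar>t i\<bar> \<le> 1) \<longrightarrow> norm (\<Sum>i\<in>I. t i *\<^sub>R x i) \<le> e"
proof (rule ccontr)
  assume neg: "\<not> ?thesis"
  define V where "V n = {norm (\<Sum>i\<in>I. t i *\<^sub>R x i) | I t. finite I \<and> I \<subseteq> {n..} \<and> (\<forall>i. \<bar>t i\<bar> \<le> 1)}" for n
  have V_bdd: "bdd_above (V n)" for n
    using bd by (intro bdd_aboveI[where M=R]) (auto simp: V_def)
  have V_ne: "V n \<noteq> {}" for n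
    by (auto simp: V_def intro!: exI[of _ "{}"] exI[of _ "\<lambda>_. 0"])
  define K where "K = (INF n. Sup (V n))"
  have e_le: "e \<le> Sup (V n)" for n
  proof -
    obtain I t where It: "finite I" "I \<subseteq> {n..}" "\<forall>i. \<bar>t i\<bar> \<le> 1" "e < norm (\<Sum>i\<in>I. t i *\<^sub>R x i)"
      using neg by (meson not_le)
    then have "norm (\<Sum>i\<in>I. t i *\<^sub>R x i) \<in> V n" by (auto simp: V_def)
    then have "norm (\<Sum>i\<in>I. t i *\<^sub>R x i) \<le> Sup (V n)" by (rule cSup_upper[OF _ V_bdd])
    then show ?thesis using It(4) by linarith
  qed
  then have K: "e \<le> K" unfolding K_def by (intro cINF_greatest) auto
  have K_le: "K \<le> Sup (V n)" for n
    unfolding K_def using e_le by (intro cINF_lower bdd_belowI2[where m=e]) auto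
  have "K < 7/6 * K" using K \<open>0 < e\<close> by simp
  then obtain n0 where n0: "Sup (V n0) < 7/6 * K"
    unfolding K_def by (subst (asm) cINF_less_iff) (use e_le in \<open>auto intro: bdd_belowI2[where m=e]\<close>)
  have up: "norm (\<Sum>i\<in>I. t i *\<^sub>R x i) \<le> 7/6 * K" if "finite I" "I \<subseteq> {n0..}" "\<And>i. \<bar>t i\<bar> \<le> 1" for I t
  proof -
    have "norm (\<Sum>i\<in>I. t i *\<^sub>R x i) \<in> V n0" using that by (auto simp: V_def)
    then have "norm (\<Sum>i\<in>I. t i *\<^sub>R x i) \<le> Sup (V n0)" by (rule cSup_upper[OF _ V_bdd])
    then show ?thesis using n0 by linarith
  qed
  have "\<exists>I t. finite I \<and> I \<subseteq> {n..} \<and> (\<forall>i. \<bar>t i\<bar> \<le> 1) \<and> 5/6 * K < norm (\<Sum>i\<in>I. t i *\<^sub>R x i)" for n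
  proof -
    have "5/6 * K < Sup (V n)" using K_le[of n] K \<open>0 < e\<close> by linarith
    then obtain v where "v \<in> V n" "5/6 * K < v"
      using less_cSup_iff[OF V_ne V_bdd] by blast
    then show ?thesis by (auto simp: V_def)
  qed
  then obtain I t where It: "\<And>n. finite (I n)" "\<And>n. I n \<subseteq> {n..}" "\<And>n i. \<bar>t n i\<bar> \<le> (1::real)"
    "\<And>n. 5/6 * K < norm (\<Sum>i\<in>I n. t n i *\<^sub>R x i)"
    by metis
  \<comment> \<open>Each block starts beyond the largest index of the previous one, so the index
    sets are disjoint.\<close>
  define p where "p = rec_nat n0 (\<lambda>_ n. Suc (Max (insert n (I n))))"
  have p0: "p 0 = n0" and pS: "p (Suc k) = Suc (Max (insert (p k) (I (p k))))" for k
    by (simp_all add: p_def)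
  have lt: "p k < p (Suc k)" and I_lt: "i \<in> I (p k) \<Longrightarrow> i < p (Suc k)" for k i
    unfolding pS using It(1)[of "p k"] by (simp_all add: less_Suc_eq_le)
  have pm: "strict_mono p" using lt by (simp add: strict_mono_Suc_iff)
  define y where "y k = (\<Sum>i\<in>I (p k). t (p k) i *\<^sub>R x i)" for k
  have uniq: "k = l" if "i \<in> I (p k)" "i \<in> I (p l)" for i k l
  proof (rule ccontr)
    assume "k \<noteq> l"
    then consider "Suc k \<le> l" | "Suc l \<le> k" by linarith
    then show False
    proof cases
      case 1
      then have "p (Suc k) \<le> p l" using pm by (simp add: strict_mono_less_eq)
      then show False using I_lt[OF that(1)] It(2)[of "p l"] that(2) by force
    next
      case 2
      then have "p (Suc l) \<le> p k" using pm by (simp add: strict_mono_less_eq)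
      then show False using I_lt[OF that(2)] It(2)[of "p k"] that(1) by force
    qed
  qed
  have "\<exists>W'\<subseteq>W. subspace W' \<and> isomorphic_subspaces c0 W'"
  proof (rule c0_isomorphic_blocks[where y=y and U="7/6 * K" and L="5/6 * K"])
    fix J :: "nat set" and s :: "nat \<Rightarrow> real" assume J: "finite J" and s: "\<And>k. \<bar>s k\<bar> \<le> 1"
    \<comment> \<open>\<kappa> recovers the block of an index and merges the double sum into one.
      Off the blocks its value is arbitrary, but the coefficient bound still holds there.\<close>
    define \<kappa> where "\<kappa> i = (SOME k. i \<in> I (p k))" for i
    have \<kappa>: "\<kappa> i = k" if "i \<in> I (p k)" for i k
      unfolding \<kappa>_def by (rule some_equality) (use that uniq in auto)
    have "(\<Sum>k\<in>J. s k *\<^sub>R y k) = (\<Sum>k\<in>J. \<Sum>i\<in>I (p k). (s (\<kappa> i) * t (p (\<kappa> i)) i) *\<^sub>R x i)"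
      unfolding y_def scaleR_sum_right by (intro sum.cong refl) (simp add: \<kappa>)
    also have "\<dots> = (\<Sum>i\<in>(\<Union>k\<in>J. I (p k)). (s (\<kappa> i) * t (p (\<kappa> i)) i) *\<^sub>R x i)"
      using J It(1) uniq by (intro sum.UNION_disjoint[symmetric]) auto
    also have "norm \<dots> \<le> 7/6 * K"
    proof (rule up)
      show "(\<Union>k\<in>J. I (p k)) \<subseteq> {n0..}"
      proof
        fix i assume "i \<in> (\<Union>k\<in>J. I (p k))"
        then obtain k where "i \<in> I (p k)" by blast
        moreover have "n0 \<le> p k" using pm p0 by (metis strict_mono_less_eq le0)
        ultimately show "i \<in> {n0..}" using It(2)[of "p k"] by force
      qed
      show "\<bar>s (\<kappa> i) * t (p (\<kappa> i)) i\<bar> \<le> 1" for i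
        unfolding abs_mult using s It(3) by (intro mult_le_one) auto
    qed (use J It(1) in auto)
    finally show "norm (\<Sum>k\<in>J. s k *\<^sub>R y k) \<le> 7/6 * K" .
  next
    show "7/6 * K < 2 * (5/6 * K)" using K \<open>0 < e\<close> by simp
    show "5/6 * K \<le> norm (y k)" for k using It(4)[of "p k"] by (simp add: y_def)
    show "y k \<in> W" for k
      unfolding y_def by (intro subspace_sum[OF W(1)] subspace_scale[OF W(1)] W(3))
  qed (use W in auto)
  with no_c0 show False by blast
qed

subsection \<open>Avoiding locally finite families of weakly closed sets\<close>

lemma weakly_open_nhd:
  fixes U :: "'b::real_normed_vector set"
  assumes "openin weak_topology U" "p \<in> U"
  shows "\<exists>(\<Phi> :: ('b \<Rightarrow>\<^sub>L real) set) \<epsilon>. finite \<Phi> \<and> 0 < \<epsilon> \<and> {q. \<forall>f\<in>\<Phi>. \<bar>blinfun_apply f q - blinfun_apply f p\<bar> < \<epsilon>} \<subseteq> U"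
proof -
  have "generate_topology_on {blinfun_apply f -` U | f U. open (U :: real set)} U"
    using assms(1) by (simp add: weak_topology_def openin_topology_generated_by_iff)
  then show ?thesis using assms(2)
  proof (induction rule: generate_topology_on.induct)
    case (Int a b)
    then have p: "p \<in> a" "p \<in> b" by auto
    from Int.IH(1)[OF p(1)] obtain \<Phi> :: "('b \<Rightarrow>\<^sub>L real) set" and \<epsilon> where
      "finite \<Phi>" "0 < \<epsilon>" "{q. \<forall>f\<in>\<Phi>. \<bar>blinfun_apply f q - blinfun_apply f p\<bar> < \<epsilon>} \<subseteq> a"
      by blast
    moreover from Int.IH(2)[OF p(2)] obtain \<Psi> :: "('b \<Rightarrow>\<^sub>L real) set" and \<delta> where
      "finite \<Psi>" "0 < \<delta>" "{q. \<forall>f\<in>\<Psi>. \<bar>blinfun_apply f q - blinfun_apply f p\<bar> < \<delta>} \<subseteq> b"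
      by blast
    ultimately show ?case
      by (intro exI[of _ "\<Phi> \<union> \<Psi>"] exI[of _ "min \<epsilon> \<delta>"]) (auto simp: subset_iff)
  next
    case (UN \<K>)
    then obtain k where k: "k \<in> \<K>" "p \<in> k" by blast
    from UN.IH[OF k] obtain \<Phi> :: "('b \<Rightarrow>\<^sub>L real) set" and \<epsilon> where
      "finite \<Phi>" "0 < \<epsilon>" "{q. \<forall>f\<in>\<Phi>. \<bar>blinfun_apply f q - blinfun_apply f p\<bar> < \<epsilon>} \<subseteq> k"
      by blast
    then show ?case using k(1) by blast
  next
    case (Basis s)
    then obtain f :: "'b \<Rightarrow>\<^sub>L real" and V where fV: "s = blinfun_apply f -` V" "open V" by blast
    moreover have "blinfun_apply f p \<in> V" using Basis fV by auto
    ultimately obtain \<epsilon> where "0 < \<epsilon>" "\<And>a. dist a (blinfun_apply f p) < \<epsilon> \<Longrightarrow> a \<in> V"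
      unfolding open_dist by blast
    then show ?case using fV
      by (intro exI[of _ "{f}"] exI[of _ \<epsilon>]) (auto simp: dist_real_def)
  qed simp
qed

lemma topspace_weak_topology [simp]: "topspace weak_topology = UNIV"
proof -
  have "UNIV = blinfun_apply 0 -` (UNIV :: real set)" by auto
  then show ?thesis
    unfolding weak_topology_def topology_generated_by_topspace by (auto intro!: exI[of _ UNIV])
qed

text \<open>A basic weak neighbourhood is invariant under translation by vectors that its
  functionals kill; finitely many such neighbourhoods, all disjoint from \<open>T\<close>, cover
  \<open>K\<close>.\<close>

lemma weakly_closed_avoids_compact:
  fixes T :: "'b::real_normed_vector set"
  assumes "closedin weak_topology T" "compact K" "K \<inter> T = {}"
  shows "\<exists>\<Phi> :: ('b \<Rightarrow>\<^sub>L real) set. finite \<Phi> \<and>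
    (\<forall>k\<in>K. \<forall>y. (\<forall>f\<in>\<Phi>. blinfun_apply f y = 0) \<longrightarrow> k + y \<notin> T)"
proof -
  have "openin weak_topology (- T)"
    using assms(1) by (simp add: closedin_def Compl_eq_Diff_UNIV)
  then have *: "\<exists>(\<Phi> :: ('b \<Rightarrow>\<^sub>L real) set) \<epsilon>. finite \<Phi> \<and> 0 < \<epsilon> \<and>
      {q. \<forall>f\<in>\<Phi>. \<bar>blinfun_apply f q - blinfun_apply f p\<bar> < \<epsilon>} \<subseteq> - T" if "p \<in> K" for p
    by (rule weakly_open_nhd) (use assms(3) that in auto)
  define Q where "Q p \<Phi> \<epsilon> \<longleftrightarrow> finite \<Phi> \<and> 0 < \<epsilon> \<and>
      {q. \<forall>f\<in>\<Phi>. \<bar>blinfun_apply f q - blinfun_apply f p\<bar> < \<epsilon>} \<subseteq> - T"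
    for p and \<Phi> :: "('b \<Rightarrow>\<^sub>L real) set" and \<epsilon> :: real
  have "\<forall>p\<in>K. \<exists>\<Phi> \<epsilon>. Q p \<Phi> \<epsilon>" using * unfolding Q_def by blast
  then obtain \<Phi> \<epsilon> where "\<And>p. p \<in> K \<Longrightarrow> Q p (\<Phi> p) (\<epsilon> p)"
    by metis
  then have \<Phi>: "finite (\<Phi> p) \<and> 0 < \<epsilon> p \<and>
      {q. \<forall>f\<in>\<Phi> p. \<bar>blinfun_apply f q - blinfun_apply f p\<bar> < \<epsilon> p} \<subseteq> - T" if "p \<in> K" for p
    using that unfolding Q_def by blast
  define N where "N p = {q. \<forall>f\<in>\<Phi> p. \<bar>blinfun_apply f q - blinfun_apply f p\<bar> < \<epsilon> p}" for p
  have "open (N p)" if "p \<in> K" for p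
  proof -
    have "N p = (\<Inter>f\<in>\<Phi> p. {q. \<bar>blinfun_apply f q - blinfun_apply f p\<bar> < \<epsilon> p})" by (auto simp: N_def)
    also have "open \<dots>"
      using \<Phi>[OF that] by (intro open_INT ballI open_Collect_less continuous_intros) auto
    finally show ?thesis .
  qed
  moreover have "K \<subseteq> (\<Union>p\<in>K. N p)" using \<Phi> by (auto simp: N_def)
  ultimately obtain D where D: "D \<subseteq> K" "finite D" "K \<subseteq> (\<Union>p\<in>D. N p)"
    using compactE_image[OF assms(2), of K N] by metis
  show ?thesis
  proof (intro exI conjI ballI allI impI)
    show "finite (\<Union>p\<in>D. \<Phi> p)" using D \<Phi> by auto
    fix k y assume "k \<in> K" and y: "\<forall>f\<in>(\<Union>p\<in>D. \<Phi> p). blinfun_apply f y = 0"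
    then obtain p where p: "p \<in> D" "k \<in> N p" using D by blast
    have "blinfun_apply f (k + y) = blinfun_apply f k" if "f \<in> \<Phi> p" for f
      using y that p(1) by (auto simp: blinfun.add_right)
    then have "k + y \<in> N p" using p(2) by (auto simp: N_def)
    then show "k + y \<notin> T" using \<Phi>[of p] p(1) D(1) unfolding N_def by blast
  qed
qed

text \<open>A finite subcover by neighbourhoods meeting finitely many sets has a Lebesgue number
  \<open>e\<close>, and \<open>e/2\<close> serves as \<delta>.\<close>

lemma locally_finite_near_compact:
  fixes \<S> :: "'b::metric_space set set"
  assumes "locally_finite_in euclidean \<S>" "compact K"
  obtains \<delta> where "0 < \<delta>" "finite {S \<in> \<S>. \<exists>p\<in>K. \<exists>q\<in>S. dist p q \<le> \<delta>}"
proof -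
  have "\<forall>p. \<exists>V. open V \<and> p \<in> V \<and> finite {S \<in> \<S>. S \<inter> V \<noteq> {}}"
    using assms(1) by (simp add: locally_finite_in_def)
  then obtain V where V: "\<And>p. open (V p)" "\<And>p. p \<in> V p" "\<And>p. finite {S \<in> \<S>. S \<inter> V p \<noteq> {}}"
    by metis
  obtain D where D: "finite D" "K \<subseteq> (\<Union>p\<in>D. V p)"
  proof (rule compactE_image[OF assms(2), of UNIV V])
    show "K \<subseteq> (\<Union>p. V p)" using V(2) by blast
  qed (rule V(1))
  obtain e where e: "0 < e" "\<And>x. x \<in> K \<Longrightarrow> \<exists>G\<in>V ` D. ball x e \<subseteq> G"
    by (rule Heine_Borel_lemma[OF assms(2), of "V ` D"]) (use D V in auto)
  have "{S \<in> \<S>. \<exists>p\<in>K. \<exists>q\<in>S. dist p q \<le> e/2} \<subseteq> (\<Union>p\<in>D. {S \<in> \<S>. S \<inter> V p \<noteq> {}})"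
  proof clarify
    fix S p q assume S: "S \<in> \<S>" "p \<in> K" "q \<in> S" "dist p q \<le> e/2"
    then obtain a where "a \<in> D" "ball p e \<subseteq> V a" using e by blast
    moreover have "q \<in> ball p e" using S e by simp
    ultimately show "S \<in> (\<Union>p\<in>D. {S \<in> \<S>. S \<inter> V p \<noteq> {}})" using S by blast
  qed
  then have "finite {S \<in> \<S>. \<exists>p\<in>K. \<exists>q\<in>S. dist p q \<le> e/2}"
    by (rule finite_subset) (use D V in auto)
  then show thesis using e(1) by (intro that[of "e/2"]) auto
qed

text \<open>In an obstacle \<open>(K, \<S>)\<close>, \<open>K\<close> contains the points to which the centre may have been moved by the
  finite dimensional displacements of the maps applied earlier, and \<open>\<S>\<close> the sets that meet no such point.\<close>

definition obstacles :: "('b::real_normed_vector set \<times> 'b set set) set \<Rightarrow> bool" where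
  "obstacles \<C> \<longleftrightarrow> finite \<C> \<and> (\<forall>(K, \<S>)\<in>\<C>. compact K \<and> locally_finite_in euclidean \<S> \<and>
     (\<forall>S\<in>\<S>. closedin weak_topology S))"

definition avoids :: "('b::real_normed_vector set \<times> 'b set set) set \<Rightarrow> 'b set \<Rightarrow> bool" where
  "avoids \<C> Z \<longleftrightarrow> (\<forall>(K, \<S>)\<in>\<C>. \<forall>z\<in>Z. \<forall>k\<in>K. z + k \<notin> \<Union>\<S>)"

lemma avoids_subset: "avoids \<C> Z \<Longrightarrow> Z' \<subseteq> Z \<Longrightarrow> avoids \<C> Z'"
  unfolding avoids_def by blast

definition thicken :: "'b::real_vector set \<Rightarrow> 'b \<Rightarrow> 'b set" where
  "thicken Z v = {z + s *\<^sub>R v | z s. z \<in> Z \<and> \<bar>s\<bar> \<le> (1::real)}"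

lemma compact_thicken:
  fixes v :: "'b::real_normed_vector"
  assumes "compact Z"
  shows "compact (thicken Z v)"
proof -
  have "compact ((\<lambda>s. s *\<^sub>R v) ` {-1..1})"
    by (intro compact_continuous_image continuous_intros) auto
  from compact_sums[OF assms this] show ?thesis
    by (rule back_subst[of compact]) (auto simp: thicken_def abs_le_iff image_iff; force)
qed

lemma subset_thicken: "Z \<subseteq> thicken Z v"
  by (force simp: thicken_def intro: exI[of _ 0])

text \<open>At radius \<delta>, only finitely many obstacle sets can be reached from
  \<open>Z + K\<close> by a step of length \<delta>.\<close>

definition few_near :: "('b::real_normed_vector set \<times> 'b set set) set \<Rightarrow> 'b set \<Rightarrow> real \<Rightarrow> bool" where
  "few_near \<C> Z \<delta> \<longleftrightarrow> (\<forall>(K, \<S>)\<in>\<C>. finite {S \<in> \<S>. \<exists>z\<in>Z. \<exists>k\<in>K. \<exists>q\<in>S. dist (z + k) q \<le> \<delta>})"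

lemma few_near_mono:
  assumes "few_near \<C> Z \<delta>" "Z' \<subseteq> Z"
  shows "few_near \<C> Z' \<delta>"
  unfolding few_near_def
proof clarify
  fix K \<S> assume "(K, \<S>) \<in> \<C>"
  then have "finite {S \<in> \<S>. \<exists>z\<in>Z. \<exists>k\<in>K. \<exists>q\<in>S. dist (z + k) q \<le> \<delta>}"
    using assms(1) unfolding few_near_def by blast
  then show "finite {S \<in> \<S>. \<exists>z\<in>Z'. \<exists>k\<in>K. \<exists>q\<in>S. dist (z + k) q \<le> \<delta>}"
    by (rule rev_finite_subset) (use assms(2) in blast)
qed

lemma ex_few_near:
  fixes Z :: "'b::real_normed_vector set"
  assumes "obstacles \<C>" "compact Z"
  shows "\<exists>n. few_near \<C> Z ((1/2) ^ n)"
proof -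
  define Q where "Q c n \<longleftrightarrow> finite {S \<in> snd c. \<exists>z\<in>Z. \<exists>k\<in>fst c. \<exists>q\<in>S. dist (z + k) q \<le> (1/2) ^ n}"
    for c :: "'b set \<times> 'b set set" and n :: nat
  have "\<forall>\<^sub>F n in sequentially. Q c n" if "c \<in> \<C>" for c
  proof -
    obtain K \<S> where c: "c = (K, \<S>)" by fastforce
    have K: "compact K" "locally_finite_in euclidean \<S>"
      using assms(1) \<open>c \<in> \<C>\<close> unfolding obstacles_def c by auto
    obtain \<delta> where \<delta>: "0 < \<delta>" "finite {S \<in> \<S>. \<exists>p\<in>{z + k | z k. z \<in> Z \<and> k \<in> K}. \<exists>q\<in>S. dist p q \<le> \<delta>}"
      by (rule locally_finite_near_compact[OF K(2) compact_sums[OF assms(2) K(1)]])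
    have "(\<lambda>n. (1/2) ^ n :: real) \<longlonglongrightarrow> 0" by (intro LIMSEQ_realpow_zero) auto
    then have "\<forall>\<^sub>F n in sequentially. (1/2) ^ n < \<delta>" using \<delta>(1) by (simp add: order_tendsto_iff)
    then show ?thesis
    proof eventually_elim
      case (elim n)
      show ?case unfolding Q_def c snd_conv fst_conv
      proof (rule finite_subset[OF subsetI \<delta>(2)])
        fix S assume "S \<in> {S \<in> \<S>. \<exists>z\<in>Z. \<exists>k\<in>K. \<exists>q\<in>S. dist (z + k) q \<le> (1/2) ^ n}"
        then obtain z k q where "S \<in> \<S>" "z \<in> Z" "k \<in> K" "q \<in> S" "dist (z + k) q \<le> (1/2) ^ n"
          by blast
        moreover from this have "dist (z + k) q \<le> \<delta>" using elim by linarith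
        ultimately show "S \<in> {S \<in> \<S>. \<exists>p\<in>{z + k | z k. z \<in> Z \<and> k \<in> K}. \<exists>q\<in>S. dist p q \<le> \<delta>}"
          by blast
      qed
    qed
  qed
  then have "\<forall>\<^sub>F n in sequentially. \<forall>c\<in>\<C>. Q c n"
    using assms(1) by (intro eventually_ball_finite) (auto simp: obstacles_def)
  then obtain n where "\<forall>c\<in>\<C>. Q c n" by (auto simp: eventually_sequentially)
  then show ?thesis unfolding few_near_def Q_def by (intro exI[of _ n]) auto
qed

lemma linear_blinfun_embed: "linear (\<lambda>y. blinfun_apply f (embed y))"
  using linear_compose[OF linear_embed bounded_linear.linear[OF blinfun.bounded_linear_right[of f]]]
  by (simp add: o_def)

lemma embed_0 [simp]: "embed 0 = 0"
  by (rule linear_0[OF linear_embed])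

text \<open>The finitely many near sets have a weakly closed union, which is avoided in the kernel
  of finitely many functionals; all other sets are too far away for a step of norm \<delta>.\<close>

lemma avoiding_step:
  fixes G :: "'a::real_normed_vector set"
  assumes \<C>: "obstacles \<C>" and G: "subspace G" "\<not> finite_dimensional G"
    and Z: "compact Z" "avoids \<C> Z" and few: "few_near \<C> Z \<delta>" and "0 < \<delta>"
  shows "\<exists>u\<in>G. norm u = \<delta> \<and> avoids \<C> (thicken Z (embed u))"
proof -
  define near where "near c = {S \<in> snd c. \<exists>z\<in>Z. \<exists>k\<in>fst c. \<exists>q\<in>S. dist (z + k) q \<le> \<delta>}"
    for c :: "'a norm_completion set \<times> 'a norm_completion set set"
  define shifts where "shifts c = {z + k | z k. z \<in> Z \<and> k \<in> fst c}"
    for c :: "'a norm_completion set \<times> 'a norm_completion set set"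
  define kills where "kills c \<Phi> \<longleftrightarrow> finite \<Phi> \<and>
     (\<forall>p\<in>shifts c. \<forall>y. (\<forall>f\<in>\<Phi>. blinfun_apply f y = 0) \<longrightarrow> p + y \<notin> \<Union>(near c))"
    for c and \<Phi> :: "('a norm_completion \<Rightarrow>\<^sub>L real) set"
  have "\<exists>\<Phi>. kills c \<Phi>" if "c \<in> \<C>" for c
  proof -
    obtain K \<S> where c: "c = (K, \<S>)" by fastforce
    have K: "compact K" "\<And>S. S \<in> \<S> \<Longrightarrow> closedin weak_topology S"
      using \<C> that unfolding obstacles_def c by auto
    have "finite (near c)" using few that unfolding few_near_def near_def c by auto
    then have 1: "closedin weak_topology (\<Union>(near c))"
      using K(2) by (intro closedin_Union) (auto simp: near_def c)
    have 2: "compact (shifts c)"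
      using compact_sums[OF Z(1) K(1)] by (simp add: shifts_def c)
    have 3: "shifts c \<inter> \<Union>(near c) = {}"
    proof -
      have "z + k \<notin> S" if "z \<in> Z" "k \<in> K" "S \<in> \<S>" for z k S
        using Z(2) \<open>c \<in> \<C>\<close> that unfolding avoids_def c by blast
      then show ?thesis by (auto simp: shifts_def near_def c)
    qed
    show ?thesis
      using weakly_closed_avoids_compact[OF 1 2 3] unfolding kills_def .
  qed
  then obtain \<Phi> where kills: "\<And>c. c \<in> \<C> \<Longrightarrow> kills c (\<Phi> c)"
    by metis
  have \<Phi>: "finite (\<Phi> c)"
    "\<And>p y. p \<in> shifts c \<Longrightarrow> (\<And>f. f \<in> \<Phi> c \<Longrightarrow> blinfun_apply f y = 0) \<Longrightarrow> p + y \<notin> \<Union>(near c)"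
    if "c \<in> \<C>" for c
    using kills[OF that] unfolding kills_def by blast+
  let ?F = "\<lambda>f y. blinfun_apply f (embed y)"
  let ?G = "{y \<in> G. \<forall>g\<in>?F ` (\<Union>c\<in>\<C>. \<Phi> c). g y = 0}"
  have "finite (\<Union>c\<in>\<C>. \<Phi> c)" using \<C> \<Phi>(1) by (auto simp: obstacles_def)
  then have sG: "subspace ?G" "\<not> finite_dimensional ?G"
    using infinite_dimensional_kernels[OF G, of "?F ` (\<Union>c\<in>\<C>. \<Phi> c)"] linear_blinfun_embed by blast+
  obtain y where y: "y \<in> ?G" "y \<noteq> 0" by (rule infinite_dimensional_nonzero[OF sG])
  define u where "u = (\<delta> / norm y) *\<^sub>R y"
  from sG(1) have "u \<in> ?G" unfolding u_def by (rule subspace_scale) (rule y(1))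
  then have u: "u \<in> G" "\<And>c f. c \<in> \<C> \<Longrightarrow> f \<in> \<Phi> c \<Longrightarrow> blinfun_apply f (embed u) = 0" by auto
  have nu: "norm u = \<delta>" using y(2) \<open>0 < \<delta>\<close> by (simp add: u_def)
  have "avoids \<C> (thicken Z (embed u))"
    unfolding avoids_def
  proof clarify
    fix K \<S> w k S assume c: "(K, \<S>) \<in> \<C>" and "w \<in> thicken Z (embed u)" and k: "k \<in> K" and S: "w + k \<in> S" "S \<in> \<S>"
    then obtain z s where w: "w = z + s *\<^sub>R embed u" "z \<in> Z" "\<bar>s\<bar> \<le> 1" by (auto simp: thicken_def)
    have eq: "w + k = (z + k) + s *\<^sub>R embed u" by (simp add: w)
    have "dist (z + k) (w + k) = \<bar>s\<bar> * \<delta>"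
      unfolding eq by (simp add: dist_norm norm_embed nu)
    also have "\<dots> \<le> \<delta>" using w(3) \<open>0 < \<delta>\<close> by (simp add: mult_left_le_one_le)
    finally have "S \<in> near (K, \<S>)"
      unfolding near_def fst_conv snd_conv using w(2) k S by blast
    moreover have "(z + k) + s *\<^sub>R embed u \<notin> \<Union>(near (K, \<S>))"
    proof (rule \<Phi>(2)[OF c])
      show "z + k \<in> shifts (K, \<S>)" using w(2) k by (auto simp: shifts_def)
      show "blinfun_apply f (s *\<^sub>R embed u) = 0" if "f \<in> \<Phi> (K, \<S>)" for f
        using u(2)[OF c that] by (simp add: blinfun.scaleR_right)
    qed
    ultimately show False using S(1) unfolding eq by blast
  qed
  then show ?thesis using u(1) nu by blast
qed

lemma subspace_closure:
  fixes S :: "'b::real_normed_vector set"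
  assumes "subspace S"
  shows "subspace (closure S)"
  unfolding subspace_def
proof (intro conjI ballI allI)
  show "0 \<in> closure S" using subspace_0[OF assms] closure_subset by blast
next
  fix v w assume "v \<in> closure S" "w \<in> closure S"
  then obtain f g where "\<forall>n. f n \<in> S" "f \<longlonglongrightarrow> v" "\<forall>n. g n \<in> S" "g \<longlonglongrightarrow> w"
    unfolding closure_sequential by blast
  then show "v + w \<in> closure S"
    unfolding closure_sequential
    by (intro exI[of _ "\<lambda>n. f n + g n"] conjI allI tendsto_add subspace_add[OF assms]) auto
next
  fix c v assume "v \<in> closure S"
  then obtain f where "\<forall>n. f n \<in> S" "f \<longlonglongrightarrow> v"
    unfolding closure_sequential by blast
  then show "c *\<^sub>R v \<in> closure S"
    unfolding closure_sequential
    by (intro exI[of _ "\<lambda>n. c *\<^sub>R f n"] conjI allI tendsto_scaleR tendsto_const subspace_scale[OF assms]) auto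
qed

text \<open>Up to a small error the compact set \<open>Z N\<close> represents the whole union, so
  the closure is totally bounded, and it is complete.\<close>

lemma compact_closure_of_tails:
  fixes Z :: "nat \<Rightarrow> 'b::banach set"
  assumes Z: "\<And>n. compact (Z n)" and near: "\<And>e. 0 < e \<Longrightarrow> \<exists>N. \<forall>n. \<forall>z\<in>Z n. \<exists>w\<in>Z N. dist w z \<le> e"
  shows "compact (closure (\<Union>n. Z n))"
  unfolding compact_eq_totally_bounded
proof (intro conjI allI impI)
  show "complete (closure (\<Union>n. Z n))" by (simp add: complete_eq_closed)
  fix e :: real assume "0 < e"
  then obtain N where N: "\<And>n z. z \<in> Z n \<Longrightarrow> \<exists>w\<in>Z N. dist w z \<le> e/4"
    using near[of "e/4"] by auto
  obtain D where D: "finite D" "Z N \<subseteq> (\<Union>x\<in>D. ball x (e/4))"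
    by (rule compactE_image[OF Z[of N], of "Z N" "\<lambda>x. ball x (e/4)"]) (use \<open>0 < e\<close> in auto)
  have "closure (\<Union>n. Z n) \<subseteq> (\<Union>x\<in>D. ball x e)"
  proof
    fix p assume "p \<in> closure (\<Union>n. Z n)"
    then obtain z where z: "z \<in> (\<Union>n. Z n)" "dist z p < e/4"
      using \<open>0 < e\<close> unfolding closure_approachable by (metis zero_less_divide_iff zero_less_numeral)
    then obtain w where w: "w \<in> Z N" "dist w z \<le> e/4" using N by blast
    then obtain x where x: "x \<in> D" "dist x w < e/4" using D(2) by force
    have "dist x p < e"
      using dist_triangle[of x p w] dist_triangle[of w p z] w z x \<open>0 < e\<close> by linarith
    then show "p \<in> (\<Union>x\<in>D. ball x e)" using x(1) by auto
  qed
  then show "\<exists>k. finite k \<and> closure (\<Union>n. Z n) \<subseteq> (\<Union>x\<in>k. ball x e)" using D(1) by blast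
qed

text \<open>The greedy choice of the step sizes \<open>(1/2) ^ stage Z\<close> makes them bounded below as soon as the sets
  \<open>Zs n\<close> stay in a compact set; hence the sums of the steps are unbounded unless \<open>c0\<close> embeds.\<close>

lemma long_avoiding_vector:
  fixes G :: "'a::real_normed_vector set"
  assumes \<C>: "obstacles \<C>" and G: "subspace G" "\<not> finite_dimensional G"
    and no_c0: "\<not> (\<exists>W\<subseteq>subspace_completion G. subspace W \<and> isomorphic_subspaces c0 W)"
    and Z: "compact Z" "avoids \<C> Z"
  shows "\<exists>v\<in>G. R \<le> norm v \<and> avoids \<C> (thicken Z (embed v))"
proof (rule ccontr)
  assume "\<not> ?thesis"
  then have short: "norm v < R" if "v \<in> G" "avoids \<C> (thicken Z (embed v))" for v
    using that by (meson not_le)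
  \<comment> \<open>The least exponent means the largest admissible step among the powers of
    1/2.\<close>
  define stage where "stage Y = (LEAST n. few_near \<C> Y ((1/2) ^ n))" for Y
  have stage: "few_near \<C> Y ((1/2) ^ stage Y)" if "compact Y" for Y
    unfolding stage_def by (rule LeastI_ex) (rule ex_few_near[OF \<C> that])
  define pick where "pick Y = (SOME u. u \<in> G \<and> norm u = (1/2) ^ stage Y \<and> avoids \<C> (thicken Y (embed u)))" for Y
  have pick: "pick Y \<in> G \<and> norm (pick Y) = (1/2) ^ stage Y \<and> avoids \<C> (thicken Y (embed (pick Y)))"
    if "compact Y" "avoids \<C> Y" for Y
    unfolding pick_def
    by (rule someI_ex) (use avoiding_step[OF \<C> G that stage[OF that(1)]] in auto)
  define Zs where "Zs = rec_nat Z (\<lambda>_ Y. thicken Y (embed (pick Y)))"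
  have Zs0: "Zs 0 = Z" and ZsS: "Zs (Suc n) = thicken (Zs n) (embed (pick (Zs n)))" for n
    by (simp_all add: Zs_def)
  have Zs: "compact (Zs n) \<and> avoids \<C> (Zs n)" for n
  proof (induction n)
    case 0
    then show ?case using Z by (simp add: Zs0)
  next
    case (Suc n)
    then show ?case using pick[of "Zs n"] by (simp add: ZsS compact_thicken)
  qed
  define u where "u n = pick (Zs n)" for n
  have u: "u n \<in> G" "norm (u n) = (1/2) ^ stage (Zs n)" for n
    using pick[of "Zs n"] Zs[of n] by (auto simp: u_def)
  have Zs_mono: "Zs m \<subseteq> Zs n" if "m \<le> n" for m n
    by (rule lift_Suc_mono_le[OF _ that]) (simp add: ZsS subset_thicken)
  have sums_in: "z + (\<Sum>i<n. t i *\<^sub>R embed (u i)) \<in> Zs n" if "z \<in> Z" "\<And>i. \<bar>t i\<bar> \<le> 1" for z t n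
  proof (induction n)
    case 0
    then show ?case using that by (simp add: Zs0)
  next
    case (Suc n)
    then show ?case
      unfolding ZsS thicken_def using that(2)[of n]
      by (intro CollectI exI[of _ "z + (\<Sum>i<n. t i *\<^sub>R embed (u i))"] exI[of _ "t n"]) (simp add: u_def)
  qed
  have split: "\<exists>w\<in>Zs m. \<exists>t. (\<forall>i. \<bar>t i\<bar> \<le> 1) \<and> y = w + (\<Sum>i\<in>{m..<n}. t i *\<^sub>R embed (u i))"
    if "m \<le> n" "y \<in> Zs n" for m n y
    using that
  proof (induction n arbitrary: y rule: dec_induct)
    case base
    then show ?case by (intro bexI[of _ y] exI[of _ "\<lambda>_. 0"]) auto
  next
    case (step n)
    then obtain y' s where y': "y = y' + s *\<^sub>R embed (u n)" "y' \<in> Zs n" "\<bar>s\<bar> \<le> 1"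
      by (auto simp: ZsS thicken_def u_def)
    obtain w t where w: "w \<in> Zs m" "\<And>i. \<bar>t i\<bar> \<le> 1" "y' = w + (\<Sum>i\<in>{m..<n}. t i *\<^sub>R embed (u i))"
      using step.IH[OF y'(2)] by blast
    have "(\<Sum>i\<in>{m..<n}. (t(n := s)) i *\<^sub>R embed (u i)) = (\<Sum>i\<in>{m..<n}. t i *\<^sub>R embed (u i))"
      by (intro sum.cong) auto
    then have "y = w + (\<Sum>i\<in>{m..<Suc n}. (t(n := s)) i *\<^sub>R embed (u i))"
      using y' w(3) step.hyps by (simp add: add.assoc)
    moreover have "\<forall>i. \<bar>(t(n := s)) i\<bar> \<le> 1" using w(2) y'(3) by simp
    ultimately show ?case using w(1) by blast
  qed
  have emb: "embed (\<Sum>i\<in>I. t i *\<^sub>R u i) = (\<Sum>i\<in>I. t i *\<^sub>R embed (u i))" for I and t :: "nat \<Rightarrow> real"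
    by (simp add: linear_sum[OF linear_embed] linear_scale[OF linear_embed])
  \<comment> \<open>Thickening \<open>Z\<close> by such a sum stays inside some \<open>Zs n\<close>,
    hence avoids the obstacles; by assumption the sum is then shorter than \<open>R\<close>.\<close>
  have bounded: "norm (\<Sum>i\<in>I. t i *\<^sub>R embed (u i)) \<le> R" if I: "finite I" and t: "\<And>i. \<bar>t i\<bar> \<le> 1" for I and t :: "nat \<Rightarrow> real"
  proof -
    let ?v = "\<Sum>i\<in>I. t i *\<^sub>R u i"
    obtain n where n: "I \<subseteq> {..<n}" using finite_nat_bounded[OF I] by blast
    have "thicken Z (embed ?v) \<subseteq> Zs n"
    proof
      fix y assume "y \<in> thicken Z (embed ?v)"
      then obtain z s where y: "y = z + s *\<^sub>R embed ?v" "z \<in> Z" "\<bar>s\<bar> \<le> 1" by (auto simp: thicken_def)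
      define t' where "t' i = (if i \<in> I then s * t i else 0)" for i
      have "s *\<^sub>R embed ?v = (\<Sum>i\<in>I. t' i *\<^sub>R embed (u i))"
        unfolding emb scaleR_sum_right by (intro sum.cong) (auto simp: t'_def)
      also have "\<dots> = (\<Sum>i<n. t' i *\<^sub>R embed (u i))"
        by (rule sum.mono_neutral_left) (use n in \<open>auto simp: t'_def\<close>)
      finally have "y = z + (\<Sum>i<n. t' i *\<^sub>R embed (u i))" using y(1) by simp
      moreover have "\<bar>t' i\<bar> \<le> 1" for i
        using y(3) t[of i] by (auto simp: t'_def abs_mult intro: mult_le_one)
      ultimately show "y \<in> Zs n" using sums_in[OF y(2), of t' n] by simp
    qed
    then have "avoids \<C> (thicken Z (embed ?v))" using Zs[of n] avoids_subset by blast
    moreover have "?v \<in> G" by (intro subspace_sum[OF G(1)] subspace_scale[OF G(1)] u(1))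
    ultimately have "norm ?v < R" by (intro short)
    then show ?thesis unfolding emb[symmetric] norm_embed by simp
  qed
  have sW: "subspace (subspace_completion G)"
    unfolding subspace_completion_def
    by (intro subspace_closure linear_subspace_image[OF linear_embed G(1)])
  have uW: "embed (u i) \<in> subspace_completion G" for i
    unfolding subspace_completion_def using u(1) closure_subset by blast
  have tails: "\<exists>N. \<forall>I t. finite I \<longrightarrow> I \<subseteq> {N..} \<longrightarrow> (\<forall>i. \<bar>t i\<bar> \<le> 1) \<longrightarrow> norm (\<Sum>i\<in>I. t i *\<^sub>R embed (u i)) \<le> e"
    if "0 < e" for e
    by (rule bounded_series_c0_or_Cauchy[OF bounded sW _ uW no_c0 that]) (auto simp: subspace_completion_def)
  \<comment> \<open>Small tails make each \<open>Zs n\<close> stay close to a fixed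
    \<open>Zs N\<close>. One exponent \<open>m\<close> then works for all stages, so the steps
    cannot become shorter than \<open>(1/2) ^ m\<close>, contradicting the small tails.\<close>
  have "compact (closure (\<Union>n. Zs n))"
  proof (rule compact_closure_of_tails)
    show "compact (Zs n)" for n using Zs by blast
    fix e :: real assume "0 < e"
    from tails[OF this] obtain N where N: "\<forall>I t. finite I \<longrightarrow> I \<subseteq> {N..} \<longrightarrow> (\<forall>i. \<bar>t i\<bar> \<le> 1) \<longrightarrow> norm (\<Sum>i\<in>I. t i *\<^sub>R embed (u i)) \<le> e" ..
    have "\<exists>w\<in>Zs N. dist w z \<le> e" if z: "z \<in> Zs n" for n z
    proof (cases "N \<le> n")
      case True
      obtain w t where w: "w \<in> Zs N" "\<forall>i. \<bar>t i\<bar> \<le> 1" "z = w + (\<Sum>i\<in>{N..<n}. t i *\<^sub>R embed (u i))"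
        using split[OF True z] by blast
      have "norm (\<Sum>i\<in>{N..<n}. t i *\<^sub>R embed (u i)) \<le> e" by (rule N[rule_format]) (use w in auto)
      then have "dist w z \<le> e" unfolding w(3) by (simp add: dist_norm)
      then show ?thesis using w(1) by blast
    next
      case False
      then have "z \<in> Zs N" using Zs_mono[of n N] z by auto
      then show ?thesis using \<open>0 < e\<close> by (intro bexI[of _ z]) auto
    qed
    then show "\<exists>N. \<forall>n. \<forall>z\<in>Zs n. \<exists>w\<in>Zs N. dist w z \<le> e" by blast
  qed
  from ex_few_near[OF \<C> this] obtain m where m: "few_near \<C> (closure (\<Union>n. Zs n)) ((1/2) ^ m)" ..
  have "few_near \<C> (Zs n) ((1/2) ^ m)" for n
  proof (rule few_near_mono[OF m])
    show "Zs n \<subseteq> closure (\<Union>n. Zs n)"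
      using closure_subset[of "\<Union>n. Zs n"] by blast
  qed
  then have "stage (Zs n) \<le> m" for n unfolding stage_def by (rule Least_le)
  then have ge: "(1/2) ^ m \<le> norm (u n)" for n
    unfolding u(2) by (intro power_decreasing) auto
  have "0 < (1/2 :: real) ^ Suc m" by simp
  from tails[OF this] obtain N where N: "\<forall>I t. finite I \<longrightarrow> I \<subseteq> {N..} \<longrightarrow> (\<forall>i. \<bar>t i\<bar> \<le> 1) \<longrightarrow> norm (\<Sum>i\<in>I. t i *\<^sub>R embed (u i)) \<le> (1/2) ^ Suc m" ..
  have "norm (\<Sum>i\<in>{N}. 1 *\<^sub>R embed (u i)) \<le> (1/2) ^ Suc m"
    by (rule N[rule_format]) auto
  then have "norm (u N) \<le> (1/2) ^ Suc m" by (simp add: norm_embed)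
  moreover have "(1/2) ^ Suc m < (1/2 :: real) ^ m" by simp
  ultimately show False using ge[of N] by linarith
qed

text \<open>Good sets are those whose image in the completion is compact and avoids the obstacles.
  The assumption about \<open>c0\<close> passes from \<open>F\<close> to each subspace
  \<open>G\<close>, so long avoiding edges always exist.\<close>

lemma avoiding_directions_not_small:
  fixes F :: "'a::real_normed_vector set"
  assumes \<C>: "obstacles \<C>" "avoids \<C> {0}" and F: "subspace F" "\<not> finite_dimensional F"
    and no_c0: "\<not> (\<exists>W\<subseteq>subspace_completion F. subspace W \<and> isomorphic_subspaces c0 W)" and "0 < r"
  shows "\<not> antipodally_small {u::'a. norm u = r \<and> avoids \<C> {embed u}}"
proof -
  have emb_thick: "embed ` thicken Z v = thicken (embed ` Z) (embed v)" for Z and v :: 'a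
  proof -
    have *: "embed (z + s *\<^sub>R v) = embed z + s *\<^sub>R embed v" for z and s :: real
      by (simp add: linear_add[OF linear_embed] linear_scale[OF linear_embed])
    show ?thesis
      unfolding thicken_def
    proof (intro equalityI subsetI)
      fix y assume "y \<in> embed ` {z + s *\<^sub>R v | z s. z \<in> Z \<and> \<bar>s\<bar> \<le> (1::real)}"
      then obtain z s where "y = embed (z + s *\<^sub>R v)" "z \<in> Z" "\<bar>s\<bar> \<le> 1" by blast
      then show "y \<in> {z + s *\<^sub>R embed v | z s. z \<in> embed ` Z \<and> \<bar>s\<bar> \<le> 1}" unfolding * by blast
    next
      fix y assume "y \<in> {z + s *\<^sub>R embed v | z s. z \<in> embed ` Z \<and> \<bar>s\<bar> \<le> 1}"
      then obtain z s where "y = embed z + s *\<^sub>R embed v" "z \<in> Z" "\<bar>s\<bar> \<le> 1" by blast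
      then show "y \<in> embed ` {z + s *\<^sub>R v | z s. z \<in> Z \<and> \<bar>s\<bar> \<le> (1::real)}" unfolding *[symmetric] by blast
    qed
  qed
  let ?Good = "\<lambda>Z :: 'a set. compact (embed ` Z) \<and> avoids \<C> (embed ` Z)"
  have "\<not> antipodally_small {u::'a. norm u = r \<and> (\<exists>Z. ?Good Z \<and> u \<in> Z)}"
  proof (rule good_directions_not_small[OF F \<open>0 < r\<close>, of ?Good])
    show "?Good {0}" using \<C>(2) by simp
    fix G Z and R :: real assume G: "subspace G" "\<not> finite_dimensional G" "G \<subseteq> F" and Z: "?Good Z"
    have "subspace_completion G \<subseteq> subspace_completion F"
      unfolding subspace_completion_def using G(3) by (intro closure_mono image_mono)
    then have "\<not> (\<exists>W\<subseteq>subspace_completion G. subspace W \<and> isomorphic_subspaces c0 W)"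
      using no_c0 by (meson subset_trans)
    then obtain v where "v \<in> G" "R \<le> norm v" "avoids \<C> (thicken (embed ` Z) (embed v))"
      using long_avoiding_vector[OF \<C>(1) G(1,2)] Z by blast
    then show "\<exists>v\<in>G. R \<le> norm v \<and> ?Good {z + s *\<^sub>R v | z s. z \<in> Z \<and> \<bar>s\<bar> \<le> 1}"
      unfolding thicken_def[symmetric] emb_thick using Z compact_thicken by blast
  qed
  then show ?thesis
    by (rule contrapos_nn) (auto elim!: antipodally_small_subset intro: avoids_subset)
qed

subsection \<open>The semigroup \<open>Gamma2\<close>\<close>

text \<open>For all large \<open>L\<close> a point of norm above \<open>L\<close> is fixed. For the
  other points, the finitely many sets meeting the compact set \<open>K\<close> of displaced centres
  contribute their subspaces to \<open>V'\<close>, and the remaining sets become obstacles for the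
  direction \<open>u\<close>.\<close>

lemma Gamma2_hat_step:
  fixes h :: "'a::real_normed_vector \<Rightarrow> 'a"
  assumes "h \<in> Gamma2_hat"
  shows "\<exists>L0. \<forall>L\<ge>L0. (\<forall>p. L < norm p \<longrightarrow> h p = p) \<and>
    (\<forall>x V r. subspace V \<longrightarrow> finite_dimensional V \<longrightarrow>
      (\<exists>V' \<C>. subspace V' \<and> finite_dimensional V' \<and> obstacles \<C> \<and> avoids \<C> {0} \<and>
        (\<forall>u p. norm u \<le> r \<longrightarrow> avoids \<C> {embed u} \<longrightarrow> norm p \<le> L \<longrightarrow> p - (x + u) \<in> V \<longrightarrow>
          L < norm (h p) \<or> h p - (x + u) \<in> V')))"
proof -
  obtain P :: "('a norm_completion set \<times> 'a set) set" where
    P: "\<And>S E. (S, E) \<in> P \<Longrightarrow> subspace E \<and> finite_dimensional E"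
    "\<And>S E. (S, E) \<in> P \<Longrightarrow> closedin weak_topology S" "locally_finite_in euclidean (fst ` P)"
    "bounded (\<Union>(fst ` P))" "\<And>S E y. (S, E) \<in> P \<Longrightarrow> embed y \<in> S \<Longrightarrow> h y - y \<in> E"
    "\<And>y. embed y \<notin> \<Union>(fst ` P) \<Longrightarrow> h y = y"
    using assms unfolding Gamma2_hat_def by fast
  let ?\<S> = "fst ` P"
  obtain L0 where L0: "\<And>y. y \<in> \<Union>?\<S> \<Longrightarrow> norm y \<le> L0"
    using P(4) unfolding bounded_iff by metis
  show ?thesis
  proof (intro exI[of _ L0] allI impI conjI)
    fix L :: real and p :: 'a assume "L0 \<le> L" "L < norm p"
    then have "embed p \<notin> \<Union>?\<S>" using L0[of "embed p"] by (auto simp: norm_embed)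
    then show "h p = p" by (rule P(6))
  next
    fix L r and x :: 'a and V :: "'a set" assume "L0 \<le> L" and V: "subspace V" "finite_dimensional V"
    obtain C where C: "compact C" "V \<inter> cball 0 (L + norm x + r) \<subseteq> C"
      using finite_dimensional_bounded_in_compact[OF V(2)] by metis
    define K where "K = (\<lambda>v. embed (x + v)) ` C"
    have "continuous_on C (\<lambda>v. embed (x + v))"
    proof -
      have "1-lipschitz_on C (\<lambda>v. embed (x + v))"
        by (rule lipschitz_onI) (simp_all add: dist_embed)
      then show ?thesis by (rule lipschitz_on_continuous_on)
    qed
    then have K: "compact K" unfolding K_def using C(1) by (rule compact_continuous_image)
    define \<S>0 where "\<S>0 = {S \<in> ?\<S>. S \<inter> K \<noteq> {}}"
    obtain \<delta> where "0 < \<delta>" "finite {S \<in> ?\<S>. \<exists>p\<in>K. \<exists>q\<in>S. dist p q \<le> \<delta>}"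
      by (rule locally_finite_near_compact[OF P(3) K])
    then have fin: "finite \<S>0"
      unfolding \<S>0_def by (elim finite_subset[rotated]) force
    \<comment> \<open>Each of the subspaces paired with \<open>S\<close> contains the displacements
      on \<open>S\<close>, so an arbitrary one is selected.\<close>
    define E where "E S = (SOME E. (S, E) \<in> P)" for S
    have E: "(S, E S) \<in> P" if "S \<in> ?\<S>" for S
      unfolding E_def using that by (intro someI_ex[of "\<lambda>E. (S, E) \<in> P"]) auto
    define V' where "V' = span (V \<union> span (\<Union>S\<in>\<S>0. E S))"
    have "finite_dimensional V'"
      unfolding V'_def using V(2) fin E P(1)
      by (intro finite_dimensional_span_Un finite_dimensional_span_UN) (auto simp: \<S>0_def)
    moreover have "subspace V'" by (simp add: V'_def)
    moreover have "obstacles {(K, ?\<S> - \<S>0)}"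
    proof -
      have "locally_finite_in euclidean (?\<S> - \<S>0)"
        using P(3) by (rule locally_finite_in_subset) auto
      then show ?thesis using K P(2) by (auto simp: obstacles_def)
    qed
    moreover have "avoids {(K, ?\<S> - \<S>0)} {0}"
      by (auto simp: avoids_def \<S>0_def)
    moreover have "L < norm (h p) \<or> h p - (x + u) \<in> V'"
      if u: "norm u \<le> r" "avoids {(K, ?\<S> - \<S>0)} {embed u}" and p: "norm p \<le> L" "p - (x + u) \<in> V" for u p
    proof -
      have pV: "p - (x + u) \<in> V'" unfolding V'_def using p(2) by (intro span_base) auto
      have "norm (p - (x + u)) \<le> L + norm x + r"
        using norm_triangle_ineq4[of p "x + u"] norm_triangle_ineq[of x u] u(1) p(1) by linarith
      then have "p - (x + u) \<in> C" using C(2) p(2) by auto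
      \<comment> \<open>The position is the direction \<open>u\<close> plus a point of
        \<open>K\<close>, so avoidance rules out all sets that miss \<open>K\<close>.\<close>
      moreover have "embed p = embed u + embed (x + (p - (x + u)))"
        by (simp flip: linear_add[OF linear_embed])
      ultimately have notin: "embed p \<notin> \<Union>(?\<S> - \<S>0)"
        using u(2) unfolding avoids_def K_def by (metis (no_types, lifting) case_prodD imageI singletonI)
      show ?thesis
      proof (cases "embed p \<in> \<Union>?\<S>")
        case True
        then obtain S where S: "S \<in> \<S>0" "embed p \<in> S" using notin by blast
        then have "h p - p \<in> E S" using P(5)[OF E] by (auto simp: \<S>0_def)
        then have "h p - p \<in> V'" unfolding V'_def using S(1) by (intro span_base UnI2) blast
        then have "(h p - p) + (p - (x + u)) \<in> V'"
          using pV \<open>subspace V'\<close> by (intro subspace_add)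
        moreover have "(h p - p) + (p - (x + u)) = h p - (x + u)" by (simp add: algebra_simps)
        ultimately show ?thesis by metis
      next
        case False
        then show ?thesis using P(6) pV by metis
      qed
    qed
    ultimately show "\<exists>V' \<C>. subspace V' \<and> finite_dimensional V' \<and> obstacles \<C> \<and> avoids \<C> {0} \<and>
        (\<forall>u p. norm u \<le> r \<longrightarrow> avoids \<C> {embed u} \<longrightarrow> norm p \<le> L \<longrightarrow> p - (x + u) \<in> V \<longrightarrow>
          L < norm (h p) \<or> h p - (x + u) \<in> V')"
      by (intro exI[of _ V'] exI[of _ "{(K, ?\<S> - \<S>0)}"] conjI allI impI)
  qed
qed

text \<open>A common \<open>L\<close> and the union of the obstacles serve for a composition: a
  point pushed beyond \<open>L\<close> by the inner map is fixed by the outer one and remains beyond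
  \<open>L\<close>.\<close>

lemma Gamma2_step:
  fixes g :: "'a::real_normed_vector \<Rightarrow> 'a"
  assumes "g \<in> Gamma2"
  shows "\<exists>L0. \<forall>L\<ge>L0. (\<forall>p. L < norm p \<longrightarrow> g p = p) \<and>
    (\<forall>x V r. subspace V \<longrightarrow> finite_dimensional V \<longrightarrow>
      (\<exists>V' \<C>. subspace V' \<and> finite_dimensional V' \<and> obstacles \<C> \<and> avoids \<C> {0} \<and>
        (\<forall>u p. norm u \<le> r \<longrightarrow> avoids \<C> {embed u} \<longrightarrow> norm p \<le> L \<longrightarrow> p - (x + u) \<in> V \<longrightarrow>
          L < norm (g p) \<or> g p - (x + u) \<in> V')))"
  using assms unfolding Gamma2_def
proof (induction rule: semigroup_generated.induct)
  case (generator h)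
  then show ?case by (rule Gamma2_hat_step)
next
  case (comp g h)
  obtain Lg where g: "\<And>L p. Lg \<le> L \<Longrightarrow> L < norm p \<Longrightarrow> g p = p"
    "\<And>L x V r. Lg \<le> L \<Longrightarrow> subspace V \<Longrightarrow> finite_dimensional V \<Longrightarrow>
      \<exists>V' \<C>. subspace V' \<and> finite_dimensional V' \<and> obstacles \<C> \<and> avoids \<C> {0} \<and>
        (\<forall>u p. norm u \<le> r \<longrightarrow> avoids \<C> {embed u} \<longrightarrow> norm p \<le> L \<longrightarrow> p - (x + u) \<in> V \<longrightarrow>
          L < norm (g p) \<or> g p - (x + u) \<in> V')"
    using comp.IH(1) by blast
  obtain Lh where h: "\<And>L p. Lh \<le> L \<Longrightarrow> L < norm p \<Longrightarrow> h p = p"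
    "\<And>L x V r. Lh \<le> L \<Longrightarrow> subspace V \<Longrightarrow> finite_dimensional V \<Longrightarrow>
      \<exists>V' \<C>. subspace V' \<and> finite_dimensional V' \<and> obstacles \<C> \<and> avoids \<C> {0} \<and>
        (\<forall>u p. norm u \<le> r \<longrightarrow> avoids \<C> {embed u} \<longrightarrow> norm p \<le> L \<longrightarrow> p - (x + u) \<in> V \<longrightarrow>
          L < norm (h p) \<or> h p - (x + u) \<in> V')"
    using comp.IH(2) by blast
  show ?case
  proof (intro exI[of _ "max Lg Lh"] allI impI conjI)
    fix L :: real and p :: 'a assume "max Lg Lh \<le> L" "L < norm p"
    then have "h p = p" "g p = p" using g(1)[of L p] h(1)[of L p] by auto
    then show "(g \<circ> h) p = p" by simp
  next
    fix L r and x :: 'a and V :: "'a set" assume "max Lg Lh \<le> L" and V: "subspace V" "finite_dimensional V"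
    then have L: "Lg \<le> L" "Lh \<le> L" by auto
    obtain V1 \<C>1 where 1: "subspace V1" "finite_dimensional V1" "obstacles \<C>1" "avoids \<C>1 {0}"
      "\<And>u p. norm u \<le> r \<Longrightarrow> avoids \<C>1 {embed u} \<Longrightarrow> norm p \<le> L \<Longrightarrow> p - (x + u) \<in> V \<Longrightarrow>
          L < norm (h p) \<or> h p - (x + u) \<in> V1"
      using h(2)[OF L(2) V, of r x] by blast
    obtain V2 \<C>2 where 2: "subspace V2" "finite_dimensional V2" "obstacles \<C>2" "avoids \<C>2 {0}"
      "\<And>u p. norm u \<le> r \<Longrightarrow> avoids \<C>2 {embed u} \<Longrightarrow> norm p \<le> L \<Longrightarrow> p - (x + u) \<in> V1 \<Longrightarrow>
          L < norm (g p) \<or> g p - (x + u) \<in> V2"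
      using g(2)[OF L(1) 1(1,2), of r x] by blast
    have "obstacles (\<C>1 \<union> \<C>2)" "avoids (\<C>1 \<union> \<C>2) {0}"
      using 1 2 unfolding obstacles_def avoids_def by auto
    moreover have "L < norm ((g \<circ> h) p) \<or> (g \<circ> h) p - (x + u) \<in> V2"
      if u: "norm u \<le> r" "avoids (\<C>1 \<union> \<C>2) {embed u}" and p: "norm p \<le> L" "p - (x + u) \<in> V" for u p
    proof -
      have a: "avoids \<C>1 {embed u}" "avoids \<C>2 {embed u}" using u(2) unfolding avoids_def by auto
      show ?thesis
      proof (cases "L < norm (h p)")
        case True
        then show ?thesis using g(1)[OF L(1) True] by simp
      next
        case False
        then have "h p - (x + u) \<in> V1" using 1(5)[OF u(1) a(1) p] by simp
        then show ?thesis using 2(5)[OF u(1) a(2)] False by simp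
      qed
    qed
    ultimately show "\<exists>V' \<C>. subspace V' \<and> finite_dimensional V' \<and> obstacles \<C> \<and> avoids \<C> {0} \<and>
        (\<forall>u p. norm u \<le> r \<longrightarrow> avoids \<C> {embed u} \<longrightarrow> norm p \<le> L \<longrightarrow> p - (x + u) \<in> V \<longrightarrow>
          L < norm ((g \<circ> h) p) \<or> (g \<circ> h) p - (x + u) \<in> V')"
      using 2(1,2) by (intro exI[of _ V2] exI[of _ "\<C>1 \<union> \<C>2"] conjI allI impI)
  qed
qed

theorem non_shrinking_Gamma2:
  fixes F :: "'a::real_normed_vector set"
  assumes F: "subspace F" "\<not> finite_dimensional F"
    and no_c0: "\<not> (\<exists>W\<subseteq>subspace_completion F. subspace W \<and> isomorphic_subspaces c0 W)"
  shows "non_shrinking (Gamma2 :: ('a \<Rightarrow> 'a) set)"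
  unfolding non_shrinking_def
proof
  assume "\<exists>g\<in>Gamma2. \<exists>x::'a. \<exists>r>0. \<exists>\<B>. finite \<B> \<and> (\<forall>(y, s)\<in>\<B>. s < r) \<and>
    g ` cball x r \<subseteq> (\<Union>(y, s)\<in>\<B>. cball y s)"
  then obtain g and x :: 'a and r \<B> where g: "g \<in> Gamma2" "0 < r" "finite \<B>" "\<forall>(y, s)\<in>\<B>. s < r"
    "g ` cball x r \<subseteq> (\<Union>(y, s)\<in>\<B>. cball y s)"
    by blast
  have "bounded (\<Union>(y, s)\<in>\<B>. cball y s)"
    using g(3) by (intro bounded_UN) auto
  then have "bounded (g ` cball x r)" using g(5) by (rule bounded_subset)
  then obtain M where M: "\<And>p. p \<in> cball x r \<Longrightarrow> norm (g p) \<le> M"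
    unfolding bounded_iff by blast
  obtain L0 where L0: "\<And>L x V r. L0 \<le> L \<Longrightarrow> subspace V \<Longrightarrow> finite_dimensional V \<Longrightarrow>
      \<exists>V' \<C>. subspace V' \<and> finite_dimensional V' \<and> obstacles \<C> \<and> avoids \<C> {0} \<and>
        (\<forall>u p. norm u \<le> r \<longrightarrow> avoids \<C> {embed u} \<longrightarrow> norm p \<le> L \<longrightarrow> p - (x + u) \<in> V \<longrightarrow>
          L < norm (g p) \<or> g p - (x + u) \<in> V')"
    using Gamma2_step[OF g(1)] by blast
  \<comment> \<open>\<open>L\<close> exceeds the norms of the points of the ball and, because
    finitely many balls cover the image, the norms of their images; this excludes the alternative of
    escaping beyond \<open>L\<close>.\<close>
  define L where "L = max L0 (max M (norm x + r))"
  have L: "L0 \<le> L" "M \<le> L" "norm x + r \<le> L" by (auto simp: L_def)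
  obtain V \<C> where V: "finite_dimensional V" "obstacles \<C>" "avoids \<C> {0}"
    and step: "\<And>u p. norm u \<le> r \<Longrightarrow> avoids \<C> {embed u} \<Longrightarrow> norm p \<le> L \<Longrightarrow> p - (x + u) \<in> {0} \<Longrightarrow>
          L < norm (g p) \<or> g p - (x + u) \<in> V"
    using L0[OF L(1) subspace_single_0 finite_dimensional_0, of r x] by blast
  let ?A = "{u. norm u = r \<and> avoids \<C> {embed u}}"
  show False
  proof (rule displaced_sphere_not_covered[of ?A r V g x \<B>])
    show "\<not> antipodally_small ?A"
      by (rule avoiding_directions_not_small[OF V(2,3) F no_c0 g(2)])
    fix u assume u: "u \<in> ?A"
    have "norm (x + u) \<le> L" using norm_triangle_ineq[of x u] u L(3) by auto
    moreover have "norm (g (x + u)) \<le> L" using M[of "x + u"] u L(2) by (auto simp: dist_norm)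
    ultimately show "g (x + u) - (x + u) \<in> V" using step[of u "x + u"] u by auto
  qed (use g V in auto)
qed

theorem theorem3p1:
  assumes "\<not> finite_dimensional (UNIV :: 'a::real_normed_vector set)"
  shows "non_shrinking (Gamma1 :: ('a \<Rightarrow> 'a) set) \<and>
    ((\<exists>F :: 'a set. subspace F \<and> \<not> finite_dimensional F \<and>
        \<not> (\<exists>W \<subseteq> subspace_completion F. subspace W \<and> isomorphic_subspaces c0 W))
      \<longrightarrow> non_shrinking (Gamma2 :: ('a \<Rightarrow> 'a) set))"
  using non_shrinking_Gamma1[OF assms] non_shrinking_Gamma2 by blast

end
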